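(* Let $p\in(0,\infty)$ and let $Y(0,1)$ be a $p$-convex rearrangement-invariant quasi-Banach function space. Let $(b_1,b_2)\in\mathcal B_p$. Furthermore, assume that the function $(0,1)\ni\tau\mapsto b_1(\tau)b_2(\tau)^{-1}$ is strictly decreasing and that the limit $$\lim_{s\to0^+}b_2(s)^p\int_s^1\frac{d\tau}{\tau\,b_1(\tau)^p}$$ exists and belongs to $(0,\infty)$. Then $$\|S_{b_1,p}(f^* )\|_{Y(0,1)}\lesssim\|U_{b_1,b_2,p}f\|_{Y(0,1)}\quad\text{for every } f\in\mathcal M(0,1),$$ with a multiplicative constant independent of $f$. Moreover, let $X(0,1)$ be another rearrangement-invariant quasi-Banach function space that is $p$-convex. If $U_{b_1,b_2,p}$ is bounded from $X(0,1)$ to $Y(0,1)$, then so is $S_{b_1,p}$.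
   Context: Functions and rearrangements. $\mathcal M(0,1)$ is the set of Lebesgue measurable complex-valued functions on $(0,1)$ (identified when equal a.e.); $\mathcal M_+(0,1)$ its nonnegative members. For $f\in\mathcal M(0,1)$, $f^*(t)=\inf\{\lambda\in(0,\infty):|\{x\in(0,1):|f(x)|>\lambda\}|\le t\}$, $t\in(0,1)$. $P\lesssim Q$ means $P\le cQ$ with a constant $c>0$ independent of the appropriate quantities; $P\approx Q$ means $P\lesssim Q$ and $Q\lesssim P$. R.i. spaces. A functional $\|\cdot\|_{X(0,1)}\colon\mathcal M_+(0,1)\to[0,\infty]$ is a rearrangement-invariant (r.i.) Banach function norm if for all $f,g,f_k\in\mathcal M_+(0,1)$ and $\lambda\ge0$: (P1) $\|f\|=0$ iff $f=0$ a.e., $\|\lambda f\|=\lambda\|f\|$, $\|f+g\|\le\|f\|+\|g\|$; (P2) $f\le g$ a.e. implies $\|f\|\le\|g\|$; (P3) $f_k\nearrow f$ a.e. implies $\|f_k\|\nearrow\|f\|$; (P4) $\|1\|<\infty$; (P5) $\int_0^1 f\le C_X\|f\|$ with $C_X$ independent of $f$; (P6) $f^*=g^*$ implies $\|f\|=\|g\|$. It is an r.i. quasi-Banach function norm if it satisfies (P2), (P3), (P4), (P6) and (P1) with the triangle inequality replaced by $\|f+g\|\le C(\|f\|+\|g\|)$ for some constant $C\ge1$ ((P5) not required). It is extended to $f\in\mathcal M(0,1)$ by $\|f\|_{X(0,1)}=\|f^*\|_{X(0,1)}$, and $X(0,1)=\{f\in\mathcal M(0,1):\|f\|_{X(0,1)}<\infty\}$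 is the corresponding r.i. (quasi-)Banach function space. $X(0,1)$ is $p$-convex if $\|f\|_{X^{1/p}(0,1)}=\|f^{1/p}\|_{X(0,1)}^p$, $f\in\mathcal M_+(0,1)$, is an r.i. Banach function norm. Slowly varying functions. A measurable $b\colon(0,1)\to(0,\infty)$ is slowly varying if for every $\varepsilon>0$ there are a nondecreasing $b_\varepsilon$ and a nonincreasing $b_{-\varepsilon}$ with $t^\varepsilon b(t)\approx b_\varepsilon(t)$ and $t^{-\varepsilon}b(t)\approx b_{-\varepsilon}(t)$ on $(0,1)$. The class $\mathcal B_p$ consists of pairs $(b_1,b_2)$ of slowly varying functions such that: (a) $b_1,b_2$ are continuous on $(0,1)$; (b) $b_1$ is nonincreasing and $b_2$ is nondecreasing; (c) $b_1(t)\approx b_1\big(t\,b_1(t)^pb_2(t)^{-p}\big)$ near $0^+$; (d) $\sup_{0<t<1}b_2(t)^p\int_t^1\frac{ds}{s\,b_1(s)^p}<\infty$. $\sigma\colon[0,1]\to[0,1]$ is the increasing bijection satisfying $t^p=\frac1{C_0}\int_0^{\sigma(t)^p}[b_1(s)b_2(s)^{-1}]^p\,ds$ for every $t\in[0,1]$, where $C_0=\int_0^1[b_1(s)b_2(s)^{-1}]^p\,ds$; $\sigma^{-1}$ is its inverse, and $\sigma^{-1}(t^{1/p})^p=(\sigma^{-1}(t^{1/p}))^p$. For $f\in\mathcal M(0,1)$ and $t\in(0,1)$: $U_{b_1,b_2,p}f(t)=f^*(\sigma^{-1}(t^{1/p})^p)\,b_2(t)^{-1}$ and $S_{b_1,p}f(t)=\left(\int_t^1\frac{|f(s)|^p}{s\,b_1(s)^p}\,ds\right)^{1/p}$.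 A (not necessarily linear) operator $T$ is bounded from $X(0,1)$ to $Y(0,1)$ if there is a constant $C$ with $\|Tf\|_{Y(0,1)}\le C\|f\|_{X(0,1)}$ for all $f\in X(0,1)$. *)

theory Defs
  imports "HOL-Analysis.Analysis"
begin

section \<open>Measurable functions on (0,1) and rearrangements\<close>

text \<open>
  Functions on (0,1) are total functions on the reals; only their values on (0,1) matter.
  Equality and inequality almost everywhere are stated explicitly instead of passing to
  equivalence classes.
\<close>

definition M_space :: "(real \<Rightarrow> complex) set" where
  "M_space = borel_measurable (lebesgue_on {0<..<1})"

definition M_plus :: "(real \<Rightarrow> real) set" where
  "M_plus = {f \<in> borel_measurable (lebesgue_on {0<..<1}). \<forall>x\<in>{0<..<1}. 0 \<le> f x}"

text \<open>Polymorphic, since it is applied both to complex functions and to members of \<open>M_plus\<close>.\<close>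

definition rearr :: "(real \<Rightarrow> 'a::real_normed_vector) \<Rightarrow> real \<Rightarrow> real" where
  "rearr f t = Inf {l. 0 < l \<and> measure lebesgue {x\<in>{0<..<1}. norm (f x) > l} \<le> t}"

definition approx_on :: "real set \<Rightarrow> (real \<Rightarrow> real) \<Rightarrow> (real \<Rightarrow> real) \<Rightarrow> bool" where
  "approx_on A f g \<longleftrightarrow>
     (\<exists>c>0. \<forall>t\<in>A. f t \<le> c * g t) \<and> (\<exists>c>0. \<forall>t\<in>A. g t \<le> c * f t)"

text \<open>Real powers on \<open>[0,\<infinity>]\<close>, for exponents \<open>p > 0\<close>.\<close>

definition epow :: "ennreal \<Rightarrow> real \<Rightarrow> ennreal" where
  "epow x p = (if x = \<infinity> then \<infinity> else ennreal (enn2real x powr p))"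


section \<open>Rearrangement-invariant (quasi-)Banach function norms\<close>

text \<open>The axioms shared by norms and quasinorms: (P1) without the triangle inequality,
  (P2), (P3), (P4) and (P6).\<close>

definition ri_functional :: "((real \<Rightarrow> real) \<Rightarrow> ennreal) \<Rightarrow> bool" where
  "ri_functional N \<longleftrightarrow>
     (\<forall>f\<in>M_plus. N f = 0 \<longleftrightarrow> (AE x in lebesgue_on {0<..<1}. f x = 0)) \<and>
     (\<forall>f\<in>M_plus. \<forall>l\<ge>0. N (\<lambda>x. l * f x) = ennreal l * N f) \<and>
     (\<forall>f\<in>M_plus. \<forall>g\<in>M_plus.
        (AE x in lebesgue_on {0<..<1}. f x \<le> g x) \<longrightarrow> N f \<le> N g) \<and>
     (\<forall>F f. (\<forall>k::nat. F k \<in> M_plus) \<and> f \<in> M_plus \<and>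
        (AE x in lebesgue_on {0<..<1}. incseq (\<lambda>k. F k x) \<and> (\<lambda>k. F k x) \<longlonglongrightarrow> f x) \<longrightarrow>
        incseq (\<lambda>k. N (F k)) \<and> (\<lambda>k. N (F k)) \<longlonglongrightarrow> N f) \<and>
     N (\<lambda>_. 1) < \<infinity> \<and>
     (\<forall>f\<in>M_plus. \<forall>g\<in>M_plus. (\<forall>t\<in>{0<..<1}. rearr f t = rearr g t) \<longrightarrow> N f = N g)"

definition ri_banach_norm :: "((real \<Rightarrow> real) \<Rightarrow> ennreal) \<Rightarrow> bool" where
  "ri_banach_norm N \<longleftrightarrow> ri_functional N \<and>
     (\<forall>f\<in>M_plus. \<forall>g\<in>M_plus. N (\<lambda>x. f x + g x) \<le> N f + N g) \<and>
     (\<exists>C::real. C > 0 \<and> (\<forall>f\<in>M_plus.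
        (\<integral>\<^sup>+x\<in>{0<..<1}. ennreal (f x) \<partial>lebesgue) \<le> ennreal C * N f))"

definition ri_quasi_banach_norm :: "((real \<Rightarrow> real) \<Rightarrow> ennreal) \<Rightarrow> bool" where
  "ri_quasi_banach_norm N \<longleftrightarrow> ri_functional N \<and>
     (\<exists>C::real. C \<ge> 1 \<and>
        (\<forall>f\<in>M_plus. \<forall>g\<in>M_plus. N (\<lambda>x. f x + g x) \<le> ennreal C * (N f + N g)))"

definition p_convex :: "real \<Rightarrow> ((real \<Rightarrow> real) \<Rightarrow> ennreal) \<Rightarrow> bool" where
  "p_convex p N \<longleftrightarrow> ri_banach_norm (\<lambda>f. epow (N (\<lambda>x. f x powr (1 / p))) p)"

definition ri_norm :: "((real \<Rightarrow> real) \<Rightarrow> ennreal) \<Rightarrow> (real \<Rightarrow> complex) \<Rightarrow> ennreal" where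
  "ri_norm N f = N (rearr f)"

definition ri_space :: "((real \<Rightarrow> real) \<Rightarrow> ennreal) \<Rightarrow> (real \<Rightarrow> complex) set" where
  "ri_space N = {f \<in> M_space. ri_norm N f < \<infinity>}"

text \<open>
  The integral operator below may take the value \<open>\<infinity>\<close>, so operators produce
  \<open>[0,\<infinity>]\<close>-valued functions. Such a function is (a.e. equal to) a member of \<open>M_plus\<close> iff it is
  finite a.e., and then its norm is that of the member; otherwise its norm is \<open>\<infinity>\<close>, which is the
  only value compatible with (P1), (P2) and (P3). Thus finiteness of the norm of \<open>T f\<close> includes
  the assertion that \<open>T f\<close> is finite a.e.
\<close>

definition ext_norm :: "((real \<Rightarrow> real) \<Rightarrow> ennreal) \<Rightarrow> (real \<Rightarrow> ennreal) \<Rightarrow> ennreal" where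
  "ext_norm N g =
     (if AE x in lebesgue_on {0<..<1}. g x < \<infinity> then N (\<lambda>x. enn2real (g x)) else \<infinity>)"

definition bounded_op ::
  "((real \<Rightarrow> real) \<Rightarrow> ennreal) \<Rightarrow> ((real \<Rightarrow> real) \<Rightarrow> ennreal) \<Rightarrow>
   ((real \<Rightarrow> complex) \<Rightarrow> real \<Rightarrow> ennreal) \<Rightarrow> bool" where
  "bounded_op NX NY T \<longleftrightarrow>
     (\<exists>C::real. C > 0 \<and> (\<forall>f\<in>ri_space NX. ext_norm NY (T f) \<le> ennreal C * ri_norm NX f))"


section \<open>Slowly varying functions and the two operators\<close>

definition slowly_varying :: "(real \<Rightarrow> real) \<Rightarrow> bool" where
  "slowly_varying b \<longleftrightarrow>
     b \<in> borel_measurable (lebesgue_on {0<..<1}) \<and> (\<forall>t\<in>{0<..<1}. 0 < b t) \<and>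
     (\<forall>\<epsilon>>0. (\<exists>g. mono_on {0<..<1} g \<and> approx_on {0<..<1} (\<lambda>t. t powr \<epsilon> * b t) g) \<and>
            (\<exists>h. antimono_on {0<..<1} h \<and> approx_on {0<..<1} (\<lambda>t. t powr (- \<epsilon>) * b t) h))"

text \<open>In the condition near 0, the argument of the outer \<open>b1\<close> tends to 0 as
  \<open>t\<close> tends to 0 by slow variation, so it lies in (0,1) for small \<open>t\<close>.\<close>

definition B_class :: "real \<Rightarrow> ((real \<Rightarrow> real) \<times> (real \<Rightarrow> real)) set" where
  "B_class p = {(b1, b2).
     slowly_varying b1 \<and> slowly_varying b2 \<and>
     continuous_on {0<..<1} b1 \<and> continuous_on {0<..<1} b2 \<and>
     antimono_on {0<..<1} b1 \<and> mono_on {0<..<1} b2 \<and>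
     (\<exists>\<delta>\<in>{0<..<1}. approx_on {0<..<\<delta>} b1 (\<lambda>t. b1 (t * b1 t powr p * b2 t powr (- p)))) \<and>
     (SUP t\<in>{0<..<1}. ennreal (b2 t powr p) *
        (\<integral>\<^sup>+s\<in>{t<..<1}. ennreal (1 / (s * b1 s powr p)) \<partial>lebesgue)) < \<infinity>}"

definition is_sigma :: "real \<Rightarrow> (real \<Rightarrow> real) \<Rightarrow> (real \<Rightarrow> real) \<Rightarrow> (real \<Rightarrow> real) \<Rightarrow> bool" where
  "is_sigma p b1 b2 \<sigma> \<longleftrightarrow>
     bij_betw \<sigma> {0..1} {0..1} \<and> strict_mono_on {0..1} \<sigma> \<and>
     (\<forall>t\<in>{0..1}. t powr p =
        1 / (LINT s:{0<..<1}|lebesgue. (b1 s / b2 s) powr p) *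
        (LINT s:{0<..<\<sigma> t powr p}|lebesgue. (b1 s / b2 s) powr p))"

text \<open>The defining equation determines the values on [0,1] only, hence a choice operator
  instead of a definite description.\<close>

definition sigma :: "real \<Rightarrow> (real \<Rightarrow> real) \<Rightarrow> (real \<Rightarrow> real) \<Rightarrow> real \<Rightarrow> real" where
  "sigma p b1 b2 = (SOME \<sigma>. is_sigma p b1 b2 \<sigma>)"

definition U_op ::
  "(real \<Rightarrow> real) \<Rightarrow> (real \<Rightarrow> real) \<Rightarrow> real \<Rightarrow> (real \<Rightarrow> complex) \<Rightarrow> real \<Rightarrow> ennreal" where
  "U_op b1 b2 p f t =
     ennreal (rearr f (the_inv_into {0..1} (sigma p b1 b2) (t powr (1 / p)) powr p) / b2 t)"

definition S_op ::
  "(real \<Rightarrow> real) \<Rightarrow> real \<Rightarrow> (real \<Rightarrow> 'a::real_normed_vector) \<Rightarrow> real \<Rightarrow> ennreal" where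
  "S_op b1 p f t =
     epow (\<integral>\<^sup>+s\<in>{t<..<1}. ennreal (norm (f s) powr p / (s * b1 s powr p)) \<partial>lebesgue) (1 / p)"

end

theory Submission
  imports Defs
begin

text \<open>
  Everything is done after raising to the power p. Since NY is p-convex, the functional
  Z h = (NY of h^(1/p))^p is a rearrangement-invariant Banach function norm, and for such norms
  the Hardy-Littlewood-Polya principle holds: if f and g are nonnegative and nonincreasing and
  the integral of f over (0,x) is at most that of g for every x, then Z f \<le> Z g (lemma
  \<open>HLP_principle\<close>). So norm inequalities reduce to inequalities between integrals over (0,x).

  Write w = (b1/b2)^p, let phi be the normalized primitive of w, and v(s) = 1/(s b1(s)^p). The
  equation that defines sigma says that the argument of the rearrangement in U is exactly phi(t),
  so the p-th power of U f is h(phi(t)) / b2(t)^p with h = (f*)^p, while the p-th power of S f*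
  is the integral of h v over (t,1).

  For nonincreasing h the integral of S over (0,x) is dominated by that of U (lemma
  \<open>S_majorized_by_U\<close>). To see this, cut the inner integral at phi(x). For s \<ge> phi(x) one has
  h(s) \<le> h(phi(t)), and the integral of v over (t,1) is at most a constant times b2(t)^(-p) by
  condition (d); this part is dominated pointwise. For s < phi(x), Tonelli's theorem turns the
  integral into that of h / b1^p over (0, phi(x)), and the substitution s = phi(t) produces
  h(phi(t)) w(t) / b1(phi(t))^p. As w = b1^p b2^(-p), it only remains to know that b1(t) is at
  most a constant times b1(phi(t)). By Karamata's estimate phi(t) is at most a constant times
  t w(t), and for the argument t w(t) the comparison is condition (c). This settles the first
  claim, for S applied to a rearrangement.

  In the second claim S acts on f itself, and S f is in general not controlled by S f*, not even in norm.
  Instead, f is replaced by another function: the least nonincreasing majorant g^p of the step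
  function formed by the averages of |f|^p over the dyadic intervals. Because the weight
  s b1(s)^p is almost increasing, S f(t) is bounded by a constant times S g*(t/4)
  (lemma \<open>dyadic_tail\<close>). On the other hand
  the integral of g^p over (0,x) is at most four times that of (f*)^p
  (lemma \<open>dyadic_major_integral\<close>), so that the norm of g in X is at most a constant times that
  of f, by the Hardy-Littlewood-Polya principle in X. The assumed bound for U at g
  finishes the proof.
\<close>

section \<open>Weak majorization of vectors and of step functions\<close>

text \<open>
  Muirhead's argument. At the first index k with x k > y k some earlier index j has slack x j
  < y j. Moving mass from j to k (a Robin Hood transfer, which is a convex combination of y
  and y with the entries j and k exchanged) preserves all the partial sum inequalities and
  makes y agree with x in at least one more entry. Since y is never sorted in the process,
  monotonicity is assumed of x alone.
\<close>
lemma weak_majorization: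
  fixes nu :: "(nat \<Rightarrow> real) \<Rightarrow> ennreal" and N :: nat
  assumes mono: "\<And>x y. (\<And>i. i < N \<Longrightarrow> 0 \<le> x i \<and> x i \<le> y i) \<Longrightarrow> nu x \<le> nu y"
    and convex: "\<And>x y a. (\<And>i. i < N \<Longrightarrow> 0 \<le> x i \<and> 0 \<le> y i) \<Longrightarrow> 0 \<le> a \<Longrightarrow> a \<le> 1 \<Longrightarrow>
        nu (\<lambda>i. a * x i + (1 - a) * y i) \<le> ennreal a * nu x + ennreal (1 - a) * nu y"
    and sym: "\<And>x j k. (\<And>i. i < N \<Longrightarrow> 0 \<le> x i) \<Longrightarrow> j < N \<Longrightarrow> k < N \<Longrightarrow>
        nu (\<lambda>i. x (Transposition.transpose j k i)) = nu x"
    and x: "\<And>i. i < N \<Longrightarrow> 0 \<le> x i" "antimono_on {..<N} x"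
    and y: "\<And>i. i < N \<Longrightarrow> 0 \<le> y i"
    and maj: "\<And>k. k \<le> N \<Longrightarrow> (\<Sum>i<k. x i) \<le> (\<Sum>i<k. y i)"
  shows "nu x \<le> nu y"
  using y maj
proof (induction "card {i\<in>{..<N}. x i \<noteq> y i}" arbitrary: y rule: less_induct)
  case less
  note y = less.prems(1) and maj = less.prems(2)
  show ?case
  proof (cases "\<forall>i<N. x i \<le> y i")
    case True
    then show ?thesis using x by (intro mono) auto
  next
    case False
    define k where "k = (LEAST k. k < N \<and> y k < x k)"
    have k: "k < N" "y k < x k"
      using LeastI_ex[of "\<lambda>k. k < N \<and> y k < x k"] False unfolding k_def by (auto simp: not_le)
    have before: "x i \<le> y i" if "i < k" for i
      using not_less_Least[of i "\<lambda>k. k < N \<and> y k < x k"] that k unfolding k_def[symmetric] by auto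
    have "\<exists>j<k. x j < y j"
    proof (rule ccontr)
      assume "\<not> ?thesis"
      then have "\<forall>i<k. y i \<le> x i" by (meson not_less)
      then have "(\<Sum>i<k. y i) \<le> (\<Sum>i<k. x i)"
        by (intro sum_mono) simp
      with maj[of "Suc k"] k show False by simp
    qed
    then obtain j where j: "j < k" "x j < y j" by blast
    have jN: "j < N" using j k by simp
    have xjk: "x k \<le> x j" using x(2) j k jN by (auto simp: monotone_on_def)
    \<comment> \<open>The largest transfer that does not overshoot at j or at k; it makes one of the two entries equal.\<close>
    define d where "d = min (y j - x j) (x k - y k)"
    have d: "0 < d" "d \<le> y j - x j" "d \<le> x k - y k" "d = y j - x j \<or> d = x k - y k"
      unfolding d_def using j k by (auto simp: min_def)
    define y' where "y' = y(j := y j - d, k := y k + d)"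
    have y'0: "0 \<le> y' i" if "i < N" for i
      using y[OF that] d x(1)[OF that] y[OF k(1)] x(1)[OF jN] unfolding y'_def by auto
    define a where "a = 1 - d / (y j - y k)"
    have den: "y j - y k > 0" using j k xjk by simp
    have a: "0 \<le> a" "a \<le> 1"
      using d den xjk k j unfolding a_def by (auto simp: field_simps)
    have "nu y' = nu (\<lambda>i. a * y i + (1 - a) * y (Transposition.transpose j k i))"
    proof (rule arg_cong[where f = nu], rule ext)
      fix i
      have "(1 - a) * (y j - y k) = d" using den by (simp add: a_def)
      then show "y' i = a * y i + (1 - a) * y (Transposition.transpose j k i)"
        using j unfolding y'_def Transposition.transpose_def by (auto simp: algebra_simps)
    qed
    also have "\<dots> \<le> ennreal a * nu y + ennreal (1 - a) * nu (\<lambda>i. y (Transposition.transpose j k i))"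
      using a y jN k by (intro convex) (auto simp: Transposition.transpose_def)
    also have "\<dots> = (ennreal a + ennreal (1 - a)) * nu y"
      using sym[of y j k] y jN k by (simp add: distrib_right)
    also have "\<dots> = nu y" using a by (simp flip: ennreal_plus)
    finally have le: "nu y' \<le> nu y" .
    have "nu x \<le> nu y'"
    proof (rule less.hyps)
      have "{i \<in> {..<N}. x i \<noteq> y' i} \<subset> {i \<in> {..<N}. x i \<noteq> y i}"
      proof
        show "{i \<in> {..<N}. x i \<noteq> y' i} \<subseteq> {i \<in> {..<N}. x i \<noteq> y i}"
          using j k unfolding y'_def by auto
        have "y' j = x j \<or> y' k = x k" using d(4) j unfolding y'_def by auto
        then have "j \<notin> {i \<in> {..<N}. x i \<noteq> y' i} \<or> k \<notin> {i \<in> {..<N}. x i \<noteq> y' i}" by auto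
        moreover have "j \<in> {i \<in> {..<N}. x i \<noteq> y i}" "k \<in> {i \<in> {..<N}. x i \<noteq> y i}"
          using jN j k by auto
        ultimately show "{i \<in> {..<N}. x i \<noteq> y' i} \<noteq> {i \<in> {..<N}. x i \<noteq> y i}"
          by metis
      qed
      then show "card {i \<in> {..<N}. x i \<noteq> y' i} < card {i \<in> {..<N}. x i \<noteq> y i}"
        by (intro psubset_card_mono) auto
    next
      fix m assume m: "m \<le> N"
      show "(\<Sum>i<m. x i) \<le> (\<Sum>i<m. y' i)"
      proof (cases "m \<le> k")
        case True
        then show ?thesis
          using before d j by (intro sum_mono) (auto simp: y'_def)
      next
        case False
        have "(\<Sum>i<m. y' i) = (\<Sum>i<m. y i + (if i = k then d else 0) - (if i = j then d else 0))"
          using j unfolding y'_def by (intro sum.cong) auto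
        also have "\<dots> = (\<Sum>i<m. y i)"
          using False j by (simp add: sum.distrib sum_subtractf)
        finally show ?thesis using maj[OF m] by simp
      qed
    qed (use y'0 in auto)
    with le show ?thesis by simp
  qed
qed

definition step :: "nat \<Rightarrow> (nat \<Rightarrow> real) \<Rightarrow> real \<Rightarrow> real" where
  "step N y t = y (nat \<lfloor>real N * t\<rfloor>)"

lemma nat_floor_less: "0 \<le> t \<Longrightarrow> t < 1 \<Longrightarrow> 0 < N \<Longrightarrow> nat \<lfloor>real N * t\<rfloor> < N"
  by (simp add: nat_less_iff floor_less_iff)

lemma step_M_plus:
  assumes "0 < N" "\<And>i. i < N \<Longrightarrow> 0 \<le> y i"
  shows "step N y \<in> M_plus"
proof -
  have "step N y \<in> borel_measurable borel"
    unfolding step_def by measurable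
  then have "step N y \<in> borel_measurable (lebesgue_on {0<..<1})"
    by (intro measurable_restrict_space1 measurable_completion) simp
  then show ?thesis
    using assms nat_floor_less unfolding M_plus_def step_def by auto
qed

text \<open>
  The level sets of a step function on a uniform grid are unions of cells of length 1/N, so
  the distribution function only counts entries; permuting entries does not change the
  rearrangement.
\<close>
lemma step_distribution:
  assumes "0 < N"
  shows "measure lebesgue {t\<in>{0<..<1}. norm (step N y t) > l} =
    real (card {i\<in>{..<N}. \<bar>y i\<bar> > l}) / real N"
proof -
  let ?A = "{i\<in>{..<N}. \<bar>y i\<bar> > l}"
  let ?J = "\<lambda>i::nat. {real i / real N ..< (real i + 1) / real N}"
  have J: "t \<in> ?J i \<longleftrightarrow> nat \<lfloor>real N * t\<rfloor> = i" if "0 \<le> t" for t i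
  proof -
    have "nat \<lfloor>real N * t\<rfloor> = i \<longleftrightarrow> \<lfloor>real N * t\<rfloor> = int i"
      using that assms by (auto simp: nat_eq_iff)
    also have "\<dots> \<longleftrightarrow> t \<in> ?J i"
      using assms by (simp add: floor_eq_iff field_simps)
    finally show ?thesis by blast
  qed
  have J01: "t \<in> {0..<1}" if "i < N" "t \<in> ?J i" for t i
  proof -
    have "0 \<le> real i / real N" "(real i + 1) / real N \<le> 1" using that assms by (auto simp: field_simps)
    moreover have "real i / real N \<le> t" "t < (real i + 1) / real N" using that by auto
    ultimately have "0 \<le> t" "t < 1" by linarith+
    then show ?thesis by simp
  qed
  have eq: "{t\<in>{0<..<1}. norm (step N y t) > l} = (\<Union>i\<in>?A. ?J i) - {0}"
  proof (intro equalityI subsetI)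
    fix t assume "t \<in> {t\<in>{0<..<1}. norm (step N y t) > l}"
    then show "t \<in> (\<Union>i\<in>?A. ?J i) - {0}"
      using J[of t "nat \<lfloor>real N * t\<rfloor>"] nat_floor_less[of t N] assms by (auto simp: step_def)
  next
    fix t assume t: "t \<in> (\<Union>i\<in>?A. ?J i) - {0}"
    then obtain i where i: "i \<in> ?A" "t \<in> ?J i" by blast
    then have "t \<in> {0..<1}" using J01 by auto
    with t i J[of t i] show "t \<in> {t\<in>{0<..<1}. norm (step N y t) > l}" by (auto simp: step_def)
  qed
  have disj: "disjoint_family_on ?J ?A"
    unfolding disjoint_family_on_def
  proof (intro ballI impI equals0I)
    fix i k t assume ik: "i \<in> ?A" "k \<in> ?A" "i \<noteq> k" and t: "t \<in> ?J i \<inter> ?J k"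
    then have "0 \<le> t" using J01[of i t] by auto
    with J[of t i] J[of t k] t ik show False by simp
  qed
  have "measure lebesgue ((\<Union>i\<in>?A. ?J i) - {0}) = measure lebesgue (\<Union>i\<in>?A. ?J i)"
    by (intro measure_Diff_null_set) (auto intro!: null_sets_completionI)
  also have "\<dots> = (\<Sum>i\<in>?A. measure lebesgue (?J i))"
    using emeasure_bounded_finite[OF bounded_Ico]
    by (intro measure_finite_Union disj) (auto simp: less_top)
  also have "\<dots> = (\<Sum>i\<in>?A. 1 / real N)"
    using assms by (intro sum.cong) (auto simp: divide_right_mono simp flip: diff_divide_distrib)
  finally show ?thesis unfolding eq by simp
qed

lemma step_equimeasurable:
  assumes "0 < N" "j < N" "k < N"
  shows "rearr (step N (\<lambda>i. y (Transposition.transpose j k i))) = rearr (step N y)"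
proof -
  let ?t = "Transposition.transpose j k"
  have "card {i\<in>{..<N}. \<bar>y (?t i)\<bar> > l} = card {i\<in>{..<N}. \<bar>y i\<bar> > l}" for l
  proof (rule bij_betw_same_card)
    show "bij_betw ?t {i\<in>{..<N}. \<bar>y (?t i)\<bar> > l} {i\<in>{..<N}. \<bar>y i\<bar> > l}"
      by (rule bij_betwI[where g = ?t]) (use assms in \<open>auto simp: Transposition.transpose_def\<close>)
  qed
  then show ?thesis
    unfolding rearr_def fun_eq_iff by (simp only: step_distribution[OF assms(1)] simp_thms)
qed

text \<open>
  The axioms in the form in which they are applied. The last one is the embedding into the
  space of integrable functions, with the constant dropped.
\<close>
lemma ri_banach_normD:
  assumes "ri_banach_norm Z"
  shows "\<And>f. f \<in> M_plus \<Longrightarrow> (AE x in lebesgue_on {0<..<1}. f x = 0) \<Longrightarrow> Z f = 0"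
    and "\<And>f l. f \<in> M_plus \<Longrightarrow> 0 \<le> l \<Longrightarrow> Z (\<lambda>x. l * f x) = ennreal l * Z f"
    and "\<And>f g. f \<in> M_plus \<Longrightarrow> g \<in> M_plus \<Longrightarrow> (\<And>x. x \<in> {0<..<1} \<Longrightarrow> f x \<le> g x) \<Longrightarrow> Z f \<le> Z g"
    and "\<And>F f. (\<And>k::nat. F k \<in> M_plus) \<Longrightarrow> f \<in> M_plus \<Longrightarrow>
        (AE x in lebesgue_on {0<..<1}. incseq (\<lambda>k. F k x) \<and> (\<lambda>k. F k x) \<longlonglongrightarrow> f x) \<Longrightarrow>
        (\<lambda>k. Z (F k)) \<longlonglongrightarrow> Z f"
    and "\<And>f g. f \<in> M_plus \<Longrightarrow> g \<in> M_plus \<Longrightarrow> (\<And>t. t \<in> {0<..<1} \<Longrightarrow> rearr f t = rearr g t) \<Longrightarrow> Z f = Z g"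
    and "\<And>f g. f \<in> M_plus \<Longrightarrow> g \<in> M_plus \<Longrightarrow> Z (\<lambda>x. f x + g x) \<le> Z f + Z g"
    and "\<And>f. f \<in> M_plus \<Longrightarrow> Z f < \<infinity> \<Longrightarrow> (\<integral>\<^sup>+x\<in>{0<..<1}. ennreal (f x) \<partial>lborel) < \<infinity>"
proof -
  note ri = assms[unfolded ri_banach_norm_def ri_functional_def]
  show "Z f = 0" if "f \<in> M_plus" "AE x in lebesgue_on {0<..<1}. f x = 0" for f
    using ri that by blast
  show "Z (\<lambda>x. l * f x) = ennreal l * Z f" if "f \<in> M_plus" "0 \<le> l" for f l
    using ri that by blast
  show "Z f \<le> Z g" if "f \<in> M_plus" "g \<in> M_plus" and le: "\<And>x. x \<in> {0<..<1} \<Longrightarrow> f x \<le> g x" for f g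
  proof -
    have "AE x in lebesgue_on {0<..<1}. f x \<le> g x" by (rule AE_I2) (use le in simp)
    with ri that show ?thesis by blast
  qed
  show "(\<lambda>k. Z (F k)) \<longlonglongrightarrow> Z f" if "\<And>k::nat. F k \<in> M_plus" "f \<in> M_plus"
    "AE x in lebesgue_on {0<..<1}. incseq (\<lambda>k. F k x) \<and> (\<lambda>k. F k x) \<longlonglongrightarrow> f x" for F f
    using ri that by blast
  show "Z f = Z g" if "f \<in> M_plus" "g \<in> M_plus" "\<And>t. t \<in> {0<..<1} \<Longrightarrow> rearr f t = rearr g t" for f g
    using ri that by blast
  show "Z (\<lambda>x. f x + g x) \<le> Z f + Z g" if "f \<in> M_plus" "g \<in> M_plus" for f g
    using ri that by blast
  show "(\<integral>\<^sup>+x\<in>{0<..<1}. ennreal (f x) \<partial>lborel) < \<infinity>" if f: "f \<in> M_plus" "Z f < \<infinity>" for f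
  proof -
    obtain C where "(\<integral>\<^sup>+x\<in>{0<..<1}. ennreal (f x) \<partial>lebesgue) \<le> ennreal C * Z f"
      using ri f by blast
    also have "\<dots> < \<infinity>" using f by (simp add: ennreal_mult_less_top)
    finally show ?thesis by (simp add: nn_integral_completion)
  qed
qed

lemma step_weak_majorization:
  assumes Z: "ri_banach_norm Z" and "0 < N"
    and x: "\<And>i. i < N \<Longrightarrow> 0 \<le> x i" "antimono_on {..<N} x"
    and y: "\<And>i. i < N \<Longrightarrow> 0 \<le> y i"
    and maj: "\<And>k. k \<le> N \<Longrightarrow> (\<Sum>i<k. x i) \<le> (\<Sum>i<k. y i)"
  shows "Z (step N x) \<le> Z (step N y)"
proof (rule weak_majorization[where N = N and nu = "\<lambda>x. Z (step N x)", OF _ _ _ x y maj])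
  note D = ri_banach_normD[OF Z]
  show "Z (step N x) \<le> Z (step N y)" if "\<And>i. i < N \<Longrightarrow> 0 \<le> x i \<and> x i \<le> y i" for x y
    using that nat_floor_less[of _ N] \<open>0 < N\<close> order_trans
    by (intro D(3) step_M_plus) (auto simp: step_def intro: order_trans)
  show "Z (step N (\<lambda>i. x (Transposition.transpose j k i))) = Z (step N x)"
    if "\<And>i. i < N \<Longrightarrow> 0 \<le> x i" "j < N" "k < N" for x j k
  proof (rule D(5))
    show "step N (\<lambda>i. x (Transposition.transpose j k i)) \<in> M_plus" "step N x \<in> M_plus"
      using that \<open>0 < N\<close> by (auto intro!: step_M_plus simp: Transposition.transpose_def)
  qed (use that \<open>0 < N\<close> in \<open>simp add: step_equimeasurable\<close>)
  show "Z (step N (\<lambda>i. a * x i + (1 - a) * y i)) \<le> ennreal a * Z (step N x) + ennreal (1 - a) * Z (step N y)"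
    if "\<And>i. i < N \<Longrightarrow> 0 \<le> x i \<and> 0 \<le> y i" "0 \<le> a" "a \<le> 1" for x y a
  proof -
    have M: "step N x \<in> M_plus" "step N y \<in> M_plus"
      "step N (\<lambda>i. a * x i) \<in> M_plus" "step N (\<lambda>i. (1 - a) * y i) \<in> M_plus"
      using that \<open>0 < N\<close> by (auto intro!: step_M_plus)
    have "Z (step N (\<lambda>i. a * x i + (1 - a) * y i)) \<le>
        Z (step N (\<lambda>i. a * x i)) + Z (step N (\<lambda>i. (1 - a) * y i))"
      using D(6)[OF M(3,4)] unfolding step_def .
    also have "Z (step N (\<lambda>i. a * x i)) = ennreal a * Z (step N x)"
      using D(2)[OF M(1), of a] that unfolding step_def by simp
    also have "Z (step N (\<lambda>i. (1 - a) * y i)) = ennreal (1 - a) * Z (step N y)"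
      using D(2)[OF M(2), of "1 - a"] that unfolding step_def by simp
    finally show ?thesis .
  qed
qed

section \<open>The Hardy-Littlewood-Polya principle for rearrangement-invariant norms\<close>

lemma antimono_measurable:
  fixes f :: "real \<Rightarrow> real"
  assumes "antimono_on {a<..<b} f"
  shows "f \<in> borel_measurable (restrict_space borel {a<..<b})"
proof -
  have "mono_on {a<..<b} (\<lambda>x. - f x)"
    using assms by (auto simp: monotone_on_def)
  then have "(\<lambda>x. - (- f x)) \<in> borel_measurable (restrict_space borel {a<..<b})"
    by (intro borel_measurable_uminus borel_measurable_mono_on_fnc)
  then show ?thesis by simp
qed

lemma borel_lebesgue_on:
  fixes f :: "real \<Rightarrow> real"
  assumes "f \<in> borel_measurable (restrict_space borel S)" "S \<in> sets borel"
  shows "f \<in> borel_measurable (lebesgue_on S)"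
proof -
  have "(\<lambda>x. indicator S x *\<^sub>R f x) \<in> borel_measurable lborel"
    using assms by (subst (asm) borel_measurable_restrict_space_iff) auto
  then have "(\<lambda>x. indicator S x *\<^sub>R f x) \<in> borel_measurable lebesgue"
    by (intro measurable_completion)
  then show ?thesis using assms by (subst borel_measurable_restrict_space_iff) auto
qed

lemma antimono_M_plus:
  assumes "antimono_on {0<..<1} f" "\<And>x. x \<in> {0<..<1} \<Longrightarrow> 0 \<le> f x"
  shows "f \<in> M_plus"
  unfolding M_plus_def using assms borel_lebesgue_on[OF antimono_measurable] by auto

text \<open>
  For a nonincreasing function these two bounds estimate the increments of its primitive from
  both sides by end point values.
\<close>
lemma set_nn_integral_ge:
  fixes f :: "real \<Rightarrow> real"
  assumes "\<And>t. t \<in> {a<..<b} \<Longrightarrow> c \<le> f t" "a \<le> b"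
  shows "ennreal (c * (b - a)) \<le> (\<integral>\<^sup>+t\<in>{a<..<b}. ennreal (f t) \<partial>lborel)"
proof (cases "0 \<le> c")
  case True
  have "ennreal (c * (b - a)) = (\<integral>\<^sup>+t. ennreal c * indicator {a<..<b} t \<partial>lborel)"
    using True assms by (simp add: nn_integral_cmult_indicator ennreal_mult)
  also have "\<dots> \<le> (\<integral>\<^sup>+t\<in>{a<..<b}. ennreal (f t) \<partial>lborel)"
    using assms by (intro nn_integral_mono) (auto simp: indicator_def intro: ennreal_leI)
  finally show ?thesis .
qed (use assms in \<open>simp add: mult_nonpos_nonneg ennreal_neg\<close>)

lemma set_nn_integral_le:
  fixes f :: "real \<Rightarrow> real"
  assumes "\<And>t. t \<in> {a<..<b} \<Longrightarrow> f t \<le> c" "a \<le> b" "0 \<le> c"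
  shows "(\<integral>\<^sup>+t\<in>{a<..<b}. ennreal (f t) \<partial>lborel) \<le> ennreal (c * (b - a))"
proof -
  have "(\<integral>\<^sup>+t\<in>{a<..<b}. ennreal (f t) \<partial>lborel) \<le> (\<integral>\<^sup>+t. ennreal c * indicator {a<..<b} t \<partial>lborel)"
    using assms by (intro nn_integral_mono) (auto simp: indicator_def intro: ennreal_leI)
  also have "\<dots> = ennreal (c * (b - a))"
    using assms by (simp add: nn_integral_cmult_indicator ennreal_mult)
  finally show ?thesis .
qed

lemma set_nn_integral_split:
  fixes f :: "real \<Rightarrow> ennreal"
  assumes f: "f \<in> borel_measurable (restrict_space borel {a<..<c})" and "a \<le> b" "b < c"
  shows "(\<integral>\<^sup>+t\<in>{a<..<c}. f t \<partial>lborel) =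
    (\<integral>\<^sup>+t\<in>{a<..<b}. f t \<partial>lborel) + (\<integral>\<^sup>+t\<in>{b<..<c}. f t \<partial>lborel)"
proof -
  have m: "(\<lambda>t. f t * indicator {a<..<c} t) \<in> borel_measurable lborel"
    using f by (subst (asm) borel_measurable_restrict_space_iff_ennreal) auto
  have m': "(\<lambda>t. f t * indicator S t) \<in> borel_measurable lborel"
    if "S \<subseteq> {a<..<c}" "S \<in> sets borel" for S
  proof -
    have "(\<lambda>t. f t * indicator {a<..<c} t * indicator S t) \<in> borel_measurable lborel"
      using m that by measurable
    also have "(\<lambda>t. f t * indicator {a<..<c} t * indicator S t) = (\<lambda>t. f t * indicator S t)"
      using that by (auto simp: indicator_def fun_eq_iff)
    finally show ?thesis .
  qed
  have "(\<integral>\<^sup>+t\<in>{a<..<c}. f t \<partial>lborel) =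
      (\<integral>\<^sup>+t. f t * indicator {a<..<b} t + f t * indicator {b<..<c} t \<partial>lborel)"
  proof (rule nn_integral_cong_AE)
    have "AE t in lborel. t \<noteq> b" by (rule AE_lborel_singleton)
    then show "AE t in lborel. f t * indicator {a<..<c} t =
        f t * indicator {a<..<b} t + f t * indicator {b<..<c} t"
      by eventually_elim (use assms in \<open>auto simp: indicator_def\<close>)
  qed
  also have "\<dots> = (\<integral>\<^sup>+t\<in>{a<..<b}. f t \<partial>lborel) + (\<integral>\<^sup>+t\<in>{b<..<c}. f t \<partial>lborel)"
    using assms by (intro nn_integral_add m') auto
  finally show ?thesis .
qed

lemma small_initial_integral:
  fixes g :: "real \<Rightarrow> ennreal"
  assumes g: "g \<in> borel_measurable (restrict_space borel {0<..<1})"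
    and fin: "(\<integral>\<^sup>+t\<in>{0<..<1}. g t \<partial>lborel) < \<infinity>"
  shows "(\<lambda>m. \<integral>\<^sup>+t\<in>{0<..<1 / real (Suc m)}. g t \<partial>lborel) \<longlonglongrightarrow> 0"
proof -
  have m: "(\<lambda>t. g t * indicator {0<..<1} t) \<in> borel_measurable lborel"
    using g by (subst (asm) borel_measurable_restrict_space_iff_ennreal) auto
  have eq: "g t * indicator {0<..<1 / real (Suc m)} t =
      g t * indicator {0<..<1} t * indicator {0<..<1 / real (Suc m)} t" for t m
  proof -
    have "t < 1" if "t < 1 / real (Suc m)"
      using that by (rule less_le_trans) simp
    then show ?thesis by (auto simp: indicator_def)
  qed
  have "(\<lambda>m. \<integral>\<^sup>+t. g t * indicator {0<..<1 / real (Suc m)} t \<partial>lborel) \<longlonglongrightarrow> (\<integral>\<^sup>+t. 0 \<partial>(lborel :: real measure))"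
  proof (rule nn_integral_dominated_convergence[where w = "\<lambda>t. g t * indicator {0<..<1} t"])
    show "AE t in lborel. (\<lambda>m. g t * indicator {0<..<1 / real (Suc m)} t) \<longlonglongrightarrow> 0"
    proof (rule AE_I2, rule tendsto_eventually)
      fix t :: real
      have "(\<lambda>m. 1 / real (Suc m)) \<longlonglongrightarrow> 0" by (rule lim_1_over_n[THEN LIMSEQ_Suc])
      then have "eventually (\<lambda>m. 1 / real (Suc m) < t) sequentially" if "0 < t"
        using that by (rule order_tendstoD)
      then have "eventually (\<lambda>m. \<not> (t < 1 / real (Suc m))) sequentially" if "0 < t"
        using that by (auto elim!: eventually_mono)
      then show "\<forall>\<^sub>F m in sequentially. g t * indicator {0<..<1 / real (Suc m)} t = 0"
        by (cases "0 < t") (auto elim!: eventually_mono simp: indicator_def not_less)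
    qed
  next
    fix j
    show "(\<lambda>t. g t * indicator {0<..<1 / real (Suc j)} t) \<in> borel_measurable lborel"
      unfolding eq using m by measurable
    show "AE t in lborel. g t * indicator {0<..<1 / real (Suc j)} t \<le> g t * indicator {0<..<1} t"
      unfolding eq by (rule AE_I2) (simp add: indicator_def)
  qed (use m fin in auto)
  then show ?thesis by simp
qed

lemma step_refine:
  assumes "0 < m" "0 < n" "t \<in> {0<..<1}"
  shows "step n x t = step (n * m) (\<lambda>i. x (i div m)) t"
proof -
  have "\<lfloor>real n * t\<rfloor> = \<lfloor>real (n * m) * t\<rfloor> div int m"
    using assms floor_divide_real_eq_div[of "int m" "real (n * m) * t"] by simp
  moreover have "0 \<le> \<lfloor>real (n * m) * t\<rfloor>" using assms by simp
  ultimately have "nat \<lfloor>real n * t\<rfloor> = nat \<lfloor>real (n * m) * t\<rfloor> div m"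
    by (simp add: nat_div_distrib)
  then show ?thesis by (simp add: step_def)
qed

text \<open>
  Values at right end points of the cells of the grid of size n. In the last cell the right
  end point is 1, where the function is arbitrary, hence the value 0 there.
\<close>
definition lower_samples :: "nat \<Rightarrow> (real \<Rightarrow> real) \<Rightarrow> nat \<Rightarrow> real" where
  "lower_samples n f i = (if i + 1 < n then f (real (i + 1) / real n) else 0)"

lemma lower_samples_nonneg: "(\<And>x. x \<in> {0<..<1} \<Longrightarrow> 0 \<le> f x) \<Longrightarrow> 0 \<le> lower_samples n f i"
  unfolding lower_samples_def by (auto simp: field_simps)

lemma lower_samples_antimono:
  assumes "antimono_on {0<..<1} f" "\<And>x. x \<in> {0<..<1} \<Longrightarrow> 0 \<le> f x" "i \<le> j"
  shows "lower_samples n f j \<le> lower_samples n f i"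
proof -
  have "f (real (j + 1) / real n) \<le> f (real (i + 1) / real n)" if "j + 1 < n"
    using assms that by (intro monotone_onD[OF assms(1)]) (auto simp: field_simps)
  then show ?thesis
    using assms lower_samples_nonneg[of f n i] unfolding lower_samples_def by auto
qed

lemma step_lower_le:
  assumes "antimono_on {0<..<1} f" "\<And>x. x \<in> {0<..<1} \<Longrightarrow> 0 \<le> f x" "t \<in> {0<..<1}" "0 < n"
  shows "step n (lower_samples n f) t \<le> f t"
proof -
  have "f (real (nat \<lfloor>real n * t\<rfloor> + 1) / real n) \<le> f t" if "nat \<lfloor>real n * t\<rfloor> + 1 < n"
  proof (rule monotone_onD[OF assms(1) \<open>t \<in> {0<..<1}\<close>])
    have "real n * t < real_of_int (\<lfloor>real n * t\<rfloor> + 1)" by linarith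
    also have "\<dots> = real (nat \<lfloor>real n * t\<rfloor> + 1)" using assms by simp
    finally show "t \<le> real (nat \<lfloor>real n * t\<rfloor> + 1) / real n" using assms by (simp add: field_simps)
  qed (use that in \<open>auto simp: field_simps\<close>)
  then show ?thesis using assms by (auto simp: step_def lower_samples_def)
qed

lemma antimono_head_average:
  fixes Y :: "nat \<Rightarrow> real"
  assumes "\<And>i j. i \<le> j \<Longrightarrow> Y j \<le> Y i" "k \<le> m"
  shows "real k * (\<Sum>i<m. Y i) \<le> real m * (\<Sum>i<k. Y i)"
  using assms(2)
proof (induction m rule: dec_induct)
  case (step m)
  have "real k * Y m = (\<Sum>i<k. Y m)" by simp
  also have "\<dots> \<le> (\<Sum>i<k. Y i)" using step assms(1) by (intro sum_mono) auto
  finally show ?case using step.IH by (simp add: algebra_simps)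
qed simp

text \<open>
  Compare f sampled on a coarse grid with g sampled on a finer grid whose cell size is 1/(nm).
  Both samples are lower sums. The samples of g miss an amount of mass which is at most the
  integral of g over the first fine cell, and this tends to 0 as m grows. The factor c < 1
  pays for the missing mass as soon as k \<ge> m, that is, from the end of the first coarse
  cell on; inside the first coarse cell the samples of f are constant and those of g are
  decreasing, so the inequality at its end implies the inequality before. Then weak
  majorization applies to the two vectors.
\<close>
lemma HLP_lower:
  assumes Z: "ri_banach_norm Z"
    and f: "antimono_on {0<..<1} f" "\<And>x. x \<in> {0<..<1} \<Longrightarrow> 0 \<le> f x"
    and g: "antimono_on {0<..<1} g" "\<And>x. x \<in> {0<..<1} \<Longrightarrow> 0 \<le> g x"
    and maj: "\<And>x. x \<in> {0<..<1} \<Longrightarrow>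
      (\<integral>\<^sup>+t\<in>{0<..<x}. ennreal (f t) \<partial>lborel) \<le> (\<integral>\<^sup>+t\<in>{0<..<x}. ennreal (g t) \<partial>lborel)"
    and fin: "(\<integral>\<^sup>+t\<in>{0<..<1}. ennreal (g t) \<partial>lborel) < \<infinity>"
    and n: "2 \<le> n" and c: "0 \<le> c" "c < 1"
  shows "Z (\<lambda>t. c * step n (lower_samples n f) t) \<le> Z g"
proof -
  define Fe where "Fe x = (\<integral>\<^sup>+t\<in>{0<..<x}. ennreal (f t) \<partial>lborel)" for x
  define Ge where "Ge x = (\<integral>\<^sup>+t\<in>{0<..<x}. ennreal (g t) \<partial>lborel)" for x
  have Ge: "Ge x < \<infinity>" if "x \<le> 1" for x
  proof -
    have "Ge x \<le> (\<integral>\<^sup>+t\<in>{0<..<1}. ennreal (g t) \<partial>lborel)"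
      unfolding Ge_def using that by (intro nn_set_integral_set_mono) auto
    with fin show ?thesis by simp
  qed
  have le: "Fe x \<le> Ge x" if "x < 1" for x
    using maj[of x] that by (cases "0 < x") (auto simp: Fe_def Ge_def)
  have Fe: "Fe x < \<infinity>" if "x < 1" for x
    using le[OF that] Ge[of x] that by simp
  have mg: "(\<lambda>t. ennreal (g t)) \<in> borel_measurable (restrict_space borel {0<..<x})"
    and mf: "(\<lambda>t. ennreal (f t)) \<in> borel_measurable (restrict_space borel {0<..<x})" if "x \<le> 1" for x
    using that
    by (auto intro!: measurable_compose[OF antimono_measurable measurable_ennreal]
      monotone_on_subset[OF f(1)] monotone_on_subset[OF g(1)])
  define F where "F x = enn2real (Fe x)" for x
  define G where "G x = enn2real (Ge x)" for x
  have F0: "F 0 = 0" by (simp add: F_def Fe_def)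
  have FG: "F x \<le> G x" if "x < 1" for x
    unfolding F_def G_def using le[OF that] Ge[of x] that by (intro enn2real_mono) auto
  have F_incr: "f b * (b - a) \<le> F b - F a" if "0 \<le> a" "a < b" "b < 1" for a b
  proof -
    have "Fe b = Fe a + (\<integral>\<^sup>+t\<in>{a<..<b}. ennreal (f t) \<partial>lborel)"
      unfolding Fe_def using that by (intro set_nn_integral_split mf) auto
    moreover have "ennreal (f b * (b - a)) \<le> (\<integral>\<^sup>+t\<in>{a<..<b}. ennreal (f t) \<partial>lborel)"
      using that by (intro set_nn_integral_ge monotone_onD[OF f(1)]) auto
    ultimately have "Fe a + ennreal (f b * (b - a)) \<le> Fe b" by (simp add: add_left_mono)
    then have "ennreal (F a + f b * (b - a)) \<le> ennreal (F b)"
      using Fe[of a] Fe[of b] that f(2)[of b] by (simp add: F_def ennreal_plus less_top)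
    then show ?thesis by (simp add: F_def ennreal_le_iff)
  qed
  have G_incr: "G b - G a \<le> g a * (b - a)" if "0 < a" "a < b" "b \<le> 1" for a b
  proof -
    have "Ge b = Ge a + (\<integral>\<^sup>+t\<in>{a<..<b}. ennreal (g t) \<partial>lborel)"
      unfolding Ge_def using that by (intro set_nn_integral_split mg) auto
    moreover have "(\<integral>\<^sup>+t\<in>{a<..<b}. ennreal (g t) \<partial>lborel) \<le> ennreal (g a * (b - a))"
      using that g(2)[of a] by (intro set_nn_integral_le monotone_onD[OF g(1)]) auto
    ultimately have "Ge b \<le> Ge a + ennreal (g a * (b - a))" by (simp add: add_left_mono)
    then have "ennreal (G b) \<le> ennreal (G a + g a * (b - a))"
      using Ge[of a] Ge[of b] that g(2)[of a] by (simp add: G_def ennreal_plus less_top)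
    moreover have "0 \<le> G a + g a * (b - a)" using g(2)[of a] that by (simp add: G_def)
    ultimately have "G b \<le> G a + g a * (b - a)" by (simp only: ennreal_le_iff)
    then show ?thesis by simp
  qed
  have G_mono: "G a \<le> G b" if "a \<le> b" "b \<le> 1" for a b
    unfolding G_def Ge_def
  proof (rule enn2real_mono)
    show "(\<integral>\<^sup>+t\<in>{0<..<a}. ennreal (g t) \<partial>lborel) \<le> (\<integral>\<^sup>+t\<in>{0<..<b}. ennreal (g t) \<partial>lborel)"
      using that by (intro nn_set_integral_set_mono) auto
  qed (use Ge[of b] that in \<open>simp add: Ge_def\<close>)
  have G_lim: "(\<lambda>m. G (1 / real (Suc m))) \<longlonglongrightarrow> 0"
  proof -
    have "(\<lambda>m. Ge (1 / real (Suc m))) \<longlonglongrightarrow> ennreal 0"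
      using small_initial_integral[of "\<lambda>t. ennreal (g t)"] mg[of 1] fin by (simp add: Ge_def)
    then show ?thesis unfolding G_def by (rule tendsto_enn2real) simp
  qed
  define X where "X i = c * lower_samples n f i" for i
  have X0: "0 \<le> X i" and Xanti: "i \<le> j \<Longrightarrow> X j \<le> X i" for i j
    using c f lower_samples_nonneg[of f n i] lower_samples_antimono[of f i j n] unfolding X_def
    by (auto intro!: mult_left_mono)
  \<comment> \<open>If g vanishes near 0 there is no slack to pay with, but then f vanishes too.\<close>
  show ?thesis
  proof (cases "G (1 / real n) = 0")
    case True
    have "f (1 / real n) * (1 / real n - 0) \<le> F (1 / real n) - F 0"
      using n by (intro F_incr) auto
    also have "\<dots> \<le> 0" using FG[of "1 / real n"] True F0 n by simp
    finally have "f (1 / real n) \<le> 0" using n by (simp add: field_simps)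
    then have "lower_samples n f i \<le> 0" for i
      using lower_samples_antimono[of f 0 i n] f n by (simp add: lower_samples_def split: if_splits)
    then have "lower_samples n f i = 0" for i using lower_samples_nonneg[of f n i] f(2) by (meson order_antisym)
    then have "(\<lambda>t. c * step n (lower_samples n f) t) = (\<lambda>t. 0)" by (simp add: step_def)
    moreover have "Z (\<lambda>t. 0) = 0" by (intro ri_banach_normD(1)[OF Z]) (auto simp: M_plus_def)
    ultimately show ?thesis by simp
  next
    case False
    then have pos: "0 < (1 - c) * G (1 / real n)" using c by (simp add: G_def less_le)
    have "\<exists>m\<ge>2. G (1 / real (n * m)) \<le> (1 - c) * G (1 / real n)"
    proof -
      have "eventually (\<lambda>m. G (1 / real (Suc m)) < (1 - c) * G (1 / real n)) sequentially"
        by (rule order_tendstoD(2)[OF G_lim pos])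
      then obtain M where M: "\<And>m. m \<ge> M \<Longrightarrow> G (1 / real (Suc m)) < (1 - c) * G (1 / real n)"
        unfolding eventually_sequentially by blast
      have "1 * (M + 2) \<le> n * (M + 2)" using n by (intro mult_right_mono) auto
      then have "M + 2 \<le> n * (M + 2)" by simp
      then have "G (1 / real (Suc (n * (M + 2) - 1))) < (1 - c) * G (1 / real n)" by (intro M) linarith
      moreover have "Suc (n * (M + 2) - 1) = n * (M + 2)" using n by simp
      ultimately show ?thesis by (metis le_add2 less_imp_le)
    qed
    then obtain m where m: "m \<ge> 2" "G (1 / real (n * m)) \<le> (1 - c) * G (1 / real n)" by blast
    define N where "N = n * m"
    define K where "K = (n - 1) * m"
    have N: "0 < N" "K + m = N" "m \<le> K"
      using n m mult_le_mono1[of 1 "n - 1" m] mult_le_mono1[of 1 n m]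
      by (auto simp: N_def K_def diff_mult_distrib)
    define Y where "Y = lower_samples N g"
    have Y0: "0 \<le> Y i" and Yanti: "i \<le> j \<Longrightarrow> Y j \<le> Y i" for i j
      using lower_samples_nonneg[of g] lower_samples_antimono[of g] g unfolding Y_def by auto
    have X_sum: "(\<Sum>i<k. X (i div m)) \<le> real N * (c * F (real k / real N))" if "k \<le> K" for k
      using that
    proof (induction k)
      case (Suc k)
      define q where "q = k div m"
      have q: "k < (q + 1) * m" "q * m \<le> k"
        using m dividend_less_div_times[of m k] by (auto simp: q_def algebra_simps)
      have "q < n - 1" using Suc.prems m by (simp add: q_def K_def less_mult_imp_div_less)
      then have qn: "q + 1 < n" by simp
      have kN: "real (Suc k) / real N \<le> real (q + 1) / real n"
      proof -
        have "real (Suc k) \<le> real ((q + 1) * m)" using q by (simp only: of_nat_le_iff)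
        then have "real (Suc k) / real (n * m) \<le> real ((q + 1) * m) / real (n * m)"
          by (rule divide_right_mono) simp
        also have "\<dots> = real (q + 1) / real n"
          unfolding of_nat_mult using m by (intro mult_divide_mult_cancel_right) simp
        finally show ?thesis by (simp add: N_def)
      qed
      have "X q = c * f (real (q + 1) / real n)" using qn by (simp add: X_def lower_samples_def)
      also have "\<dots> \<le> c * f (real (Suc k) / real N)"
      proof (intro mult_left_mono monotone_onD[OF f(1)] kN)
        have "Suc k < N" using Suc.prems N m by simp
        then show "real (Suc k) / real N \<in> {0<..<1}" by simp
      qed (use c qn in auto)
      also have "f (real (Suc k) / real N) \<le> real N * (F (real (Suc k) / real N) - F (real k / real N))"
      proof -
        have "Suc k < N" using Suc.prems N m by simp
        moreover have "real (Suc k) / real N - real k / real N = 1 / real N"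
          by (simp add: diff_divide_distrib[symmetric])
        ultimately show ?thesis
          using F_incr[of "real k / real N" "real (Suc k) / real N"] N
          by (simp add: divide_strict_right_mono field_simps)
      qed
      finally have "X q \<le> c * (real N * (F (real (Suc k) / real N) - F (real k / real N)))"
        using c by (simp add: mult_left_mono)
      with Suc show ?case by (simp add: q_def algebra_simps)
    qed (simp add: F0)
    have Y_sum: "real N * (G (real (Suc k) / real N) - G (1 / real N)) \<le> (\<Sum>i<k. Y i)" if "k < N" for k
      using that
    proof (induction k)
      case (Suc k)
      have "real (Suc (Suc k)) / real N - real (Suc k) / real N = 1 / real N"
        by (simp add: diff_divide_distrib[symmetric])
      then have "G (real (Suc (Suc k)) / real N) - G (real (Suc k) / real N) \<le> Y k * (1 / real N)"
        using G_incr[of "real (Suc k) / real N" "real (Suc (Suc k)) / real N"] Suc.prems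
        by (simp add: divide_strict_right_mono Y_def lower_samples_def)
      then have "real N * (G (real (Suc (Suc k)) / real N) - G (real (Suc k) / real N)) \<le> Y k"
        using N by (simp add: field_simps)
      with Suc show ?case by (simp add: algebra_simps)
    qed simp
    have mid: "(\<Sum>i<k. X (i div m)) \<le> (\<Sum>i<k. Y i)" if "m \<le> k" "k \<le> K" for k
    proof -
      have kN: "k < N" using that N m by simp
      have "real n * real m \<le> real n * real k" using that by (intro mult_left_mono) auto
      then have "1 / real n \<le> real k / real N" using n m by (simp add: N_def field_simps)
      then have Gn: "G (1 / real n) \<le> G (real k / real N)"
        using kN by (intro G_mono) auto
      have "c * F (real k / real N) \<le> c * G (real k / real N)"
        using c kN by (intro mult_left_mono FG) auto
      also have "\<dots> = G (real k / real N) - (1 - c) * G (real k / real N)" by (simp add: algebra_simps)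
      also have "\<dots> \<le> G (real (Suc k) / real N) - G (1 / real N)"
      proof -
        have "(1 - c) * G (1 / real n) \<le> (1 - c) * G (real k / real N)"
          using Gn c by (intro mult_left_mono) auto
        moreover have "G (real k / real N) \<le> G (real (Suc k) / real N)"
          using kN by (intro G_mono divide_right_mono) auto
        ultimately show ?thesis using m by (simp add: N_def)
      qed
      finally have "real N * (c * F (real k / real N)) \<le> real N * (G (real (Suc k) / real N) - G (1 / real N))"
        by (rule mult_left_mono) simp
      with X_sum[of k] Y_sum[of k] that kN show ?thesis by linarith
    qed
    have all: "(\<Sum>i<k. X (i div m)) \<le> (\<Sum>i<k. Y i)" if "k \<le> N" for k
    proof -
      consider "k < m" | "m \<le> k" "k \<le> K" | "K < k" by linarith
      then show ?thesis
      proof cases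
        case 1
        have "real m * (\<Sum>i<k. X (i div m)) = real k * (real m * X 0)" using 1 by simp
        also have "real m * X 0 = (\<Sum>i<m. X (i div m))" by simp
        also have "real k * \<dots> \<le> real k * (\<Sum>i<m. Y i)"
          using N by (intro mult_left_mono mid) auto
        also have "\<dots> \<le> real m * (\<Sum>i<k. Y i)"
          using 1 Yanti by (intro antimono_head_average) auto
        finally show ?thesis using m by simp
      next
        case 3
        have "(\<Sum>i<k. X (i div m)) = (\<Sum>i<K. X (i div m))"
        proof (rule sum.mono_neutral_right)
          show "\<forall>i\<in>{..<k} - {..<K}. X (i div m) = 0"
          proof
            fix i assume "i \<in> {..<k} - {..<K}"
            then have "(n - 1) * m \<le> i" by (simp add: K_def)
            then have "n - 1 \<le> i div m" using m by (simp add: less_eq_div_iff_mult_less_eq)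
            then show "X (i div m) = 0" by (simp add: X_def lower_samples_def)
          qed
        qed (use 3 in auto)
        also have "\<dots> \<le> (\<Sum>i<K. Y i)" using N by (intro mid) auto
        also have "\<dots> \<le> (\<Sum>i<k. Y i)" using 3 Y0 by (intro sum_mono2) auto
        finally show ?thesis .
      qed (rule mid)
    qed
    have "Z (\<lambda>t. c * step n (lower_samples n f) t) = Z (step n X)"
      by (simp add: step_def[abs_def] X_def)
    also have "\<dots> \<le> Z (step N (\<lambda>i. X (i div m)))"
      using step_refine[of m n _ X] n m X0 N unfolding N_def
      by (intro ri_banach_normD(3)[OF Z] step_M_plus) auto
    also have "\<dots> \<le> Z (step N Y)"
      using X0 Y0 N all by (intro step_weak_majorization[OF Z]) (auto simp: monotone_on_def intro!: Xanti div_le_mono)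
    also have "\<dots> \<le> Z g"
      using step_lower_le[OF g] N Y0
      by (intro ri_banach_normD(3)[OF Z] step_M_plus antimono_M_plus g) (auto simp: Y_def)
    finally show ?thesis .
  qed
qed

text \<open>
  The lower samples of f on dyadic grids, multiplied by factors below 1 that tend to 1,
  increase to f at every point of continuity, hence almost everywhere; the Fatou property
  passes to the limit.
\<close>
theorem HLP_principle:
  assumes Z: "ri_banach_norm Z"
    and f: "antimono_on {0<..<1} f" "\<And>x. x \<in> {0<..<1} \<Longrightarrow> 0 \<le> f x"
    and g: "antimono_on {0<..<1} g" "\<And>x. x \<in> {0<..<1} \<Longrightarrow> 0 \<le> g x"
    and maj: "\<And>x. x \<in> {0<..<1} \<Longrightarrow>
      (\<integral>\<^sup>+t\<in>{0<..<x}. ennreal (f t) \<partial>lborel) \<le> (\<integral>\<^sup>+t\<in>{0<..<x}. ennreal (g t) \<partial>lborel)"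
  shows "Z f \<le> Z g"
proof (cases "Z g = \<infinity>")
  case False
  have gM: "g \<in> M_plus" and fM: "f \<in> M_plus" using f g by (auto intro: antimono_M_plus)
  have fin: "(\<integral>\<^sup>+t\<in>{0<..<1}. ennreal (g t) \<partial>lborel) < \<infinity>"
    using ri_banach_normD(7)[OF Z gM] False by (simp add: less_top)
  define c where "c k = 1 - 1 / real (k + 2)" for k :: nat
  define s where "s k = step (2 ^ Suc k) (lower_samples (2 ^ Suc k) f)" for k :: nat
  have c: "0 \<le> c k" "c k < 1" "c k \<le> c (Suc k)" for k
    by (auto simp: c_def field_simps)
  have s0: "0 \<le> s k t" for k t
    using lower_samples_nonneg[of f] f by (simp add: s_def step_def)
  have sM: "(\<lambda>t. c k * s k t) \<in> M_plus" for k
  proof -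
    have "step (2 ^ Suc k) (\<lambda>i. c k * lower_samples (2 ^ Suc k) f i) \<in> M_plus"
      using lower_samples_nonneg[of f] f c by (intro step_M_plus) auto
    then show ?thesis by (simp add: s_def step_def[abs_def])
  qed
  define r where "r k t = real (nat \<lfloor>2 ^ Suc k * t\<rfloor> + 1) / 2 ^ Suc k" for k :: nat and t :: real
  have r_floor: "r k t = (of_int \<lfloor>2 ^ Suc k * t\<rfloor> + 1) / 2 ^ Suc k" if "0 < t" for k t
    using that by (simp add: r_def)
  have r_gt: "t < r k t" and r_le: "r k t \<le> t + 1 / 2 ^ Suc k" if "0 < t" for k t
  proof -
    have "2 ^ Suc k * t < of_int \<lfloor>2 ^ Suc k * t\<rfloor> + 1" "of_int \<lfloor>2 ^ Suc k * t\<rfloor> \<le> 2 ^ Suc k * t"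
      by linarith+
    then show "t < r k t" "r k t \<le> t + 1 / 2 ^ Suc k"
      unfolding r_floor[OF that] by (simp_all add: field_simps del: power_Suc)
  qed
  have r_dec: "r (Suc k) t \<le> r k t" if "0 < t" for k t
  proof -
    have "2 ^ Suc (Suc k) * t < 2 * (of_int \<lfloor>2 ^ Suc k * t\<rfloor> + 1)"
      using floor_correct[of "2 ^ Suc k * t"] by (simp add: field_simps)
    then have "2 ^ Suc (Suc k) * t < of_int (2 * (\<lfloor>2 ^ Suc k * t\<rfloor> + 1))" by simp
    then have "\<lfloor>2 ^ Suc (Suc k) * t\<rfloor> < 2 * (\<lfloor>2 ^ Suc k * t\<rfloor> + 1)" unfolding floor_less_iff .
    then have "\<lfloor>2 ^ Suc (Suc k) * t\<rfloor> + 1 \<le> 2 * (\<lfloor>2 ^ Suc k * t\<rfloor> + 1)" by simp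
    then have "real_of_int (\<lfloor>2 ^ Suc (Suc k) * t\<rfloor> + 1) \<le> of_int (2 * (\<lfloor>2 ^ Suc k * t\<rfloor> + 1))"
      by (simp only: of_int_le_iff)
    then have "real_of_int \<lfloor>2 ^ Suc (Suc k) * t\<rfloor> + 1 \<le> 2 * (of_int \<lfloor>2 ^ Suc k * t\<rfloor> + 1)" by simp
    then have "(real_of_int \<lfloor>2 ^ Suc (Suc k) * t\<rfloor> + 1) / 2 ^ Suc (Suc k) \<le>
        2 * (of_int \<lfloor>2 ^ Suc k * t\<rfloor> + 1) / 2 ^ Suc (Suc k)"
      by (rule divide_right_mono) simp
    also have "\<dots> = (of_int \<lfloor>2 ^ Suc k * t\<rfloor> + 1) / 2 ^ Suc k"
      unfolding power_Suc[of _ "Suc k"] by (rule mult_divide_mult_cancel_left) simp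
    finally show ?thesis
      unfolding r_floor[OF that] .
  qed
  have s_eq: "s k t = (if r k t < 1 then f (r k t) else 0)" for k t
  proof -
    have "real (a + 1) / 2 ^ Suc k < 1 \<longleftrightarrow> a + 1 < 2 ^ Suc k" for a :: nat
      by (simp only: divide_less_eq_1_pos zero_less_power zero_less_numeral of_nat_less_numeral_power_cancel_iff)
    then show ?thesis
      unfolding s_def step_def lower_samples_def r_def by (simp del: power_Suc of_nat_add)
  qed
  have incs: "incseq (\<lambda>k. c k * s k t)" if "t \<in> {0<..<1}" for t
  proof (rule incseq_SucI)
    fix k
    have "f (r k t) \<le> f (r (Suc k) t)" if "r k t < 1"
      using r_gt[of t k] r_gt[of t "Suc k"] r_dec[of t k] \<open>t \<in> {0<..<1}\<close> that
      by (intro monotone_onD[OF f(1)]) auto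
    then have "s k t \<le> s (Suc k) t"
      using s0[of "Suc k" t] r_dec[of t k] that by (auto simp: s_eq)
    then show "c k * s k t \<le> c (Suc k) * s (Suc k) t"
      using c s0 by (intro mult_mono) auto
  qed
  have clim: "c \<longlonglongrightarrow> 1"
  proof -
    have "(\<lambda>k. 1 / real (Suc (Suc k))) \<longlonglongrightarrow> 0"
      by (intro LIMSEQ_Suc lim_1_over_n)
    then have "(\<lambda>k. 1 - 1 / real (k + 2)) \<longlonglongrightarrow> 1 - 0"
      by (intro tendsto_diff) simp_all
    then show ?thesis by (simp add: c_def[abs_def])
  qed
  have lims: "(\<lambda>k. c k * s k t) \<longlonglongrightarrow> f t" if t: "t \<in> {0<..<1}" and cont: "isCont f t" for t
  proof -
    have "(\<lambda>k. 1 / 2 ^ Suc k :: real) \<longlonglongrightarrow> 0"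
      using LIMSEQ_Suc[OF LIMSEQ_realpow_zero[of "1/2"]] by (simp add: power_one_over)
    then have "(\<lambda>k. t + 1 / 2 ^ Suc k) \<longlonglongrightarrow> t + 0" by (intro tendsto_intros)
    then have rlim: "(\<lambda>k. r k t) \<longlonglongrightarrow> t"
      using r_gt[of t] r_le[of t] t
      by (intro tendsto_sandwich[of "\<lambda>_. t" "\<lambda>k. r k t" _ "\<lambda>k. t + 1 / 2 ^ Suc k" t])
        (auto intro!: always_eventually less_imp_le)
    then have "eventually (\<lambda>k. r k t < 1) sequentially"
      using t by (intro order_tendstoD) auto
    moreover have "(\<lambda>k. f (r k t)) \<longlonglongrightarrow> f t"
      using isCont_tendsto_compose[OF cont rlim] .
    ultimately have "(\<lambda>k. s k t) \<longlonglongrightarrow> f t"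
      by (auto elim!: Lim_transform_eventually eventually_mono simp: s_eq)
    from tendsto_mult[OF clim this] show ?thesis by simp
  qed
  have "mono_on {0<..<1} (\<lambda>x. - f x)" using f(1) by (auto simp: monotone_on_def)
  from mono_on_ctble_discont_open[OF open_greaterThanLessThan this]
  have "countable {t\<in>{0<..<1}. \<not> isCont (\<lambda>x. - f x) t}" .
  then have "AE t in lebesgue. t \<notin> {t\<in>{0<..<1}. \<not> isCont (\<lambda>x. - f x) t}"
    by (intro AE_not_in AE_completion) (simp add: countable_imp_null_set_lborel AE_not_in)
  then have "AE t in lebesgue_on {0<..<1}. incseq (\<lambda>k. c k * s k t) \<and> (\<lambda>k. c k * s k t) \<longlonglongrightarrow> f t"
    using incs lims continuous_minus[of _ "\<lambda>x. - f x"]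
    by (subst AE_restrict_space_iff) (auto elim!: eventually_mono)
  then have "(\<lambda>k. Z (\<lambda>t. c k * s k t)) \<longlonglongrightarrow> Z f"
    by (intro ri_banach_normD(4)[OF Z] sM fM)
  moreover have "Z (\<lambda>t. c k * s k t) \<le> Z g" for k
    unfolding s_def using c by (intro HLP_lower[OF Z f g maj fin]) auto
  ultimately show ?thesis
    by (intro LIMSEQ_le_const2) auto
qed simp

section \<open>Slowly varying functions and the change of variables\<close>

lemma slowly_varying_pos: "slowly_varying b \<Longrightarrow> t \<in> {0<..<1} \<Longrightarrow> 0 < b t"
  by (simp add: slowly_varying_def)

text \<open>
  Slow variation enters through the next two inequalities between values of b itself, which
  are free of the equivalent monotone functions.
\<close>
lemma slowly_varying_quasi_increasing:
  assumes "slowly_varying b" "0 < e"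
  shows "\<exists>C>0. \<forall>s t. 0 < s \<longrightarrow> s \<le> t \<longrightarrow> t < 1 \<longrightarrow> s powr e * b s \<le> C * (t powr e * b t)"
proof -
  from assms obtain g where g: "mono_on {0<..<1} g" "approx_on {0<..<1} (\<lambda>t. t powr e * b t) g"
    unfolding slowly_varying_def by blast
  then obtain c1 c2 where c: "c1 > 0" "\<And>t. t \<in> {0<..<1} \<Longrightarrow> t powr e * b t \<le> c1 * g t"
    "c2 > 0" "\<And>t. t \<in> {0<..<1} \<Longrightarrow> g t \<le> c2 * (t powr e * b t)"
    unfolding approx_on_def by blast
  show ?thesis
  proof (intro exI[of _ "c1 * c2"] conjI allI impI)
    fix s t :: real assume st: "0 < s" "s \<le> t" "t < 1"
    have "s powr e * b s \<le> c1 * g s" using st by (intro c) auto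
    also have "\<dots> \<le> c1 * g t" using c st g(1) by (intro mult_left_mono) (auto simp: monotone_on_def)
    also have "\<dots> \<le> c1 * (c2 * (t powr e * b t))" using c st by (intro mult_left_mono) auto
    finally show "s powr e * b s \<le> c1 * c2 * (t powr e * b t)" by (simp add: mult.assoc)
  qed (use c in simp)
qed

lemma slowly_varying_quasi_decreasing:
  assumes "slowly_varying b" "0 < e"
  shows "\<exists>C>0. \<forall>s t. 0 < s \<longrightarrow> s \<le> t \<longrightarrow> t < 1 \<longrightarrow> t powr (- e) * b t \<le> C * (s powr (- e) * b s)"
proof -
  from assms obtain g where g: "antimono_on {0<..<1} g" "approx_on {0<..<1} (\<lambda>t. t powr (- e) * b t) g"
    unfolding slowly_varying_def by blast
  then obtain c1 c2 where c: "c1 > 0" "\<And>t. t \<in> {0<..<1} \<Longrightarrow> t powr (- e) * b t \<le> c1 * g t"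
    "c2 > 0" "\<And>t. t \<in> {0<..<1} \<Longrightarrow> g t \<le> c2 * (t powr (- e) * b t)"
    unfolding approx_on_def by blast
  show ?thesis
  proof (intro exI[of _ "c1 * c2"] conjI allI impI)
    fix s t :: real assume st: "0 < s" "s \<le> t" "t < 1"
    have "t powr (- e) * b t \<le> c1 * g t" using st by (intro c) auto
    also have "\<dots> \<le> c1 * g s" using c st g(1) by (intro mult_left_mono) (auto simp: monotone_on_def)
    also have "\<dots> \<le> c1 * (c2 * (s powr (- e) * b s))" using c st by (intro mult_left_mono) auto
    finally show "t powr (- e) * b t \<le> c1 * c2 * (s powr (- e) * b s)" by (simp add: mult.assoc)
  qed (use c in simp)
qed

text \<open>
  A decreasing weight whose product with the square root is almost increasing: this is what is
  used of the slow variation of \<open>(b1/b2)^p\<close>. It makes the weight integrable at 0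
  with the Karamata estimate \<open>W_le\<close> for its primitive.
\<close>
locale decreasing_weight =
  fixes w :: "real \<Rightarrow> real" and M :: real
  assumes w_pos: "\<And>s. s \<in> {0<..<1} \<Longrightarrow> 0 < w s"
    and w_cont: "continuous_on {0<..<1} w"
    and w_anti: "antimono_on {0<..<1} w"
    and M_pos: "0 < M"
    and w_quasi: "\<And>s t. 0 < s \<Longrightarrow> s \<le> t \<Longrightarrow> t < 1 \<Longrightarrow> s powr (1/2) * w s \<le> M * (t powr (1/2) * w t)"
begin

text \<open>
  Almost monotonicity of the product with the square root bounds w by a multiple of s^(-1/2)
  on the left half of the interval; on the right half w is bounded because it decreases.
\<close>
lemma w_absint: "w absolutely_integrable_on {0<..<1}"
proof (rule measurable_bounded_by_integrable_imp_absolutely_integrable)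
  let ?K = "(M + 1) * w (1/2)"
  show "w \<in> borel_measurable (lebesgue_on {0<..<1})"
    by (intro continuous_imp_measurable_on_sets_lebesgue w_cont) simp
  have "(\<lambda>s. s powr (- 1/2)) integrable_on {0..1::real}"
    using has_integral_powr_from_0[of "-1/2" 1] by auto
  then have "(\<lambda>s. s powr (- 1/2)) integrable_on {0<..<1::real}"
    by (simp add: integrable_on_open_interval_real)
  then show "(\<lambda>s. ?K * s powr (- 1/2)) integrable_on {0<..<1::real}"
    by (rule integrable_on_mult_right)
  fix s :: real assume s: "s \<in> {0<..<1}"
  have w2: "0 < w (1/2)" by (rule w_pos) simp
  have "w s \<le> ?K * s powr (- 1/2)"
  proof (cases "s \<le> 1/2")
    case True
    have "s powr (1/2) * w s \<le> M * ((1/2) powr (1/2) * w (1/2))"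
      using True s by (intro w_quasi) auto
    also have "\<dots> \<le> M * (1 * w (1/2))"
      using M_pos w2 by (intro mult_left_mono mult_right_mono powr_le1) auto
    also have "\<dots> \<le> ?K" using w2 by (simp add: algebra_simps)
    finally have "s powr (- 1/2) * (s powr (1/2) * w s) \<le> s powr (- 1/2) * ?K" by (rule mult_left_mono) simp
    then show ?thesis using s by (simp add: powr_minus field_simps)
  next
    case False
    have "w s \<le> w (1/2)" using False s by (intro monotone_onD[OF w_anti]) auto
    also have "\<dots> \<le> ?K * 1" using M_pos w2 by (simp add: algebra_simps)
    also have "\<dots> \<le> ?K * s powr (- 1/2)"
    proof (rule mult_left_mono)
      show "1 \<le> s powr (- 1/2)" using s by (simp add: powr_minus one_le_inverse_iff powr_le1)
    qed (use M_pos w2 in simp)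
    finally show ?thesis .
  qed
  then show "norm (w s) \<le> ?K * s powr (- 1/2)" using w_pos[OF s] by simp
qed simp

lemma w_int: "w integrable_on {0..1}"
  using set_lebesgue_integral_eq_integral(1)[OF w_absint] unfolding integrable_on_open_interval_real .

definition W :: "real \<Rightarrow> real" where "W t = integral {0..t} w"

lemma W_eq: "0 \<le> t \<Longrightarrow> t \<le> 1 \<Longrightarrow> (LINT s:{0<..<t}|lebesgue. w s) = W t"
proof -
  assume t: "0 \<le> t" "t \<le> 1"
  have "w absolutely_integrable_on {0<..<t}"
    using w_absint by (rule set_integrable_subset) (use t in auto)
  then show ?thesis
    unfolding W_def by (simp add: set_lebesgue_integral_eq_integral(2) integral_open_interval_real)
qed

lemma W_cont: "continuous_on {0..1} W"
  unfolding W_def[abs_def] by (rule indefinite_integral_continuous_1[OF w_int])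

lemma W_deriv:
  assumes t: "t \<in> {0<..<1}"
  shows "(W has_real_derivative w t) (at t)"
proof -
  have "continuous (at t within {0..1}) w"
    by (rule continuous_at_imp_continuous_at_within, rule continuous_on_interior[OF w_cont])
      (use t in \<open>simp add: interior_open\<close>)
  then have "(W has_vector_derivative w t) (at t within {0..1})"
    unfolding W_def[abs_def] using t integral_has_vector_derivative_continuous_at[OF w_int, of t "{}"]
    by simp
  then have "(W has_real_derivative w t) (at t within {0<..<1})"
    unfolding has_real_derivative_iff_has_vector_derivative
    by (rule has_vector_derivative_within_subset) auto
  then show ?thesis by (simp only: at_within_open[OF t open_greaterThanLessThan])
qed

lemma W_0: "W 0 = 0" by (simp add: W_def)

lemma W_strict_mono:
  assumes st: "0 \<le> s" "s < t" "t \<le> 1"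
  shows "W s < W t"
proof (rule DERIV_pos_imp_increasing_open[OF st(2)])
  show "continuous_on {s..t} W" using st by (intro continuous_on_subset[OF W_cont]) auto
  fix x assume "s < x" "x < t"
  then show "\<exists>y. (W has_real_derivative y) (at x) \<and> 0 < y"
    using st W_deriv[of x] w_pos[of x] by auto
qed

lemma W_pos: "0 < t \<Longrightarrow> t \<le> 1 \<Longrightarrow> 0 < W t"
  using W_strict_mono[of 0 t] W_0 by simp

text \<open>
  Karamata's estimate: on (0,t) the weight is bounded by a multiple of t^(1/2) w(t) s^(-1/2),
  and the integral of s^(-1/2) is 2 t^(1/2).
\<close>
lemma W_le: assumes t: "t \<in> {0<..<1}" shows "W t \<le> 2 * M * (t * w t)"
proof -
  let ?c = "M * (t powr (1/2) * w t)"
  have "((\<lambda>s. ?c * s powr (- 1/2)) has_integral ?c * (t powr (1/2) / (1/2))) {0..t}"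
  proof (rule has_integral_mult_right)
    show "((\<lambda>s. s powr (- 1/2)) has_integral (t powr (1/2) / (1/2))) {0..t}"
      using has_integral_powr_from_0[of "-1/2" t] t by simp
  qed
  then have I: "((\<lambda>s. ?c * s powr (- 1/2)) has_integral ?c * (t powr (1/2) / (1/2))) {0<..<t}"
    by (simp only: has_integral_Icc_iff_Ioo)
  have "w integrable_on {0<..<t}"
    using integrable_subinterval_real[OF w_int, of 0 t] t by (simp add: integrable_on_open_interval_real)
  then have "integral {0<..<t} w \<le> integral {0<..<t} (\<lambda>s. ?c * s powr (- 1/2))"
  proof (rule integral_le)
    show "(\<lambda>s. ?c * s powr (- 1/2)) integrable_on {0<..<t}" using I by blast
    fix s assume s: "s \<in> {0<..<t}"
    have "s powr (- 1/2) * (s powr (1/2) * w s) \<le> s powr (- 1/2) * ?c"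
      using s t by (intro mult_left_mono w_quasi) auto
    then show "w s \<le> ?c * s powr (- 1/2)" using s by (simp add: powr_minus field_simps)
  qed
  also have "\<dots> = ?c * (t powr (1/2) / (1/2))" using I by (rule integral_unique)
  also have "\<dots> = 2 * M * ((t powr (1/2) * t powr (1/2)) * w t)" by simp
  also have "t powr (1/2) * t powr (1/2) = t" using t by (simp flip: powr_add)
  finally show ?thesis by (simp add: W_def integral_open_interval_real)
qed

definition phi :: "real \<Rightarrow> real" where "phi t = W t / W 1"

lemma phi_ends: "phi 0 = 0" "phi 1 = 1"
  using W_pos[of 1] by (auto simp: phi_def W_0)

lemma phi_mono: "0 \<le> s \<Longrightarrow> s < t \<Longrightarrow> t \<le> 1 \<Longrightarrow> phi s < phi t"
  unfolding phi_def using W_strict_mono[of s t] W_pos[of 1] by (simp add: divide_strict_right_mono)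

lemma phi_in: "t \<in> {0<..<1} \<Longrightarrow> phi t \<in> {0<..<1}"
  using phi_mono[of 0 t] phi_mono[of t 1] by (simp add: phi_ends)

lemma phi_cont: "continuous_on {0..1} phi"
  unfolding phi_def[abs_def] using W_pos[of 1] W_cont by (intro continuous_intros) auto

lemma phi_bij: "bij_betw phi {0..1} {0..1}"
proof -
  have inj: "inj_on phi {0..1}"
  proof (rule linorder_inj_onI')
    fix s t :: real assume "s \<in> {0..1}" "t \<in> {0..1}" "s < t"
    then show "phi s \<noteq> phi t" using phi_mono[of s t] by simp
  qed
  have "phi ` {0..1} = {0..1}"
  proof
    show "phi ` {0..1} \<subseteq> {0..1}"
    proof
      fix y assume "y \<in> phi ` {0..1}"
      then obtain x where x: "0 \<le> x" "x \<le> 1" "y = phi x" by auto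
      have "phi 0 \<le> phi x" "phi x \<le> phi 1"
        using phi_mono[of 0 x] phi_mono[of x 1] x by (cases "x = 0"; cases "x = 1"; auto)+
      then show "y \<in> {0..1}" using phi_ends x by simp
    qed
    show "{0..1} \<subseteq> phi ` {0..1}"
    proof
      fix y :: real assume "y \<in> {0..1}"
      then show "y \<in> phi ` {0..1}"
        using IVT'[of phi 0 y 1] phi_ends phi_cont by auto
    qed
  qed
  with inj show ?thesis by (simp add: bij_betw_def)
qed

lemma phi_deriv: "t \<in> {0<..<1} \<Longrightarrow> (phi has_real_derivative w t / W 1) (at t)"
  unfolding phi_def[abs_def] by (intro DERIV_cdivide W_deriv)

lemma phi_le_mono: "0 \<le> s \<Longrightarrow> s \<le> t \<Longrightarrow> t \<le> 1 \<Longrightarrow> phi s \<le> phi t"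
  using phi_mono[of s t] by (cases "s = t") auto

text \<open>
  The weight may be unbounded at 0, so the substitution is made on compact intervals [a n, x]
  with a n decreasing to 0, followed by monotone convergence.
\<close>
lemma phi_substitution:
  fixes f :: "real \<Rightarrow> real"
  assumes f: "f \<in> borel_measurable (restrict_space borel {0<..<1})" and x: "x \<in> {0<..<1}"
  shows "(\<integral>\<^sup>+s\<in>{0<..<phi x}. ennreal (f s) \<partial>lborel) \<le>
    (\<integral>\<^sup>+t\<in>{0<..<x}. ennreal (f (phi t) * (w t / W 1)) \<partial>lborel)"
proof -
  define a where "a n = x / real (n + 2)" for n :: nat
  have a: "0 < a n" "a n \<le> x" "a (Suc n) \<le> a n" for n
    using x by (auto simp: a_def field_simps)
  have a_lim: "a \<longlonglongrightarrow> 0"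
  proof -
    have "(\<lambda>n. x * (1 / real (Suc (Suc n)))) \<longlonglongrightarrow> x * 0"
      by (intro tendsto_mult_left LIMSEQ_Suc lim_1_over_n)
    then show ?thesis by (simp add: a_def[abs_def])
  qed
  have phi_lim: "(\<lambda>n. phi (a n)) \<longlonglongrightarrow> 0"
  proof -
    have "(\<lambda>n. phi (a n)) \<longlonglongrightarrow> phi 0"
      using less_imp_le[OF a(1)] order_trans[OF a(2), of 1] x
      by (intro continuous_on_tendsto_compose[OF phi_cont a_lim] always_eventually) auto
    then show ?thesis by (simp add: phi_ends)
  qed
  have mf: "(\<lambda>s. ennreal (f s) * indicator {phi (a n)..phi x} s) \<in> borel_measurable lborel" for n
  proof -
    have sub: "{phi (a n)..phi x} \<subseteq> {0<..<1}"
      using phi_in[of "a n"] phi_in[OF x] a[of n] x by auto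
    have "(\<lambda>s. indicator {0<..<1} s *\<^sub>R f s) \<in> borel_measurable borel"
      using f by (subst (asm) borel_measurable_restrict_space_iff) auto
    then have "(\<lambda>s. ennreal (indicator {0<..<1} s *\<^sub>R f s) * indicator {phi (a n)..phi x} s) \<in> borel_measurable borel"
      by measurable
    also have "(\<lambda>s. ennreal (indicator {0<..<1} s *\<^sub>R f s) * indicator {phi (a n)..phi x} s) =
        (\<lambda>s. ennreal (f s) * indicator {phi (a n)..phi x} s)"
      using sub by (auto simp: indicator_def fun_eq_iff)
    finally show ?thesis by simp
  qed
  have piece: "(\<integral>\<^sup>+s. ennreal (f s) * indicator {phi (a n)..phi x} s \<partial>lborel) \<le>
    (\<integral>\<^sup>+t\<in>{0<..<x}. ennreal (f (phi t) * (w t / W 1)) \<partial>lborel)" for n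
  proof -
    have in01: "t \<in> {0<..<1}" if "t \<in> {a n..x}" for t using that a[of n] x by auto
    have "(\<integral>\<^sup>+s. ennreal (f s) * indicator {phi (a n)..phi x} s \<partial>lborel) =
        (\<integral>\<^sup>+s. ennreal (f s * indicator {phi (a n)..phi x} s) \<partial>lborel)"
      by (intro nn_integral_cong) (auto simp: indicator_def)
    also have "\<dots> = (\<integral>\<^sup>+t. ennreal (f (phi t) * (w t / W 1) * indicator {a n..x} t) \<partial>lborel)"
    proof (rule nn_integral_substitution)
      show "set_borel_measurable borel {phi (a n)..phi x} f"
      proof -
        have sub: "{phi (a n)..phi x} \<subseteq> {0<..<1}"
          using phi_in[of "a n"] phi_in[OF x] a[of n] x by auto
        have "f \<in> borel_measurable (restrict_space borel {phi (a n)..phi x})"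
          using f sub by (rule measurable_restrict_mono)
        then show ?thesis
          unfolding set_borel_measurable_def by (subst (asm) borel_measurable_restrict_space_iff) auto
      qed
      show "(phi has_real_derivative w t / W 1) (at t)" if "t \<in> {a n..x}" for t
        using in01[OF that] by (rule phi_deriv)
      show "continuous_on {a n..x} (\<lambda>t. w t / W 1)"
        using W_pos[of 1] in01 by (intro continuous_intros continuous_on_subset[OF w_cont]) auto
      show "0 \<le> w t / W 1" if "t \<in> {a n..x}" for t
        using w_pos[OF in01[OF that]] W_pos[of 1] by simp
    qed (use a in simp)
    also have "\<dots> \<le> (\<integral>\<^sup>+t\<in>{0<..<x}. ennreal (f (phi t) * (w t / W 1)) \<partial>lborel)"
    proof (rule nn_integral_mono_AE)
      have "AE t in lborel. t \<noteq> x" by (rule AE_lborel_singleton)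
      then show "AE t in lborel. ennreal (f (phi t) * (w t / W 1) * indicator {a n..x} t) \<le>
          ennreal (f (phi t) * (w t / W 1)) * indicator {0<..<x} t"
      proof eventually_elim
        case (elim t)
        then show ?case using a(1)[of n] by (auto simp: indicator_def)
      qed
    qed
    finally show ?thesis .
  qed
  have "(\<integral>\<^sup>+s\<in>{0<..<phi x}. ennreal (f s) \<partial>lborel) \<le>
      (\<integral>\<^sup>+s. (SUP n. ennreal (f s) * indicator {phi (a n)..phi x} s) \<partial>lborel)"
  proof (rule nn_integral_mono)
    fix s
    show "ennreal (f s) * indicator {0<..<phi x} s \<le> (SUP n. ennreal (f s) * indicator {phi (a n)..phi x} s)"
    proof (cases "s \<in> {0<..<phi x}")
      case True
      then have "eventually (\<lambda>n. phi (a n) < s) sequentially"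
        by (intro order_tendstoD(2)[OF phi_lim]) simp
      then obtain n where "phi (a n) < s" by (auto simp: eventually_sequentially)
      then show ?thesis using True by (intro SUP_upper2[of n]) auto
    qed simp
  qed
  also have "\<dots> = (SUP n. \<integral>\<^sup>+s. ennreal (f s) * indicator {phi (a n)..phi x} s \<partial>lborel)"
  proof (rule nn_integral_monotone_convergence_SUP)
    show "incseq (\<lambda>n s. ennreal (f s) * indicator {phi (a n)..phi x} s)"
    proof (intro incseq_SucI le_funI)
      fix n s
      have "phi (a (Suc n)) \<le> phi (a n)"
        using a[of n] a[of "Suc n"] x by (intro phi_le_mono) auto
      then show "ennreal (f s) * indicator {phi (a n)..phi x} s \<le> ennreal (f s) * indicator {phi (a (Suc n))..phi x} s"
        by (auto simp: indicator_def)
    qed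
  qed (rule mf)
  also have "\<dots> \<le> (\<integral>\<^sup>+t\<in>{0<..<x}. ennreal (f (phi t) * (w t / W 1)) \<partial>lborel)"
    by (intro SUP_least piece)
  finally show ?thesis .
qed

end

locale Bp_pair =
  fixes p :: real and b1 b2 :: "real \<Rightarrow> real"
  assumes p: "0 < p" and Bp: "(b1, b2) \<in> B_class p"
begin

definition w :: "real \<Rightarrow> real" where "w s = (b1 s / b2 s) powr p"

lemma sv: "slowly_varying b1" "slowly_varying b2"
  and cont: "continuous_on {0<..<1} b1" "continuous_on {0<..<1} b2"
  and b1_anti: "antimono_on {0<..<1} b1" and b2_mono: "mono_on {0<..<1} b2"
  and cond_c: "\<exists>\<delta>\<in>{0<..<1}. approx_on {0<..<\<delta>} b1 (\<lambda>t. b1 (t * b1 t powr p * b2 t powr (- p)))"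
  and cond_d: "(SUP t\<in>{0<..<1}. ennreal (b2 t powr p) *
        (\<integral>\<^sup>+s\<in>{t<..<1}. ennreal (1 / (s * b1 s powr p)) \<partial>lebesgue)) < \<infinity>"
  using Bp by (simp_all only: B_class_def mem_Collect_eq prod.case)

lemma pos: "t \<in> {0<..<1} \<Longrightarrow> 0 < b1 t" "t \<in> {0<..<1} \<Longrightarrow> 0 < b2 t"
  using sv slowly_varying_pos by auto

lemma w_eq: "t \<in> {0<..<1} \<Longrightarrow> w t = b1 t powr p * b2 t powr (- p)"
  unfolding w_def powr_minus_divide using pos[of t] by (simp add: powr_divide)

text \<open>
  The square root is split evenly: t^(1/(4p)) makes b1 almost increasing, t^(-1/(4p)) makes b2
  almost decreasing, and the quotient of the two, raised to the power p, is t^(1/2) w(t).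
\<close>
lemma w_quasi_ex: "\<exists>M>0. \<forall>s t. 0 < s \<longrightarrow> s \<le> t \<longrightarrow> t < 1 \<longrightarrow> s powr (1/2) * w s \<le> M * (t powr (1/2) * w t)"
proof -
  define e where "e = 1 / (4 * p)"
  have e: "0 < e" using p by (simp add: e_def)
  obtain C1 where C1: "C1 > 0" "\<And>s t. 0 < s \<Longrightarrow> s \<le> t \<Longrightarrow> t < 1 \<Longrightarrow> s powr e * b1 s \<le> C1 * (t powr e * b1 t)"
    using slowly_varying_quasi_increasing[OF sv(1) e] by blast
  obtain C2 where C2: "C2 > 0" "\<And>s t. 0 < s \<Longrightarrow> s \<le> t \<Longrightarrow> t < 1 \<Longrightarrow> t powr (- e) * b2 t \<le> C2 * (s powr (- e) * b2 s)"
    using slowly_varying_quasi_decreasing[OF sv(2) e] by blast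
  have half: "(t powr e * b1 t / (t powr (- e) * b2 t)) powr p = t powr (1/2) * w t" if "0 < t" "t < 1" for t
  proof -
    have "t powr e * b1 t / (t powr (- e) * b2 t) = t powr (2 * e) * (b1 t / b2 t)"
    proof -
      have "t powr (2 * e) = t powr e * t powr e" by (simp flip: powr_add)
      then show ?thesis by (simp add: powr_minus field_simps)
    qed
    then have "(t powr e * b1 t / (t powr (- e) * b2 t)) powr p = (t powr (2 * e)) powr p * (b1 t / b2 t) powr p"
      using pos[of t] that by (simp only: powr_mult)
    also have "(t powr (2 * e)) powr p = t powr (1/2)" using p by (simp add: powr_powr e_def)
    finally show ?thesis by (simp add: w_def)
  qed
  show ?thesis
  proof (intro exI[of _ "(C1 * C2) powr p"] conjI allI impI)
    fix s t :: real assume st: "0 < s" "s \<le> t" "t < 1"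
    have P: "0 < b1 s" "0 < b2 s" "0 < b1 t" "0 < b2 t" using st pos[of s] pos[of t] by auto
    have "s powr e * b1 s / (s powr (- e) * b2 s) \<le> C1 * (t powr e * b1 t) / (t powr (- e) * b2 t / C2)"
      using C1 C2 st P C1(2)[OF st] C2(2)[OF st]
      by (intro frac_le) (auto simp: field_simps)
    also have "\<dots> = C1 * C2 * (t powr e * b1 t / (t powr (- e) * b2 t))" by (simp add: field_simps)
    finally have "(s powr e * b1 s / (s powr (- e) * b2 s)) powr p \<le> (C1 * C2 * (t powr e * b1 t / (t powr (- e) * b2 t))) powr p"
      using P st p by (intro powr_mono2) auto
    also have "\<dots> = (C1 * C2) powr p * (t powr e * b1 t / (t powr (- e) * b2 t)) powr p"
      using C1 C2 P by (subst powr_mult) auto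
    finally show "s powr (1/2) * w s \<le> (C1 * C2) powr p * (t powr (1/2) * w t)"
      using half[of s] half[of t] st by simp
  qed (use C1 C2 in simp)
qed

text \<open>
  A choice of the constant in \<open>w_quasi_ex\<close>, as the locale of weights has it as a
  parameter.
\<close>
definition M :: real where
  "M = (SOME M. M > 0 \<and> (\<forall>s t. 0 < s \<longrightarrow> s \<le> t \<longrightarrow> t < 1 \<longrightarrow> s powr (1/2) * w s \<le> M * (t powr (1/2) * w t)))"

sublocale decreasing_weight w M
proof
  have M: "M > 0 \<and> (\<forall>s t. 0 < s \<longrightarrow> s \<le> t \<longrightarrow> t < 1 \<longrightarrow> s powr (1/2) * w s \<le> M * (t powr (1/2) * w t))"
    unfolding M_def by (rule someI_ex) (rule w_quasi_ex)
  then show "0 < M" by blast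
  show "s powr (1/2) * w s \<le> M * (t powr (1/2) * w t)" if "0 < s" "s \<le> t" "t < 1" for s t
    using M that by blast
  show "0 < w s" if "s \<in> {0<..<1}" for s using pos[OF that] by (simp add: w_def)
  show "continuous_on {0<..<1} w"
    unfolding w_def[abs_def]
  proof (intro continuous_intros cont ballI)
    fix x :: real assume "x \<in> {0<..<1}"
    from pos[OF this] show "b2 x \<noteq> 0" "b1 x / b2 x \<noteq> 0" by auto
  qed
  show "antimono_on {0<..<1} w"
  proof (rule monotone_onI)
    fix s t :: real assume st: "s \<in> {0<..<1}" "t \<in> {0<..<1}" "s \<le> t"
    have "b1 t / b2 t \<le> b1 s / b2 s"
      using pos[OF st(1)] pos[OF st(2)] monotone_onD[OF b1_anti st] monotone_onD[OF b2_mono st]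
      by (intro frac_le) auto
    then show "w t \<le> w s" using pos[OF st(2)] p by (auto simp: w_def intro!: powr_mono2)
  qed
qed

lemma is_sigma_iff:
  "is_sigma p b1 b2 s \<longleftrightarrow> bij_betw s {0..1} {0..1} \<and> strict_mono_on {0..1} s \<and>
     (\<forall>t\<in>{0..1}. t powr p = phi (s t powr p))"
proof -
  have "1 / (LINT s:{0<..<1}|lebesgue. (b1 s / b2 s) powr p) *
      (LINT s:{0<..<x}|lebesgue. (b1 s / b2 s) powr p) = phi x" if "x \<in> {0..1}" for x
    using W_eq[of 1] W_eq[of x] that by (simp add: w_def phi_def)
  moreover have "s t powr p \<in> {0..1}" if "bij_betw s {0..1} {0..1}" "t \<in> {0..1}" for t
    using bij_betw_apply[OF that] p by (simp add: powr_le1)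
  ultimately show ?thesis unfolding is_sigma_def by (metis (no_types, lifting))
qed

text \<open>
  The choice operator in the definition of sigma is harmless once a solution exists; it is
  obtained from the inverse of phi by conjugating with the power p.
\<close>
lemma is_sigma_sigma: "is_sigma p b1 b2 (sigma p b1 b2)"
proof -
  define psi where "psi = the_inv_into {0..1} phi"
  have psi: "bij_betw psi {0..1} {0..1}"
    unfolding psi_def by (rule bij_betw_the_inv_into[OF phi_bij])
  have phi_psi: "phi (psi y) = y" if "y \<in> {0..1}" for y
    unfolding psi_def using phi_bij that by (intro f_the_inv_into_f_bij_betw) auto
  have psi_in: "psi y \<in> {0..1}" if "y \<in> {0..1}" for y
    using bij_betw_apply[OF psi that] .
  have psi_mono: "psi x < psi y" if "x \<in> {0..1}" "y \<in> {0..1}" "x < y" for x y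
  proof (rule ccontr)
    assume "\<not> psi x < psi y"
    then have "phi (psi y) \<le> phi (psi x)"
      using phi_mono[of "psi y" "psi x"] psi_in[OF that(1)] psi_in[OF that(2)]
      by (cases "psi y = psi x") auto
    with phi_psi that show False by auto
  qed
  have pw: "t powr a \<in> {0..1}" if "t \<in> {0..1}" "0 < a" for t a :: real
    using that by (auto intro: powr_le1)
  have inv: "(t powr a) powr (1 / a) = t" if "0 \<le> t" "0 < a" for t a :: real
    using that by (simp add: powr_powr)
  define s where "s t = psi (t powr p) powr (1 / p)" for t
  have s_in: "s t \<in> {0..1}" if "t \<in> {0..1}" for t
    unfolding s_def using p that by (intro pw psi_in) auto
  have s_phi: "t powr p = phi (s t powr p)" if "t \<in> {0..1}" for t
  proof -
    have "s t powr p = psi (t powr p)"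
      using psi_in[OF pw[OF that p]] p by (simp add: s_def powr_powr)
    then show ?thesis using phi_psi[OF pw[OF that p]] by simp
  qed
  have s_mono: "strict_mono_on {0..1} s"
  proof (rule strict_mono_onI)
    fix x y :: real assume xy: "x \<in> {0..1}" "y \<in> {0..1}" "x < y"
    have "psi (x powr p) < psi (y powr p)"
      using xy p by (intro psi_mono pw powr_less_mono2) auto
    then show "s x < s y" unfolding s_def using p psi_in[OF pw[OF xy(1) p]]
      by (intro powr_less_mono2) auto
  qed
  have s_surj: "\<exists>t\<in>{0..1}. s t = y" if y: "y \<in> {0..1}" for y
  proof (intro bexI)
    have y': "y powr p \<in> {0..1}" using pw[OF y p] .
    have phi_y: "phi (y powr p) \<in> {0..1}" using bij_betw_apply[OF phi_bij y'] .
    show "phi (y powr p) powr (1 / p) \<in> {0..1}" using phi_y p by (intro pw) auto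
    have "psi (phi (y powr p)) = y powr p"
      unfolding psi_def using phi_bij y' by (intro the_inv_into_f_f) (auto simp: bij_betw_def)
    then show "s (phi (y powr p) powr (1 / p)) = y"
      using phi_y p y by (simp add: s_def powr_powr)
  qed
  have "bij_betw s {0..1} {0..1}"
    unfolding bij_betw_def using strict_mono_on_imp_inj_on[OF s_mono] s_in s_surj by blast
  then have "is_sigma p b1 b2 s"
    unfolding is_sigma_iff using s_mono s_phi by blast
  then show ?thesis unfolding sigma_def by (rule someI[where P = "is_sigma p b1 b2"])
qed

text \<open>
  Any solution of the defining equation gives this value, since the equation at the point
  sigma^(-1)(t^(1/p)) reads sigma^(-1)(t^(1/p))^p = phi(t).
\<close>
lemma sigma_inverse:
  assumes t: "t \<in> {0<..<1}"
  shows "the_inv_into {0..1} (sigma p b1 b2) (t powr (1 / p)) powr p = phi t"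
proof -
  let ?s = "sigma p b1 b2" and ?u = "the_inv_into {0..1} (sigma p b1 b2) (t powr (1 / p))"
  have s: "bij_betw ?s {0..1} {0..1}" "\<And>t. t \<in> {0..1} \<Longrightarrow> t powr p = phi (?s t powr p)"
    using is_sigma_sigma unfolding is_sigma_iff by auto
  have tp: "t powr (1 / p) \<in> {0..1}" using t p by (auto intro: powr_le1)
  have "?u \<in> {0..1}" using bij_betw_apply[OF bij_betw_the_inv_into[OF s(1)] tp] .
  then have "?u powr p = phi (?s ?u powr p)" by (rule s(2))
  also have "?s ?u = t powr (1 / p)" using s(1) tp by (rule f_the_inv_into_f_bij_betw)
  also have "(t powr (1 / p)) powr p = t" using t p by (simp add: powr_powr)
  finally show ?thesis .
qed

lemma U_op_eq: "t \<in> {0<..<1} \<Longrightarrow> U_op b1 b2 p f t = ennreal (rearr f (phi t) / b2 t)"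
  unfolding U_op_def by (simp only: sigma_inverse)

end

section \<open>Majorization of the integral operator on nonincreasing functions\<close>

text \<open>
  For fixed s the set of t in (0,x) with t < s has measure at most s.
\<close>
lemma tail_integral_Tonelli:
  fixes q :: "real \<Rightarrow> ennreal"
  assumes [measurable]: "q \<in> borel_measurable lborel"
  shows "(\<integral>\<^sup>+t\<in>{0<..<x}. (\<integral>\<^sup>+s\<in>{t<..<1}. q s \<partial>lborel) \<partial>lborel) \<le> (\<integral>\<^sup>+s\<in>{0<..<1}. ennreal s * q s \<partial>lborel)"
proof -
  have [measurable]: "Measurable.pred (borel \<Otimes>\<^sub>M borel) (\<lambda>z. snd z < (fst z :: real))" by measurable
  have "(\<integral>\<^sup>+t\<in>{0<..<x}. (\<integral>\<^sup>+s\<in>{t<..<1}. q s \<partial>lborel) \<partial>lborel) =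
      (\<integral>\<^sup>+t. (\<integral>\<^sup>+s. q s * indicator {t<..<1} s * indicator {0<..<x} t \<partial>lborel) \<partial>lborel)"
    by (subst nn_integral_multc[symmetric]) auto
  also have "\<dots> = (\<integral>\<^sup>+s. (\<integral>\<^sup>+t. q s * indicator {t<..<1} s * indicator {0<..<x} t \<partial>lborel) \<partial>lborel)"
    by (rule lborel_pair.Fubini'[symmetric]) (simp add: indicator_def split_beta; measurable)
  also have "\<dots> \<le> (\<integral>\<^sup>+s. (\<integral>\<^sup>+t. (q s * indicator {0<..<1} s) * indicator {0<..<s} t \<partial>lborel) \<partial>lborel)"
    by (intro nn_integral_mono) (auto simp: indicator_def)
  also have "\<dots> = (\<integral>\<^sup>+s\<in>{0<..<1}. ennreal s * q s \<partial>lborel)"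
  proof (rule nn_integral_cong)
    fix s :: real
    have "(\<integral>\<^sup>+t. (q s * indicator {0<..<1} s) * indicator {0<..<s} t \<partial>lborel) =
        (q s * indicator {0<..<1} s) * emeasure lborel {0<..<s}"
      by (subst nn_integral_cmult_indicator) auto
    then show "(\<integral>\<^sup>+t. (q s * indicator {0<..<1} s) * indicator {0<..<s} t \<partial>lborel) = ennreal s * q s * indicator {0<..<1} s"
      by (auto simp: indicator_def mult.commute)
  qed
  finally show ?thesis .
qed

context Bp_pair begin

text \<open>
  On the left half b1 decreases, and on the right half t b1(t) is almost increasing.
\<close>
lemma b1_lower: "\<exists>m>0. \<forall>t\<in>{0<..<1}. m \<le> b1 t"
proof -
  obtain C where C: "C > 0" "\<And>s t. 0 < s \<Longrightarrow> s \<le> t \<Longrightarrow> t < 1 \<Longrightarrow> s powr 1 * b1 s \<le> C * (t powr 1 * b1 t)"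
    using slowly_varying_quasi_increasing[OF sv(1), of 1] by auto
  have b: "0 < b1 (1/2)" by (rule pos) simp
  let ?m = "min (b1 (1/2)) (b1 (1/2) / (2 * C))"
  have "?m \<le> b1 t" if t: "t \<in> {0<..<1}" for t
  proof (cases "t \<le> 1/2")
    case True
    then have "b1 (1/2) \<le> b1 t" using t by (intro monotone_onD[OF b1_anti]) auto
    then show ?thesis by simp
  next
    case False
    have "1/2 * b1 (1/2) \<le> C * (t * b1 t)" using C(2)[of "1/2" t] False t by simp
    also have "\<dots> \<le> C * (1 * b1 t)" using C(1) t pos[OF t] by (intro mult_left_mono mult_right_mono) auto
    finally have "b1 (1/2) / (2 * C) \<le> b1 t" using C(1) by (simp add: field_simps)
    then show ?thesis by simp
  qed
  then show ?thesis using b C by (intro exI[of _ ?m]) auto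
qed

text \<open>
  For small t, condition (c) compares b1(t) with b1(r), where r = t w(t). By Karamata's
  estimate phi(t) \<le> A r for a constant A, and slow variation lets r be replaced by A r.
  For t away from 0 both sides are bounded and bounded away from 0.
\<close>
lemma b1_phi: "\<exists>c>0. \<forall>t\<in>{0<..<1}. b1 t \<le> c * b1 (phi t)"
proof -
  obtain m where m: "m > 0" "\<And>t. t \<in> {0<..<1} \<Longrightarrow> m \<le> b1 t" using b1_lower by blast
  obtain d c0 where d: "d \<in> {0<..<1}" "c0 > 0"
    and c0: "\<And>t. t \<in> {0<..<d} \<Longrightarrow> b1 t \<le> c0 * b1 (t * b1 t powr p * b2 t powr (- p))"
    using cond_c unfolding approx_on_def by blast
  obtain C where C: "C > 0" "\<And>s t. 0 < s \<Longrightarrow> s \<le> t \<Longrightarrow> t < 1 \<Longrightarrow> s powr 1 * b1 s \<le> C * (t powr 1 * b1 t)"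
    using slowly_varying_quasi_increasing[OF sv(1), of 1] by auto
  define A where "A = max 1 (2 * M / W 1)"
  have A: "1 \<le> A" "2 * M / W 1 \<le> A" by (auto simp: A_def)
  define K where "K = M * w (1/2)"
  have K: "0 < K" using M_pos w_pos[of "1/2"] by (simp add: K_def)
  have tw: "t * w t \<le> K * t powr (1/2)" if "0 < t" "t \<le> 1/2" for t
  proof -
    have "t powr (1/2) * w t \<le> M * ((1/2) powr (1/2) * w (1/2))" using that by (intro w_quasi) auto
    also have "\<dots> \<le> M * (1 * w (1/2))"
      using M_pos w_pos[of "1/2"] by (intro mult_left_mono mult_right_mono powr_le1) auto
    finally have "t powr (1/2) * (t powr (1/2) * w t) \<le> t powr (1/2) * K"
      by (intro mult_left_mono) (auto simp: K_def)
    moreover have "t powr (1/2) * (t powr (1/2) * w t) = t * w t"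
    proof -
      have "t powr (1/2) * t powr (1/2) = t" using that by (simp flip: powr_add)
      then show ?thesis by (simp only: mult.assoc[symmetric])
    qed
    ultimately show ?thesis by (simp only: mult.commute[of _ K])
  qed
  \<comment> \<open>Below e condition (c) is available and A t w(t) \<le> A K t^(1/2) < 1, so that b1 is evaluated inside (0,1).\<close>
  define e where "e = min (min d (1/2)) ((1 / (A * K)) powr 2)"
  have e: "0 < e" "e \<le> d" "e \<le> 1/2" "e \<le> (1 / (A * K)) powr 2"
    using d K A by (auto simp: e_def)
  define c where "c = max (c0 * (C * A)) (b1 e / m)"
  have c: "c0 * (C * A) \<le> c" "b1 e / m \<le> c" "c > 0"
  proof -
    show "c0 * (C * A) \<le> c" "b1 e / m \<le> c" by (auto simp: c_def)
    have "0 < c0 * (C * A)" using d C A by (intro mult_pos_pos) auto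
    with \<open>c0 * (C * A) \<le> c\<close> show "c > 0" by linarith
  qed
  have "b1 t \<le> c * b1 (phi t)" if t: "t \<in> {0<..<1}" for t
  proof (cases "t < e")
    case True
    define r where "r = t * w t"
    have r0: "0 < r" using t w_pos[OF t] by (simp add: r_def)
    have "A * r \<le> A * (K * t powr (1/2))" using tw[of t] True t e A by (auto simp: r_def)
    also have "\<dots> < A * (K * (1 / (A * K)))"
    proof -
      have "t powr (1/2) < ((1 / (A * K)) powr 2) powr (1/2)" using True t e by (intro powr_less_mono2) auto
      also have "\<dots> = 1 / (A * K)" using A K by (simp only: powr_powr) simp
      finally show ?thesis using A K by (intro mult_strict_left_mono) auto
    qed
    also have "\<dots> = 1" using A K by simp
    finally have Ar: "A * r < 1" .
    have rA: "r \<le> A * r" using r0 A by simp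
    have "phi t \<le> 2 * M / W 1 * r"
      unfolding phi_def r_def using W_le[OF t] W_pos[of 1] by (simp add: field_simps)
    also have "\<dots> \<le> A * r" using A r0 by (intro mult_right_mono) auto
    finally have phi_r: "phi t \<le> A * r" .
    have "b1 t \<le> c0 * b1 r"
      using c0[of t] True t e w_eq[OF t] by (simp add: r_def mult.assoc)
    also have "b1 r \<le> (C * A) * b1 (A * r)"
      using C(2)[OF r0 rA Ar] r0 A by (simp add: field_simps)
    also have "b1 (A * r) \<le> b1 (phi t)"
      using phi_in[OF t] Ar r0 phi_r A by (intro monotone_onD[OF b1_anti]) auto
    finally have "b1 t \<le> c0 * ((C * A) * b1 (phi t))" using d C A by (simp add: mult_left_mono)
    also have "\<dots> = c0 * (C * A) * b1 (phi t)" by simp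
    also have "\<dots> \<le> c * b1 (phi t)" using c pos[OF phi_in[OF t]] by (intro mult_right_mono) auto
    finally show ?thesis .
  next
    case False
    have "b1 t \<le> b1 e" using False t e by (intro monotone_onD[OF b1_anti]) auto
    also have "\<dots> = b1 e / m * m" using m by simp
    also have "\<dots> \<le> c * b1 (phi t)"
      using c m phi_in[OF t] by (intro mult_mono) auto
    finally show ?thesis .
  qed
  then show ?thesis using c by blast
qed

definition v :: "real \<Rightarrow> real" where "v s = 1 / (s * b1 s powr p)"

lemma v_pos: "s \<in> {0<..<1} \<Longrightarrow> 0 < v s"
  using pos[of s] by (simp add: v_def)

lemma v_cont: "continuous_on {0<..<1} v"
  unfolding v_def[abs_def]
proof (intro continuous_intros cont ballI)
  fix x :: real assume x: "x \<in> {0<..<1}"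
  from pos[OF x] show "b1 x \<noteq> 0" by simp
  with x show "x * b1 x powr p \<noteq> 0" by simp
qed

text \<open>
  Condition (d), with the supremum turned into a real constant.
\<close>
lemma v_tail: "\<exists>K>0. \<forall>t\<in>{0<..<1}. (\<integral>\<^sup>+s\<in>{t<..<1}. ennreal (v s) \<partial>lborel) \<le> ennreal (K / b2 t powr p)"
proof -
  define S where "S = (SUP t\<in>{0<..<1}. ennreal (b2 t powr p) *
        (\<integral>\<^sup>+s\<in>{t<..<1}. ennreal (1 / (s * b1 s powr p)) \<partial>lebesgue))"
  have S: "S < \<infinity>" using cond_d by (simp add: S_def)
  define K where "K = enn2real S + 1"
  have "(\<integral>\<^sup>+s\<in>{t<..<1}. ennreal (v s) \<partial>lborel) \<le> ennreal (K / b2 t powr p)" if t: "t \<in> {0<..<1}" for t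
  proof -
    let ?B = "b2 t powr p" and ?I = "\<integral>\<^sup>+s\<in>{t<..<1}. ennreal (v s) \<partial>lborel"
    have B: "0 < ?B" using pos[OF t] by simp
    have "ennreal ?B * ?I = ennreal ?B * (\<integral>\<^sup>+s\<in>{t<..<1}. ennreal (1 / (s * b1 s powr p)) \<partial>lebesgue)"
      by (simp add: nn_integral_completion v_def)
    also have "\<dots> \<le> S" unfolding S_def by (rule SUP_upper[OF t])
    also have "S = ennreal (enn2real S)" using S by simp
    also have "\<dots> \<le> ennreal K" by (intro ennreal_leI) (simp add: K_def)
    finally have "ennreal (1 / ?B) * (ennreal ?B * ?I) \<le> ennreal (1 / ?B) * ennreal K" by (rule mult_left_mono) simp
    moreover have "ennreal (1 / ?B) * (ennreal ?B * ?I) = ?I"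
      using B by (simp add: mult.assoc[symmetric] flip: ennreal_mult')
    moreover have "ennreal (1 / ?B) * ennreal K = ennreal (K / ?B)"
      using B by (simp flip: ennreal_mult')
    ultimately show ?thesis by simp
  qed
  moreover have "K > 0" using enn2real_nonneg[of S] by (simp add: K_def add_nonneg_pos)
  ultimately show ?thesis by blast
qed

text \<open>
  The inner integral is cut at phi(x). The outer part is bounded pointwise by condition (d)
  and monotonicity of h; the inner part, the integral of q, is treated by Tonelli's theorem
  and the substitution s = phi(t).
\<close>
lemma S_majorized_by_U:
  "\<exists>C>0. \<forall>h x. antimono_on {0<..<1} h \<longrightarrow> (\<forall>s\<in>{0<..<1}. 0 \<le> h s) \<longrightarrow> x \<in> {0<..<1} \<longrightarrow>
     (\<integral>\<^sup>+t\<in>{0<..<x}. (\<integral>\<^sup>+s\<in>{t<..<1}. ennreal (h s * v s) \<partial>lborel) \<partial>lborel) \<le>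
     (\<integral>\<^sup>+t\<in>{0<..<x}. ennreal (C * (h (phi t) / b2 t powr p)) \<partial>lborel)"
proof -
  obtain c where c: "c > 0" "\<And>t. t \<in> {0<..<1} \<Longrightarrow> b1 t \<le> c * b1 (phi t)" using b1_phi by blast
  obtain K where K: "K > 0" "\<And>t. t \<in> {0<..<1} \<Longrightarrow>
      (\<integral>\<^sup>+s\<in>{t<..<1}. ennreal (v s) \<partial>lborel) \<le> ennreal (K / b2 t powr p)" using v_tail by blast
  define D where "D = c powr p / W 1"
  have D: "0 < D" using c W_pos[of 1] by (simp add: D_def)
  show ?thesis
  proof (intro exI[of _ "D + K"] conjI allI impI)
    show "0 < D + K" using D K by simp
    fix h :: "real \<Rightarrow> real" and x :: real
    assume h: "antimono_on {0<..<1} h" and h0: "\<forall>s\<in>{0<..<1}. 0 \<le> h s" and x: "x \<in> {0<..<1}"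
    have mh: "h \<in> borel_measurable (restrict_space borel {0<..<1})" by (rule antimono_measurable[OF h])
    have mb1: "b1 \<in> borel_measurable (restrict_space borel {0<..<1})"
      by (rule borel_measurable_continuous_on_restrict[OF cont(1)])
    have mv: "v \<in> borel_measurable (restrict_space borel {0<..<1})"
      by (rule borel_measurable_continuous_on_restrict[OF v_cont])
    define q where "q s = ennreal (h s * v s) * indicator {0<..<phi x} s" for s
    have mq: "q \<in> borel_measurable lborel"
    proof -
      have "(\<lambda>s. ennreal (h s * v s)) \<in> borel_measurable (restrict_space borel {0<..<1})"
        using mh mv by measurable
      then have "(\<lambda>s. ennreal (h s * v s) * indicator {0<..<1} s) \<in> borel_measurable borel"
        by (subst (asm) borel_measurable_restrict_space_iff_ennreal) auto
      then have "(\<lambda>s. ennreal (h s * v s) * indicator {0<..<1} s * indicator {0<..<phi x} s) \<in> borel_measurable borel"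
        by measurable
      also have "(\<lambda>s. ennreal (h s * v s) * indicator {0<..<1} s * indicator {0<..<phi x} s) = q"
        using phi_in[OF x] by (auto simp: q_def indicator_def fun_eq_iff)
      finally show ?thesis by simp
    qed
    have hphi_anti: "antimono_on {0<..<1} (\<lambda>t. h (phi t))"
      using phi_in phi_le_mono by (intro monotone_onI monotone_onD[OF h]) auto
    have mu: "(\<lambda>t. ennreal (a * (h (phi t) / b2 t powr p)) * indicator {0<..<x} t) \<in> borel_measurable lborel" for a
    proof -
      have "b2 \<in> borel_measurable (restrict_space borel {0<..<1})"
        by (rule borel_measurable_continuous_on_restrict[OF cont(2)])
      with antimono_measurable[OF hphi_anti]
      have "(\<lambda>t. ennreal (a * (h (phi t) / b2 t powr p))) \<in> borel_measurable (restrict_space borel {0<..<1})"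
        by measurable
      then have "(\<lambda>t. ennreal (a * (h (phi t) / b2 t powr p)) * indicator {0<..<1} t) \<in> borel_measurable borel"
        by (subst (asm) borel_measurable_restrict_space_iff_ennreal) auto
      then have "(\<lambda>t. ennreal (a * (h (phi t) / b2 t powr p)) * indicator {0<..<1} t * indicator {0<..<x} t) \<in> borel_measurable borel"
        by measurable
      also have "(\<lambda>t. ennreal (a * (h (phi t) / b2 t powr p)) * indicator {0<..<1} t * indicator {0<..<x} t) =
          (\<lambda>t. ennreal (a * (h (phi t) / b2 t powr p)) * indicator {0<..<x} t)"
        using x by (auto simp: indicator_def fun_eq_iff)
      finally show ?thesis by simp
    qed
    have pointwise: "(\<integral>\<^sup>+s\<in>{t<..<1}. ennreal (h s * v s) \<partial>lborel) \<le>
        (\<integral>\<^sup>+s\<in>{t<..<1}. q s \<partial>lborel) + ennreal (K * (h (phi t) / b2 t powr p))" if t: "t \<in> {0<..<x}" for t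
    proof -
      have t1: "t \<in> {0<..<1}" using t x by auto
      have "(\<integral>\<^sup>+s\<in>{t<..<1}. ennreal (h s * v s) \<partial>lborel) \<le>
          (\<integral>\<^sup>+s. q s * indicator {t<..<1} s + ennreal (h (phi x)) * (ennreal (v s) * indicator {t<..<1} s) \<partial>lborel)"
      proof (rule nn_integral_mono)
        fix s :: real
        have "h s * v s \<le> h (phi x) * v s" if "phi x \<le> s" "s < 1"
          using that phi_in[OF x] v_pos[of s] by (intro mult_right_mono monotone_onD[OF h]) auto
        then show "ennreal (h s * v s) * indicator {t<..<1} s \<le>
            q s * indicator {t<..<1} s + ennreal (h (phi x)) * (ennreal (v s) * indicator {t<..<1} s)"
          using t phi_in[OF x] h0 v_pos[of s]
          by (auto simp: q_def indicator_def not_less ennreal_leI simp flip: ennreal_mult')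
      qed
      also have "\<dots> = (\<integral>\<^sup>+s\<in>{t<..<1}. q s \<partial>lborel) + ennreal (h (phi x)) * (\<integral>\<^sup>+s\<in>{t<..<1}. ennreal (v s) \<partial>lborel)"
      proof -
        have mvt: "(\<lambda>s. ennreal (v s) * indicator {t<..<1} s) \<in> borel_measurable lborel"
        proof -
          have "(\<lambda>s. ennreal (v s)) \<in> borel_measurable (restrict_space borel {t<..<1})"
            using t by (intro measurable_compose[OF measurable_restrict_mono[OF mv] measurable_ennreal]) auto
          then show ?thesis
            by (subst (asm) borel_measurable_restrict_space_iff_ennreal) auto
        qed
        show ?thesis using mq mvt by (subst nn_integral_add) (auto simp: nn_integral_cmult)
      qed
      also have "ennreal (h (phi x)) * (\<integral>\<^sup>+s\<in>{t<..<1}. ennreal (v s) \<partial>lborel) \<le>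
          ennreal (h (phi t)) * ennreal (K / b2 t powr p)"
        using t x phi_in[OF t1] phi_in[OF x] phi_mono[of t x]
        by (intro mult_mono K(2)[OF t1] ennreal_leI monotone_onD[OF h]) auto
      also have "\<dots> = ennreal (K * (h (phi t) / b2 t powr p))"
      proof -
        have "0 \<le> h (phi t)" using h0 phi_in[OF t1] by blast
        then have "ennreal (h (phi t)) * ennreal (K / b2 t powr p) = ennreal (h (phi t) * (K / b2 t powr p))"
          by (rule ennreal_mult'[symmetric])
        then show ?thesis by (simp add: mult.commute)
      qed
      finally show ?thesis by (simp add: add_left_mono)
    qed
    have mT: "(\<lambda>t. (\<integral>\<^sup>+s\<in>{t<..<1}. q s \<partial>lborel) * indicator {0<..<x} t) \<in> borel_measurable lborel"
    proof -
      have [measurable]: "q \<in> borel_measurable borel" using mq by simp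
      have "(\<lambda>t. (\<integral>\<^sup>+s. q s * (if t < s \<and> s < 1 then 1 else 0) \<partial>lborel)) \<in> borel_measurable borel"
        by measurable
      then show ?thesis by (simp add: indicator_def of_bool_def)
    qed
    have "(\<integral>\<^sup>+t\<in>{0<..<x}. (\<integral>\<^sup>+s\<in>{t<..<1}. ennreal (h s * v s) \<partial>lborel) \<partial>lborel) \<le>
        (\<integral>\<^sup>+t. (\<integral>\<^sup>+s\<in>{t<..<1}. q s \<partial>lborel) * indicator {0<..<x} t +
            ennreal (K * (h (phi t) / b2 t powr p)) * indicator {0<..<x} t \<partial>lborel)"
      using pointwise by (intro nn_integral_mono) (auto simp: indicator_def)
    also have "\<dots> = (\<integral>\<^sup>+t\<in>{0<..<x}. (\<integral>\<^sup>+s\<in>{t<..<1}. q s \<partial>lborel) \<partial>lborel) +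
        (\<integral>\<^sup>+t\<in>{0<..<x}. ennreal (K * (h (phi t) / b2 t powr p)) \<partial>lborel)"
      by (rule nn_integral_add[OF mT mu])
    also have "(\<integral>\<^sup>+t\<in>{0<..<x}. (\<integral>\<^sup>+s\<in>{t<..<1}. q s \<partial>lborel) \<partial>lborel) \<le> (\<integral>\<^sup>+s\<in>{0<..<1}. ennreal s * q s \<partial>lborel)"
      by (rule tail_integral_Tonelli[OF mq])
    also have "\<dots> = (\<integral>\<^sup>+s\<in>{0<..<phi x}. ennreal (h s / b1 s powr p) \<partial>lborel)"
      using phi_in[OF x] by (intro nn_integral_cong) (auto simp: q_def v_def indicator_def simp flip: ennreal_mult')
    also have "\<dots> \<le> (\<integral>\<^sup>+t\<in>{0<..<x}. ennreal (h (phi t) / b1 (phi t) powr p * (w t / W 1)) \<partial>lborel)"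
    proof (rule phi_substitution[OF _ x])
      show "(\<lambda>s. h s / b1 s powr p) \<in> borel_measurable (restrict_space borel {0<..<1})"
        using mh mb1 by measurable
    qed
    also have "\<dots> \<le> (\<integral>\<^sup>+t\<in>{0<..<x}. ennreal (D * (h (phi t) / b2 t powr p)) \<partial>lborel)"
    proof (rule nn_integral_mono)
      fix t :: real
      have "h (phi t) / b1 (phi t) powr p * (w t / W 1) \<le> D * (h (phi t) / b2 t powr p)" if t: "t \<in> {0<..<x}"
      proof -
        have t1: "t \<in> {0<..<1}" using t x by auto
        have P: "0 < b1 t" "0 < b2 t" "0 < b1 (phi t)" using pos[OF t1] pos[OF phi_in[OF t1]] by auto
        have "b1 t powr p \<le> (c * b1 (phi t)) powr p" using c(2)[OF t1] P p by (intro powr_mono2) auto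
        also have "\<dots> = c powr p * b1 (phi t) powr p" using c P by (simp add: powr_mult)
        finally have "b1 t powr p / b1 (phi t) powr p \<le> c powr p" using P by (simp add: field_simps)
        then have "h (phi t) / (b2 t powr p * W 1) * (b1 t powr p / b1 (phi t) powr p) \<le>
            h (phi t) / (b2 t powr p * W 1) * c powr p"
          using h0 phi_in[OF t1] P W_pos[of 1] by (intro mult_left_mono) auto
        moreover have "w t = b1 t powr p / b2 t powr p" using P by (simp add: w_def powr_divide)
        ultimately show ?thesis by (simp add: D_def mult.commute)
      qed
      then show "ennreal (h (phi t) / b1 (phi t) powr p * (w t / W 1)) * indicator {0<..<x} t \<le>
          ennreal (D * (h (phi t) / b2 t powr p)) * indicator {0<..<x} t"
        by (auto simp: indicator_def intro: ennreal_leI)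
    qed
    finally have "(\<integral>\<^sup>+t\<in>{0<..<x}. (\<integral>\<^sup>+s\<in>{t<..<1}. ennreal (h s * v s) \<partial>lborel) \<partial>lborel) \<le>
        (\<integral>\<^sup>+t\<in>{0<..<x}. ennreal (D * (h (phi t) / b2 t powr p)) \<partial>lborel) +
        (\<integral>\<^sup>+t\<in>{0<..<x}. ennreal (K * (h (phi t) / b2 t powr p)) \<partial>lborel)"
      by (simp add: add_right_mono)
    also have "\<dots> = (\<integral>\<^sup>+t. ennreal (D * (h (phi t) / b2 t powr p)) * indicator {0<..<x} t +
        ennreal (K * (h (phi t) / b2 t powr p)) * indicator {0<..<x} t \<partial>lborel)"
      by (rule nn_integral_add[OF mu mu, symmetric])
    also have "\<dots> = (\<integral>\<^sup>+t\<in>{0<..<x}. ennreal ((D + K) * (h (phi t) / b2 t powr p)) \<partial>lborel)"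
    proof (rule nn_integral_cong)
      fix t :: real
      have "0 \<le> h (phi t)" if "t \<in> {0<..<x}" using h0 phi_in[of t] that x by auto
      then show "ennreal (D * (h (phi t) / b2 t powr p)) * indicator {0<..<x} t +
        ennreal (K * (h (phi t) / b2 t powr p)) * indicator {0<..<x} t =
        ennreal ((D + K) * (h (phi t) / b2 t powr p)) * indicator {0<..<x} t"
        using D K by (auto simp: indicator_def distrib_right add_divide_distrib simp flip: ennreal_plus)
    qed
    finally show "(\<integral>\<^sup>+t\<in>{0<..<x}. (\<integral>\<^sup>+s\<in>{t<..<1}. ennreal (h s * v s) \<partial>lborel) \<partial>lborel) \<le>
        (\<integral>\<^sup>+t\<in>{0<..<x}. ennreal ((D + K) * (h (phi t) / b2 t powr p)) \<partial>lborel)" .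
  qed
qed

end

section \<open>Distribution functions and rearrangements\<close>

definition dist_fun :: "(real \<Rightarrow> 'a::real_normed_vector) \<Rightarrow> real \<Rightarrow> real" where
  "dist_fun f l = measure lebesgue {x\<in>{0<..<1}. norm (f x) > l}"

lemma rearr_dist_fun: "rearr f t = Inf {l. 0 < l \<and> dist_fun f l \<le> t}"
  by (simp only: rearr_def dist_fun_def)

context
  fixes f :: "real \<Rightarrow> 'a::real_normed_vector"
  assumes nf: "(\<lambda>x. norm (f x)) \<in> borel_measurable (lebesgue_on {0<..<1})"
begin

lemma superlevel_sets: "{x\<in>{0<..<1}. norm (f x) > l} \<in> sets lebesgue"
proof -
  have "{x \<in> space (lebesgue_on {0<..<1}). l < norm (f x)} \<in> sets (lebesgue_on {0<..<1})"
    using nf by measurable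
  then show ?thesis by (simp add: sets_restrict_space_iff)
qed

lemma superlevel_fmeasurable: "{x\<in>{0<..<1}. norm (f x) > l} \<in> fmeasurable lebesgue"
proof (rule fmeasurableI2[of "{0<..<1}"])
  show "{0<..<1::real} \<in> fmeasurable lebesgue" by simp
qed (use superlevel_sets in auto)

lemma dist_fun_antimono: "l \<le> l' \<Longrightarrow> dist_fun f l' \<le> dist_fun f l"
  unfolding dist_fun_def by (intro measure_mono_fmeasurable superlevel_fmeasurable superlevel_sets) auto

lemma dist_fun_lim: "(\<lambda>n. dist_fun f (real n)) \<longlonglongrightarrow> 0"
proof -
  have "(\<lambda>n. dist_fun f (real n)) \<longlonglongrightarrow> measure lebesgue (\<Inter>n::nat. {x\<in>{0<..<1}. norm (f x) > real n})"
    unfolding dist_fun_def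
  proof (rule Lim_measure_decseq)
    show "emeasure lebesgue {x\<in>{0<..<1}. norm (f x) > real n} \<noteq> \<infinity>" for n
      using fmeasurableD2[OF superlevel_fmeasurable] by simp
  qed (use superlevel_sets in \<open>auto simp: decseq_def\<close>)
  also have "(\<Inter>n::nat. {x\<in>{0<..<1}. norm (f x) > real n}) = {}"
  proof (rule equals0I)
    fix x assume x: "x \<in> (\<Inter>n::nat. {x\<in>{0<..<1}. norm (f x) > real n})"
    obtain n :: nat where "norm (f x) < real n" using reals_Archimedean2 by blast
    moreover have "real n < norm (f x)" using x by blast
    ultimately show False by linarith
  qed
  finally show ?thesis by simp
qed

text \<open>
  Right continuity of the distribution function, in the form that yields the strict inequality
  in \<open>rearr_greater_iff\<close>.
\<close>
lemma dist_fun_right_cont: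
  assumes "t < dist_fun f l"
  shows "\<exists>l'>l. t < dist_fun f l'"
proof -
  have "(\<lambda>n. dist_fun f (l + 1 / real (Suc n))) \<longlonglongrightarrow>
      measure lebesgue (\<Union>n::nat. {x\<in>{0<..<1}. norm (f x) > l + 1 / real (Suc n)})"
    unfolding dist_fun_def
  proof (rule Lim_measure_incseq)
    show "incseq (\<lambda>n. {x\<in>{0<..<1}. norm (f x) > l + 1 / real (Suc n)})"
    proof (rule incseq_SucI, safe)
      fix n x assume "l + 1 / real (Suc n) < norm (f x)"
      moreover have "1 / real (Suc (Suc n)) \<le> 1 / real (Suc n)" by (simp add: field_simps)
      ultimately show "l + 1 / real (Suc (Suc n)) < norm (f x)" by linarith
    qed
    have sub: "(\<Union>n::nat. {x\<in>{0<..<1}. norm (f x) > l + 1 / real (Suc n)}) \<subseteq> {0<..<1}" by auto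
    have "emeasure lebesgue (\<Union>n::nat. {x\<in>{0<..<1}. norm (f x) > l + 1 / real (Suc n)}) \<le> emeasure lebesgue {0<..<1::real}"
      by (rule emeasure_mono[OF sub]) simp
    also have "\<dots> < \<infinity>" by simp
    finally show "emeasure lebesgue (\<Union>n::nat. {x\<in>{0<..<1}. norm (f x) > l + 1 / real (Suc n)}) \<noteq> \<infinity>" by (rule less_imp_neq)
  qed (intro image_subsetI superlevel_sets)
  also have "(\<Union>n::nat. {x\<in>{0<..<1}. norm (f x) > l + 1 / real (Suc n)}) = {x\<in>{0<..<1}. norm (f x) > l}"
  proof (intro equalityI subsetI)
    fix x assume "x \<in> (\<Union>n::nat. {x\<in>{0<..<1}. norm (f x) > l + 1 / real (Suc n)})"
    then obtain n :: nat where n: "x \<in> {0<..<1}" "norm (f x) > l + 1 / real (Suc n)" by blast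
    moreover have "0 < 1 / real (Suc n)" by simp
    ultimately have "l < norm (f x)" by linarith
    with n show "x \<in> {x\<in>{0<..<1}. norm (f x) > l}" by simp
  next
    fix x assume x: "x \<in> {x\<in>{0<..<1}. norm (f x) > l}"
    then obtain n where "1 / real (Suc n) < norm (f x) - l"
      using nat_approx_posE[of "norm (f x) - l"] by auto
    then have "norm (f x) > l + 1 / real (Suc n)" by linarith
    with x show "x \<in> (\<Union>n::nat. {x\<in>{0<..<1}. norm (f x) > l + 1 / real (Suc n)})" by blast
  qed
  finally have "(\<lambda>n. dist_fun f (l + 1 / real (Suc n))) \<longlonglongrightarrow> dist_fun f l"
    unfolding dist_fun_def[of f l] .
  from order_tendstoD(1)[OF this assms] obtain n where "t < dist_fun f (l + 1 / real (Suc n))"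
    by (auto simp: eventually_sequentially)
  then show ?thesis by (intro exI[of _ "l + 1 / real (Suc n)"]) auto
qed

lemma rearr_nonempty: "0 < t \<Longrightarrow> {l. 0 < l \<and> dist_fun f l \<le> t} \<noteq> {}"
proof -
  assume "0 < t"
  then have "eventually (\<lambda>n. dist_fun f (real n) < t) sequentially"
    by (intro order_tendstoD(2)[OF dist_fun_lim])
  then obtain n where n: "\<And>m. m \<ge> n \<Longrightarrow> dist_fun f (real m) < t"
    unfolding eventually_sequentially by blast
  have "dist_fun f (real (Suc n)) \<le> t" by (intro less_imp_le n) simp
  then have "real (Suc n) \<in> {l. 0 < l \<and> dist_fun f l \<le> t}" by (simp del: of_nat_Suc)
  then show ?thesis by blast
qed

lemma rearr_bdd: "bdd_below {l. 0 < l \<and> dist_fun f l \<le> t}"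
  by (rule bdd_belowI[of _ 0]) auto

lemma rearr_nonneg: "0 < t \<Longrightarrow> 0 \<le> rearr f t"
  unfolding rearr_dist_fun by (intro cInf_greatest rearr_nonempty) auto

lemma rearr_mono: "0 < s \<Longrightarrow> s \<le> t \<Longrightarrow> rearr f t \<le> rearr f s"
  unfolding rearr_dist_fun by (intro cInf_superset_mono rearr_nonempty rearr_bdd) auto

text \<open>
  The Galois connection between the rearrangement and the distribution function; it shows that
  the two functions f and f* are equimeasurable.
\<close>
lemma rearr_greater_iff:
  assumes t: "0 < t" and l: "0 \<le> l"
  shows "l < rearr f t \<longleftrightarrow> t < dist_fun f l"
proof
  assume "t < dist_fun f l"
  then obtain l' where l': "l < l'" "t < dist_fun f l'" using dist_fun_right_cont by blast
  have "l' \<le> rearr f t"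
    unfolding rearr_dist_fun
  proof (intro cInf_greatest rearr_nonempty t)
    fix m assume m: "m \<in> {l. 0 < l \<and> dist_fun f l \<le> t}"
    show "l' \<le> m"
    proof (rule ccontr)
      assume "\<not> l' \<le> m"
      then have "dist_fun f l' \<le> dist_fun f m" by (intro dist_fun_antimono) simp
      with m l' show False by simp
    qed
  qed
  with l' show "l < rearr f t" by simp
next
  assume less: "l < rearr f t"
  show "t < dist_fun f l"
  proof (rule ccontr)
    assume "\<not> t < dist_fun f l"
    then have le: "dist_fun f l \<le> t" by simp
    have "rearr f t \<le> l"
    proof (rule field_le_epsilon)
      fix e :: real assume e: "0 < e"
      have "dist_fun f (l + e) \<le> t" using dist_fun_antimono[of l "l + e"] e le by simp
      then show "rearr f t \<le> l + e"
        unfolding rearr_dist_fun using e l by (intro cInf_lower rearr_bdd) auto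
    qed
    with less show False by simp
  qed
qed

lemma rearr_powr_antimono: "0 < p \<Longrightarrow> antimono_on {0<..<1} (\<lambda>t. rearr f t powr p)"
  by (intro monotone_onI powr_mono2) (auto intro: rearr_nonneg rearr_mono)

end

text \<open>
  A nonincreasing function need not equal its rearrangement at jumps. The two bounds avoid an
  exceptional set at the price of a shift of the argument.
\<close>
lemma rearr_antimono_le:
  fixes f :: "real \<Rightarrow> 'a::real_normed_vector"
  assumes nf: "(\<lambda>x. norm (f x)) \<in> borel_measurable (lebesgue_on {0<..<1})"
    and anti: "antimono_on {0<..<1} (\<lambda>x. norm (f x))" and t: "t \<in> {0<..<1}"
  shows "rearr f t \<le> norm (f t)"
    and "s \<in> {t<..<1} \<Longrightarrow> norm (f s) \<le> rearr f t"
proof -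
  show "rearr f t \<le> norm (f t)"
  proof (rule ccontr)
    assume "\<not> rearr f t \<le> norm (f t)"
    then have "t < dist_fun f (norm (f t))"
      using rearr_greater_iff[OF nf, of t "norm (f t)"] t by simp
    also have "\<dots> \<le> measure lebesgue {0<..<t}"
      unfolding dist_fun_def
    proof (rule measure_mono_fmeasurable[OF _ superlevel_sets[OF nf]])
      show "{x\<in>{0<..<1}. norm (f t) < norm (f x)} \<subseteq> {0<..<t}"
        using monotone_onD[OF anti t] by (force simp: not_le[symmetric])
    qed simp
    finally show False using t by simp
  qed
  assume s: "s \<in> {t<..<1}"
  show "norm (f s) \<le> rearr f t"
  proof (rule ccontr)
    assume "\<not> norm (f s) \<le> rearr f t"
    then have r: "rearr f t < norm (f s)" by simp
    have "s \<le> dist_fun f (rearr f t)"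
    proof -
      have "measure lebesgue {0<..<s} \<le> dist_fun f (rearr f t)"
        unfolding dist_fun_def
      proof (rule measure_mono_fmeasurable[OF _ _ superlevel_fmeasurable[OF nf]])
        show "{0<..<s} \<subseteq> {x\<in>{0<..<1}. rearr f t < norm (f x)}"
        proof
          fix x assume x: "x \<in> {0<..<s}"
          then have "norm (f s) \<le> norm (f x)"
            using s t by (intro monotone_onD[OF anti]) auto
          then show "x \<in> {x\<in>{0<..<1}. rearr f t < norm (f x)}" using r x s by auto
        qed
      qed simp
      then show ?thesis using s t by simp
    qed
    then have "t < dist_fun f (rearr f t)" using s by simp
    then have "rearr f t < rearr f t"
      using rearr_greater_iff[OF nf, of t "rearr f t"] rearr_nonneg[OF nf, of t] t by simp
    then show False by simp
  qed
qed

lemma layer_cake: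
  fixes g :: "real \<Rightarrow> real"
  assumes [measurable]: "g \<in> borel_measurable borel" "E \<in> sets borel"
  shows "(\<integral>\<^sup>+x\<in>E. ennreal (g x) \<partial>lborel) = (\<integral>\<^sup>+l\<in>{0<..}. emeasure lborel {x\<in>E. l < g x} \<partial>lborel)"
proof -
  have "(\<integral>\<^sup>+x\<in>E. ennreal (g x) \<partial>lborel) = (\<integral>\<^sup>+x. (\<integral>\<^sup>+l. (if x \<in> E \<and> 0 < l \<and> l < g x then 1 else 0) \<partial>lborel) \<partial>lborel)"
  proof (rule nn_integral_cong)
    fix x :: real
    have "ennreal (g x) = emeasure lborel {0<..<g x}" by (cases "0 \<le> g x") (auto simp: ennreal_neg)
    also have "\<dots> = (\<integral>\<^sup>+l. indicator {0<..<g x} l \<partial>lborel)" by simp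
    finally show "ennreal (g x) * indicator E x = (\<integral>\<^sup>+l. (if x \<in> E \<and> 0 < l \<and> l < g x then 1 else 0) \<partial>lborel)"
      by (cases "x \<in> E") (auto simp: indicator_def of_bool_def intro!: nn_integral_cong)
  qed
  also have "\<dots> = (\<integral>\<^sup>+l. (\<integral>\<^sup>+x. (if x \<in> E \<and> 0 < l \<and> l < g x then 1 else 0) \<partial>lborel) \<partial>lborel)"
    by (rule lborel_pair.Fubini'[symmetric]) measurable
  also have "\<dots> = (\<integral>\<^sup>+l\<in>{0<..}. emeasure lborel {x\<in>E. l < g x} \<partial>lborel)"
  proof (rule nn_integral_cong)
    fix l :: real
    have "emeasure lborel {x\<in>E. l < g x} = (\<integral>\<^sup>+x. indicator {x\<in>E. l < g x} x \<partial>lborel)" by simp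
    then show "(\<integral>\<^sup>+x. (if x \<in> E \<and> 0 < l \<and> l < g x then 1 else 0) \<partial>lborel) =
        emeasure lborel {x\<in>E. l < g x} * indicator {0<..} l"
      by (cases "0 < l") (auto simp: indicator_def of_bool_def intro!: nn_integral_cong)
  qed
  finally show ?thesis .
qed

lemma less_powr_iff:
  fixes y :: real
  assumes p: "0 < p" and "0 < l" "0 \<le> y"
  shows "l < y powr p \<longleftrightarrow> l powr (1 / p) < y"
proof -
  have l: "(l powr (1 / p)) powr p = l" using assms by (simp add: powr_powr)
  show ?thesis
  proof
    assume "l powr (1 / p) < y"
    then have "(l powr (1 / p)) powr p < y powr p" using p by (intro powr_less_mono2) auto
    then show "l < y powr p" using l by simp
  next
    assume less: "l < y powr p"
    show "l powr (1 / p) < y"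
    proof (rule ccontr)
      assume "\<not> l powr (1 / p) < y"
      then have "y powr p \<le> (l powr (1 / p)) powr p" using assms by (intro powr_mono2) auto
      with l less show False by simp
    qed
  qed
qed

text \<open>
  By the layer cake formula the claim reduces to level sets, where it says that the part of a
  level set inside E has measure at most the minimum of |E| and the measure of the whole level
  set; this minimum is the measure of the corresponding level set of f* on (0,|E|). The
  function g is a Borel representative of the norm of f, so that Tonelli's theorem can be
  applied to Lebesgue measure on Borel sets.
\<close>
lemma Hardy_Littlewood:
  fixes f :: "real \<Rightarrow> 'a::real_normed_vector" and g :: "real \<Rightarrow> real"
  assumes nf: "(\<lambda>x. norm (f x)) \<in> borel_measurable (lebesgue_on {0<..<1})"
    and g[measurable]: "g \<in> borel_measurable borel" and g0: "\<And>x. 0 \<le> g x"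
    and gf: "AE x in lebesgue. x \<in> {0<..<1} \<longrightarrow> g x = norm (f x)"
    and E[measurable]: "E \<in> sets borel" and E1: "E \<subseteq> {0<..1}" and p: "0 < p"
  shows "(\<integral>\<^sup>+x\<in>E. ennreal (g x powr p) \<partial>lborel) \<le> (\<integral>\<^sup>+t\<in>{0<..<measure lborel E}. ennreal (rearr f t powr p) \<partial>lborel)"
proof -
  define e where "e = measure lborel E"
  have E_fin: "emeasure lborel E = ennreal e"
  proof -
    have "emeasure lborel E \<le> emeasure lborel {0<..1::real}" by (intro emeasure_mono E1) simp
    then have "emeasure lborel E < \<infinity>" by (simp add: le_less_trans)
    then show ?thesis unfolding e_def by (intro emeasure_eq_ennreal_measure) simp
  qed
  have e1: "e \<le> 1"
  proof -
    have "emeasure lborel E \<le> emeasure lborel {0<..1::real}" by (intro emeasure_mono E1) simp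
    then show ?thesis using E_fin by simp
  qed
  define r where "r t = indicator {0<..<1} t * rearr f t" for t
  have r[measurable]: "r \<in> borel_measurable borel"
  proof -
    have "antimono_on {0<..<1} (rearr f)"
      using rearr_mono[OF nf] by (auto simp: monotone_on_def)
    from antimono_measurable[OF this] show ?thesis
      unfolding r_def[abs_def] by (subst (asm) borel_measurable_restrict_space_iff) auto
  qed
  have level: "emeasure lborel {x\<in>E. l < g x powr p} \<le> emeasure lborel {t\<in>{0<..<e}. l < r t powr p}" if l: "0 < l" for l
  proof -
    define m where "m = l powr (1 / p)"
    have m: "0 \<le> m" by (simp add: m_def)
    have L: "{x\<in>E. l < g x powr p} = {x\<in>E. m < g x}"
      using less_powr_iff[OF p l g0] by (auto simp: m_def)
    have a: "emeasure lborel {x\<in>E. m < g x} \<le> ennreal e"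
      unfolding E_fin[symmetric] by (intro emeasure_mono) auto
    have b: "emeasure lborel {x\<in>E. m < g x} \<le> ennreal (dist_fun f m)"
    proof -
      have "emeasure lborel {x\<in>E. m < g x} = emeasure lebesgue {x\<in>E. m < g x}" by simp
      also have "\<dots> \<le> emeasure lebesgue {x\<in>{0<..<1}. m < norm (f x)}"
      proof (rule emeasure_mono_AE)
        have "AE x in lborel. x \<noteq> (1::real)" by (rule AE_lborel_singleton)
        then have "AE x in lebesgue. x \<noteq> (1::real)" by (rule AE_completion)
        with gf show "AE x in lebesgue. x \<in> {x \<in> E. m < g x} \<longrightarrow> x \<in> {x\<in>{0<..<1}. m < norm (f x)}"
          by eventually_elim (use E1 in force)
      qed (rule superlevel_sets[OF nf])
      also have "\<dots> = ennreal (dist_fun f m)"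
        unfolding dist_fun_def using fmeasurableD2[OF superlevel_fmeasurable[OF nf]] by (intro emeasure_eq_ennreal_measure) simp
      finally show ?thesis .
    qed
    have "emeasure lborel {x\<in>E. m < g x} \<le> ennreal (min e (dist_fun f m))"
      using a b by (simp add: min_def)
    also have "\<dots> = emeasure lborel {0<..<min e (dist_fun f m)}"
    proof -
      have "0 \<le> min e (dist_fun f m)" by (simp add: e_def dist_fun_def)
      then show ?thesis by simp
    qed
    also have "{0<..<min e (dist_fun f m)} = {t\<in>{0<..<e}. l < r t powr p}"
      using rearr_greater_iff[OF nf _ m] rearr_nonneg[OF nf] less_powr_iff[OF p l] e1
      by (auto simp: r_def m_def indicator_def)
    finally show ?thesis unfolding L .
  qed
  have "(\<integral>\<^sup>+x\<in>E. ennreal (g x powr p) \<partial>lborel) = (\<integral>\<^sup>+l\<in>{0<..}. emeasure lborel {x\<in>E. l < g x powr p} \<partial>lborel)"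
    by (intro layer_cake) measurable
  also have "\<dots> \<le> (\<integral>\<^sup>+l\<in>{0<..}. emeasure lborel {t\<in>{0<..<e}. l < r t powr p} \<partial>lborel)"
    using level by (intro nn_integral_mono) (auto simp: indicator_def)
  also have "\<dots> = (\<integral>\<^sup>+t\<in>{0<..<e}. ennreal (r t powr p) \<partial>lborel)"
    by (rule layer_cake[symmetric]) measurable
  also have "\<dots> = (\<integral>\<^sup>+t\<in>{0<..<e}. ennreal (rearr f t powr p) \<partial>lborel)"
    using e1 by (intro nn_integral_cong) (auto simp: r_def indicator_def)
  finally show ?thesis by (simp add: e_def)
qed

section \<open>From integral inequalities to norm inequalities\<close>

lemma ri_functional_mono:
  assumes "ri_functional N" "f \<in> M_plus" "g \<in> M_plus" "\<And>x. x \<in> {0<..<1} \<Longrightarrow> f x \<le> g x"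
  shows "N f \<le> N g"
proof -
  have "AE x in lebesgue_on {0<..<1}. f x \<le> g x" by (rule AE_I2) (use assms(4) in simp)
  with assms(1-3) show ?thesis unfolding ri_functional_def by blast
qed

lemma M_plus_cong:
  assumes "f \<in> M_plus" "\<And>x. x \<in> {0<..<1} \<Longrightarrow> f x = g x"
  shows "g \<in> M_plus"
proof -
  have "g \<in> borel_measurable (lebesgue_on {0<..<1}) \<longleftrightarrow> f \<in> borel_measurable (lebesgue_on {0<..<1})"
    by (rule measurable_cong) (simp add: assms(2))
  then show ?thesis using assms unfolding M_plus_def by auto
qed

lemma ri_functional_cong:
  assumes N: "ri_functional N" and f: "f \<in> M_plus" and eq: "\<And>x. x \<in> {0<..<1} \<Longrightarrow> f x = g x"
  shows "N f = N g"
proof (rule antisym)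
  have g: "g \<in> M_plus" using f eq by (rule M_plus_cong)
  show "N f \<le> N g" by (rule ri_functional_mono[OF N f g]) (simp add: eq)
  show "N g \<le> N f" by (rule ri_functional_mono[OF N g f]) (simp add: eq)
qed

lemma epow_less_top: "epow x p < top \<longleftrightarrow> x < top"
  by (auto simp: epow_def less_top)

lemma epow_root_le:
  assumes p: "0 < p" and C: "0 \<le> C" and y: "y < \<infinity>" and le: "epow x p \<le> ennreal C * epow y p"
  shows "x \<le> ennreal (C powr (1 / p)) * y"
proof -
  have "ennreal C * epow y p < \<infinity>" using y p by (simp add: ennreal_mult_less_top epow_less_top)
  with le have "epow x p < \<infinity>" by (rule le_less_trans)
  then have x: "x < \<infinity>" using p by (simp add: epow_less_top)
  define a where "a = enn2real x"
  define b where "b = enn2real y"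
  have ab: "x = ennreal a" "y = ennreal b" "0 \<le> a" "0 \<le> b" using x y by (auto simp: a_def b_def)
  have "ennreal (a powr p) \<le> ennreal (C * b powr p)"
    using le ab C by (simp add: epow_def ennreal_mult)
  then have "a powr p \<le> C * b powr p" using C by (simp add: ennreal_le_iff)
  then have "(a powr p) powr (1 / p) \<le> (C * b powr p) powr (1 / p)" using p by (intro powr_mono2) auto
  then have "a \<le> C powr (1 / p) * b" using ab p C by (simp add: powr_mult powr_powr)
  then show ?thesis using ab C by (simp add: ennreal_leI flip: ennreal_mult)
qed

text \<open>
  The Hardy-Littlewood-Polya principle for Z h = (N of h^(1/p))^p, with a left-hand side that
  may be infinite. If the norm of u is infinite there is nothing to prove; otherwise u^p is
  integrable, hence so is G, and a nonincreasing function with finite integral is finite on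
  (0,1).
\<close>
lemma ext_norm_HLP:
  fixes G :: "real \<Rightarrow> ennreal" and u :: "real \<Rightarrow> real"
  assumes p: "0 < p" and N: "ri_functional N" and conv: "p_convex p N"
    and G: "\<And>s t. 0 < s \<Longrightarrow> s \<le> t \<Longrightarrow> t < 1 \<Longrightarrow> G t \<le> G s"
    and u: "antimono_on {0<..<1} u" "\<And>t. t \<in> {0<..<1} \<Longrightarrow> 0 \<le> u t" and C: "0 < C"
    and maj: "\<And>x. x \<in> {0<..<1} \<Longrightarrow>
      (\<integral>\<^sup>+t\<in>{0<..<x}. G t \<partial>lborel) \<le> (\<integral>\<^sup>+t\<in>{0<..<x}. ennreal (C * u t powr p) \<partial>lborel)"
  shows "ext_norm N (\<lambda>t. epow (G t) (1 / p)) \<le> ennreal (C powr (1 / p)) * N u"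
proof (cases "N u < \<infinity>")
  case False
  then have "N u = top" using less_top[of "N u"] by auto
  then show ?thesis using C by (simp add: ennreal_mult_top)
next
  case True
  define Z where "Z h = epow (N (\<lambda>x. h x powr (1 / p))) p" for h
  have Z: "ri_banach_norm Z" using conv unfolding p_convex_def Z_def .
  have uM: "u \<in> M_plus" using u by (rule antimono_M_plus)
  have up: "antimono_on {0<..<1} (\<lambda>t. u t powr p)"
    using p u by (auto simp: monotone_on_def intro!: powr_mono2)
  have upM: "(\<lambda>t. u t powr p) \<in> M_plus" by (rule antimono_M_plus[OF up]) simp
  have Zup: "Z (\<lambda>t. u t powr p) = epow (N u) p"
  proof -
    have "N u = N (\<lambda>x. (u x powr p) powr (1 / p))"
      by (rule ri_functional_cong[OF N uM]) (use u p in \<open>simp add: powr_powr\<close>)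
    then show ?thesis by (simp add: Z_def)
  qed
  have fin: "(\<integral>\<^sup>+t\<in>{0<..<1}. ennreal (u t powr p) \<partial>lborel) < \<infinity>"
    by (rule ri_banach_normD(7)[OF Z upM]) (use True p in \<open>simp add: Zup epow_less_top\<close>)
  have G_fin: "G t < \<infinity>" if t: "t \<in> {0<..<1}" for t
  proof -
    have "G t * ennreal t = (\<integral>\<^sup>+s. G t * indicator {0<..<t} s \<partial>lborel)"
      using t by (subst nn_integral_cmult_indicator) auto
    also have "\<dots> \<le> (\<integral>\<^sup>+s\<in>{0<..<t}. G s \<partial>lborel)"
      using t by (intro nn_integral_mono) (auto simp: indicator_def intro: G)
    also have "\<dots> \<le> (\<integral>\<^sup>+s\<in>{0<..<t}. ennreal (C * u s powr p) \<partial>lborel)" by (rule maj[OF t])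
    also have "\<dots> \<le> (\<integral>\<^sup>+s. ennreal C * (ennreal (u s powr p) * indicator {0<..<1} s) \<partial>lborel)"
      using t C by (intro nn_integral_mono) (auto simp: indicator_def ennreal_mult)
    also have "\<dots> = ennreal C * (\<integral>\<^sup>+s\<in>{0<..<1}. ennreal (u s powr p) \<partial>lborel)"
    proof (rule nn_integral_cmult)
      have "(\<lambda>s. ennreal (u s powr p)) \<in> borel_measurable (restrict_space borel {0<..<1})"
        by (intro measurable_compose[OF antimono_measurable[OF up] measurable_ennreal])
      then show "(\<lambda>s. ennreal (u s powr p) * indicator {0<..<1} s) \<in> borel_measurable lborel"
        by (subst (asm) borel_measurable_restrict_space_iff_ennreal) auto
    qed
    also have "\<dots> < \<infinity>" using fin by (simp add: ennreal_mult_less_top)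
    finally show ?thesis using t by (auto simp: ennreal_mult_less_top)
  qed
  define g where "g t = enn2real (G t)" for t
  have gG: "ennreal (g t) = G t" if "t \<in> {0<..<1}" for t
    using G_fin[OF that] by (simp add: g_def)
  have g0: "0 \<le> g t" for t by (simp add: g_def)
  have g_anti: "antimono_on {0<..<1} g"
    using G G_fin by (intro monotone_onI) (auto simp: g_def intro!: enn2real_mono)
  have gM: "g \<in> M_plus" using g_anti g0 by (intro antimono_M_plus) auto
  have gpM: "(\<lambda>t. g t powr (1 / p)) \<in> M_plus"
    using g_anti g0 p by (intro antimono_M_plus) (auto simp: monotone_on_def intro!: powr_mono2)
  have "Z g \<le> Z (\<lambda>t. C * u t powr p)"
  proof (rule HLP_principle[OF Z g_anti g0])
    show "antimono_on {0<..<1} (\<lambda>t. C * u t powr p)"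
      using up C by (auto simp: monotone_on_def intro!: mult_left_mono)
    fix x :: real assume x: "x \<in> {0<..<1}"
    have "(\<integral>\<^sup>+t\<in>{0<..<x}. ennreal (g t) \<partial>lborel) = (\<integral>\<^sup>+t\<in>{0<..<x}. G t \<partial>lborel)"
      using x gG by (intro nn_integral_cong) (auto simp: indicator_def)
    with maj[OF x] show "(\<integral>\<^sup>+t\<in>{0<..<x}. ennreal (g t) \<partial>lborel) \<le> (\<integral>\<^sup>+t\<in>{0<..<x}. ennreal (C * u t powr p) \<partial>lborel)"
      by simp
  qed (use C in auto)
  also have "\<dots> = ennreal C * Z (\<lambda>t. u t powr p)" using C by (intro ri_banach_normD(2)[OF Z upM]) simp
  finally have "epow (N (\<lambda>t. g t powr (1 / p))) p \<le> ennreal C * epow (N u) p"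
    unfolding Zup unfolding Z_def .
  then have main: "N (\<lambda>t. g t powr (1 / p)) \<le> ennreal (C powr (1 / p)) * N u"
    using p C True by (intro epow_root_le) auto
  have S_eq: "epow (G t) (1 / p) = ennreal (g t powr (1 / p))" if "t \<in> {0<..<1}" for t
    using G_fin[OF that] by (simp add: epow_def g_def less_top)
  have "AE t in lebesgue_on {0<..<1}. epow (G t) (1 / p) < \<infinity>"
    by (rule AE_I2) (simp add: S_eq)
  then have "ext_norm N (\<lambda>t. epow (G t) (1 / p)) = N (\<lambda>t. enn2real (epow (G t) (1 / p)))"
    by (simp add: ext_norm_def)
  also have "\<dots> = N (\<lambda>t. g t powr (1 / p))"
    by (rule ri_functional_cong[OF N gpM, symmetric]) (simp add: S_eq)
  finally show ?thesis using main by simp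
qed

section \<open>Decreasing majorants built from dyadic averages\<close>

definition dyadic_ivl :: "nat \<Rightarrow> real set" where "dyadic_ivl k = {1 / 2 ^ (k + 1) <.. 1 / 2 ^ k}"

lemma dyadic_ivl_sets[measurable]: "dyadic_ivl k \<in> sets borel" by (simp add: dyadic_ivl_def)

lemma dyadic_ivl_emeasure: "emeasure lborel (dyadic_ivl k) = ennreal (1 / 2 ^ (k + 1))" "measure lborel (dyadic_ivl k) = 1 / 2 ^ (k + 1)"
proof -
  have "(1::real) / 2 ^ k - 1 / 2 ^ (k + 1) = 1 / 2 ^ (k + 1)" by (simp add: field_simps)
  moreover have "(1::real) / 2 ^ (k + 1) \<le> 1 / 2 ^ k" by (simp add: field_simps)
  ultimately show "emeasure lborel (dyadic_ivl k) = ennreal (1 / 2 ^ (k + 1))" "measure lborel (dyadic_ivl k) = 1 / 2 ^ (k + 1)"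
    unfolding dyadic_ivl_def by (simp_all only: emeasure_lborel_Ioc measure_lborel_Ioc)
qed

lemma dyadic_ivl_subset: "dyadic_ivl k \<subseteq> {0<..1}"
proof
  fix s assume s: "s \<in> dyadic_ivl k"
  have "(0::real) < 1 / 2 ^ (k + 1)" "(1::real) / 2 ^ k \<le> 1" by (auto simp: field_simps)
  moreover have "1 / 2 ^ (k + 1) < s" "s \<le> 1 / 2 ^ k"
    using s by (auto simp: dyadic_ivl_def simp del: power_Suc)
  ultimately have "0 < s" "s \<le> 1" by linarith+
  then show "s \<in> {0<..1}" by simp
qed

lemma dyadic_ivl_disjoint: "disjoint_family dyadic_ivl"
proof -
  have "dyadic_ivl j \<inter> dyadic_ivl k = {}" if "j < k" for j k
  proof -
    have "(1::real) / 2 ^ k \<le> 1 / 2 ^ (j + 1)"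
      using that by (intro divide_left_mono power_increasing) auto
    then show ?thesis unfolding dyadic_ivl_def by auto
  qed
  then show ?thesis
    unfolding disjoint_family_on_def by (metis Int_commute linorder_neqE_nat)
qed

lemma dyadic_ivl_cover: assumes "s \<in> {0<..1}" shows "\<exists>k. s \<in> dyadic_ivl k"
proof -
  have "\<exists>k. (1/2::real) ^ k < s" using assms by (intro real_arch_pow_inv) auto
  then have ex: "\<exists>k. (1::real) / 2 ^ k < s" by (simp add: power_one_over)
  define k where "k = (LEAST k. (1::real) / 2 ^ k < s)"
  have k: "1 / 2 ^ k < s" unfolding k_def by (rule LeastI_ex[OF ex])
  then have "k \<noteq> 0" using assms by (intro notI) auto
  then obtain j where j: "k = Suc j" by (cases k) auto
  have "\<not> 1 / 2 ^ j < s" using not_less_Least[of j "\<lambda>k. 1 / 2 ^ k < s"] j unfolding k_def[symmetric] by simp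
  with k j have "s \<in> dyadic_ivl j" unfolding dyadic_ivl_def by (simp del: power_Suc)
  then show ?thesis by blast
qed

text \<open>
  At most one term of the series is different from 0.
\<close>
lemma suminf_disjoint_le:
  fixes c :: "nat \<Rightarrow> ennreal"
  assumes "disjoint_family A" "\<And>k. x \<in> A k \<Longrightarrow> c k \<le> b"
  shows "(\<Sum>k. c k * indicator (A k) x) \<le> b"
proof (cases "\<exists>k. x \<in> A k")
  case True
  then obtain k where k: "x \<in> A k" by blast
  then have "(\<Sum>k. c k * indicator (A k) x) = c k" by (rule suminf_cmult_indicator[OF assms(1)])
  with assms(2)[OF k] show ?thesis by simp
next
  case False
  then have "(\<lambda>k. c k * indicator (A k) x) = (\<lambda>k. 0)" by (auto simp: fun_eq_iff)
  then show ?thesis by simp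
qed

lemma suminf_ge_term: "c k \<le> (\<Sum>k. c k :: ennreal)"
  using sum_le_suminf[of c "{k}"] by simp

definition dyadic_avg :: "(real \<Rightarrow> ennreal) \<Rightarrow> nat \<Rightarrow> ennreal" where
  "dyadic_avg F k = ennreal (2 ^ (k + 1)) * (\<integral>\<^sup>+s\<in>dyadic_ivl k. F s \<partial>lborel)"

text \<open>
  Up to its values at the dyadic points, where it is continuous from the right, this is the
  least nonincreasing majorant of the step function of the dyadic averages.
\<close>
definition dyadic_major :: "(real \<Rightarrow> ennreal) \<Rightarrow> real \<Rightarrow> ennreal" where
  "dyadic_major F t = (SUP k\<in>{k. t < 1 / 2 ^ k}. dyadic_avg F k)"

lemma dyadic_major_antimono: "s \<le> t \<Longrightarrow> dyadic_major F t \<le> dyadic_major F s"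
  unfolding dyadic_major_def by (intro SUP_subset_mono) auto

text \<open>
  Measurability is assumed on the interval alone, because the functions to which this is
  applied are controlled only on (0,1).
\<close>
lemma nn_integral_scale:
  fixes q :: "real \<Rightarrow> ennreal"
  assumes [measurable]: "(\<lambda>t. q t * indicator {0<..<a * x} t) \<in> borel_measurable borel" and a: "0 < a"
  shows "(\<integral>\<^sup>+t\<in>{0<..<a * x}. q t \<partial>lborel) = ennreal a * (\<integral>\<^sup>+t\<in>{0<..<x}. q (a * t) \<partial>lborel)"
proof -
  have "(\<integral>\<^sup>+t\<in>{0<..<a * x}. q t \<partial>lborel) =
      ennreal \<bar>a\<bar> * (\<integral>\<^sup>+t. q (0 + a * t) * indicator {0<..<a * x} (0 + a * t) \<partial>lborel)"
    using a by (intro nn_integral_real_affine) auto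
  also have "(\<lambda>t. q (0 + a * t) * indicator {0<..<a * x} (0 + a * t)) = (\<lambda>t. q (a * t) * indicator {0<..<x} t)"
    using a by (auto simp: fun_eq_iff indicator_def zero_less_mult_iff)
  finally show ?thesis using a by simp
qed

text \<open>
  Averages of a nonincreasing function over (0,y) decrease in y; the factor 2 allows y to be
  as small as x/2.
\<close>
lemma antimono_average:
  fixes h :: "real \<Rightarrow> real"
  assumes h: "antimono_on {0<..<1} h" and x: "0 < x" "x < 1" and y: "x / 2 \<le> y" "y < 1"
  shows "ennreal (1 / y) * (\<integral>\<^sup>+t\<in>{0<..<y}. ennreal (h t) \<partial>lborel) \<le>
    ennreal (2 / x) * (\<integral>\<^sup>+t\<in>{0<..<x}. ennreal (h t) \<partial>lborel)"
proof -
  have y0: "0 < y" using x y by simp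
  have m: "(\<lambda>t. ennreal (h t) * indicator {0<..<c} t) \<in> borel_measurable borel" if "c \<le> 1" for c
  proof -
    have "antimono_on {0<..<c} h" using that by (intro monotone_on_subset[OF h]) auto
    then have "(\<lambda>t. ennreal (h t)) \<in> borel_measurable (restrict_space borel {0<..<c})"
      by (intro measurable_compose[OF antimono_measurable measurable_ennreal])
    then show ?thesis by (subst (asm) borel_measurable_restrict_space_iff_ennreal) auto
  qed
  show ?thesis
  proof (cases "y \<le> x")
    case True
    have "ennreal (1 / y) \<le> ennreal (2 / x)" using x y y0 by (intro ennreal_leI) (simp add: field_simps)
    moreover have "(\<integral>\<^sup>+t\<in>{0<..<y}. ennreal (h t) \<partial>lborel) \<le> (\<integral>\<^sup>+t\<in>{0<..<x}. ennreal (h t) \<partial>lborel)"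
      using True by (intro nn_set_integral_set_mono) auto
    ultimately show ?thesis by (rule mult_mono) auto
  next
    case False
    define a where "a = y / x"
    have a: "0 < a" "1 \<le> a" "a * x = y" using x y0 False by (auto simp: a_def)
    have "(\<integral>\<^sup>+t\<in>{0<..<a * x}. ennreal (h t) \<partial>lborel) = ennreal a * (\<integral>\<^sup>+t\<in>{0<..<x}. ennreal (h (a * t)) \<partial>lborel)"
      using m[of "a * x"] a y by (intro nn_integral_scale) auto
    also have "\<dots> \<le> ennreal a * (\<integral>\<^sup>+t\<in>{0<..<x}. ennreal (h t) \<partial>lborel)"
    proof (intro mult_left_mono nn_integral_mono)
      fix t
      have "h (a * t) \<le> h t" if t: "t \<in> {0<..<x}"
      proof -
        have "a * t < a * x" using t a by (intro mult_strict_left_mono) auto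
        then have "a * t < 1" using a y by simp
        moreover have "1 * t \<le> a * t" using a t by (intro mult_right_mono) auto
        ultimately show ?thesis using t x a by (intro monotone_onD[OF h]) auto
      qed
      then show "ennreal (h (a * t)) * indicator {0<..<x} t \<le> ennreal (h t) * indicator {0<..<x} t"
        by (auto simp: indicator_def intro: ennreal_leI)
    qed simp
    finally have "ennreal (1 / y) * (\<integral>\<^sup>+t\<in>{0<..<y}. ennreal (h t) \<partial>lborel) \<le>
        ennreal (1 / y) * (ennreal a * (\<integral>\<^sup>+t\<in>{0<..<x}. ennreal (h t) \<partial>lborel))"
      unfolding a(3) by (rule mult_left_mono) simp
    also have "\<dots> = ennreal (1 / x) * (\<integral>\<^sup>+t\<in>{0<..<x}. ennreal (h t) \<partial>lborel)"
      using x y0 by (simp add: a_def mult.assoc[symmetric] flip: ennreal_mult')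
    also have "\<dots> \<le> ennreal (2 / x) * (\<integral>\<^sup>+t\<in>{0<..<x}. ennreal (h t) \<partial>lborel)"
      using x by (intro mult_right_mono ennreal_leI) (auto simp: divide_right_mono)
    finally show ?thesis .
  qed
qed

text \<open>
  The supremum in the majorant is split according to whether the dyadic interval has its right
  end point beyond x. The averages over intervals beyond x are bounded by twice the average of
  h over (0,x), because their length is at least x/2. For the intervals contained in (0,x] the
  supremum can simply be replaced by the sum: the average over the interval ending at 2^(-k)
  contributes on (0, 2^(-k)), that is, with twice the integral of F over that interval, and
  the intervals are disjoint.
\<close>
lemma dyadic_major_integral:
  fixes F :: "real \<Rightarrow> ennreal" and h :: "real \<Rightarrow> real"
  assumes F[measurable]: "F \<in> borel_measurable borel" and h: "antimono_on {0<..<1} h"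
    and HL: "\<And>E. E \<in> sets borel \<Longrightarrow> E \<subseteq> {0<..1} \<Longrightarrow>
      (\<integral>\<^sup>+s\<in>E. F s \<partial>lborel) \<le> (\<integral>\<^sup>+t\<in>{0<..<measure lborel E}. ennreal (h t) \<partial>lborel)"
    and x: "x \<in> {0<..<1}"
  shows "(\<integral>\<^sup>+t\<in>{0<..<x}. dyadic_major F t \<partial>lborel) \<le> 4 * (\<integral>\<^sup>+t\<in>{0<..<x}. ennreal (h t) \<partial>lborel)"
proof -
  define H where "H = (\<integral>\<^sup>+t\<in>{0<..<x}. ennreal (h t) \<partial>lborel)"
  define c where "c = ennreal (2 / x) * H"
  define a where "a k = (if 1 / 2 ^ k \<le> x then dyadic_avg F k else 0)" for k
  have large: "dyadic_avg F k \<le> c" if "x < 1 / 2 ^ k" for k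
  proof -
    have "(\<integral>\<^sup>+s\<in>dyadic_ivl k. F s \<partial>lborel) \<le> (\<integral>\<^sup>+t\<in>{0<..<1 / 2 ^ (k + 1)}. ennreal (h t) \<partial>lborel)"
      using HL[of "dyadic_ivl k"] dyadic_ivl_subset[of k] dyadic_ivl_sets unfolding dyadic_ivl_emeasure by blast
    then have "dyadic_avg F k \<le> ennreal (2 ^ (k + 1)) * (\<integral>\<^sup>+t\<in>{0<..<1 / 2 ^ (k + 1)}. ennreal (h t) \<partial>lborel)"
      unfolding dyadic_avg_def by (rule mult_left_mono) simp
    also have "ennreal (2 ^ (k + 1)) = ennreal (1 / (1 / 2 ^ (k + 1)))" by simp
    also have "ennreal (1 / (1 / 2 ^ (k + 1))) * (\<integral>\<^sup>+t\<in>{0<..<1 / 2 ^ (k + 1)}. ennreal (h t) \<partial>lborel) \<le> c"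
      unfolding c_def H_def
    proof (rule antimono_average[OF h])
      show "x / 2 \<le> 1 / 2 ^ (k + 1)" using that by (simp add: field_simps)
      have "(1::real) < 2 ^ (k + 1)" by (rule one_less_power) auto
      then show "(1::real) / 2 ^ (k + 1) < 1" by (simp only: divide_less_eq_1_pos zero_less_power zero_less_numeral)
    qed (use x in auto)
    finally show ?thesis .
  qed
  have point: "dyadic_major F t \<le> c + (\<Sum>k. a k * indicator {0<..<1 / 2 ^ k :: real} t)" if t: "t \<in> {0<..<x}" for t
    unfolding dyadic_major_def
  proof (rule SUP_least)
    fix k assume k: "k \<in> {k. t < 1 / 2 ^ k}"
    show "dyadic_avg F k \<le> c + (\<Sum>k. a k * indicator {0<..<1 / 2 ^ k :: real} t)"
    proof (cases "1 / 2 ^ k \<le> x")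
      case True
      then have "dyadic_avg F k = a k * indicator {0<..<1 / 2 ^ k :: real} t" using k t by (simp add: a_def)
      also have "\<dots> \<le> (\<Sum>k. a k * indicator {0<..<1 / 2 ^ k :: real} t)" by (rule suminf_ge_term)
      finally show ?thesis by (rule order_trans) simp
    next
      case False
      then have "dyadic_avg F k \<le> c" using large by simp
      then show ?thesis by (rule order_trans) simp
    qed
  qed
  have "(\<integral>\<^sup>+t\<in>{0<..<x}. dyadic_major F t \<partial>lborel) \<le>
      (\<integral>\<^sup>+t. c * indicator {0<..<x} t + (\<Sum>k. a k * indicator {0<..<1 / 2 ^ k :: real} t) \<partial>lborel)"
    using point by (intro nn_integral_mono) (auto simp: indicator_def)
  also have "\<dots> = (\<integral>\<^sup>+t. c * indicator {0<..<x} t \<partial>lborel) + (\<integral>\<^sup>+t. (\<Sum>k. a k * indicator {0<..<1 / 2 ^ k :: real} t) \<partial>lborel)"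
    by (intro nn_integral_add) measurable
  also have "(\<integral>\<^sup>+t. c * indicator {0<..<x} t \<partial>lborel) = c * ennreal x"
    using x by (subst nn_integral_cmult_indicator) auto
  also have "c * ennreal x = 2 * H"
  proof -
    have "c * ennreal x = (ennreal (2 / x) * ennreal x) * H" by (simp add: c_def mult_ac)
    also have "ennreal (2 / x) * ennreal x = ennreal 2" using x by (simp flip: ennreal_mult')
    finally show ?thesis by simp
  qed
  also have "(\<integral>\<^sup>+t. (\<Sum>k. a k * indicator {0<..<1 / 2 ^ k :: real} t) \<partial>lborel) = (\<Sum>k. \<integral>\<^sup>+t. a k * indicator {0<..<1 / 2 ^ k :: real} t \<partial>lborel)"
    by (rule nn_integral_suminf) measurable
  also have "\<dots> = (\<Sum>k. \<integral>\<^sup>+s. 2 * ((if 1 / 2 ^ k \<le> x then F s else 0) * indicator (dyadic_ivl k) s) \<partial>lborel)"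
  proof (rule arg_cong[where f = suminf], rule ext)
    fix k
    have "(\<integral>\<^sup>+t. a k * indicator {0<..<1 / 2 ^ k :: real} t \<partial>lborel) = a k * ennreal (1 / 2 ^ k)"
      by (subst nn_integral_cmult_indicator) auto
    also have "\<dots> = 2 * (\<integral>\<^sup>+s. (if 1 / 2 ^ k \<le> x then F s else 0) * indicator (dyadic_ivl k) s \<partial>lborel)"
    proof (cases "1 / 2 ^ k \<le> x")
      case True
      have "ennreal (2 ^ (k + 1)) * ennreal (1 / 2 ^ k) = ennreal (2 ^ (k + 1) * (1 / 2 ^ k))"
        by (rule ennreal_mult[symmetric]) auto
      also have "(2::real) ^ (k + 1) * (1 / 2 ^ k) = 2" by simp
      finally have e: "ennreal (2 ^ (k + 1)) * ennreal (1 / 2 ^ k) = 2" by simp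
      have "a k * ennreal (1 / 2 ^ k) = (ennreal (2 ^ (k + 1)) * ennreal (1 / 2 ^ k)) * (\<integral>\<^sup>+s\<in>dyadic_ivl k. F s \<partial>lborel)"
        using True by (simp only: a_def dyadic_avg_def if_True mult_ac)
      then show ?thesis unfolding e using True by simp
    qed (simp add: a_def)
    also have "\<dots> = (\<integral>\<^sup>+s. 2 * ((if 1 / 2 ^ k \<le> x then F s else 0) * indicator (dyadic_ivl k) s) \<partial>lborel)"
      by (rule nn_integral_cmult[symmetric]) measurable
    finally show "(\<integral>\<^sup>+t. a k * indicator {0<..<1 / 2 ^ k :: real} t \<partial>lborel) =
      (\<integral>\<^sup>+s. 2 * ((if 1 / 2 ^ k \<le> x then F s else 0) * indicator (dyadic_ivl k) s) \<partial>lborel)" .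
  qed
  also have "\<dots> = (\<integral>\<^sup>+s. (\<Sum>k. 2 * ((if 1 / 2 ^ k \<le> x then F s else 0) * indicator (dyadic_ivl k) s)) \<partial>lborel)"
    by (rule nn_integral_suminf[symmetric]) measurable
  also have "\<dots> \<le> (\<integral>\<^sup>+s. 2 * (F s * indicator {0<..x} s) \<partial>lborel)"
  proof (rule nn_integral_mono)
    fix s
    have "(\<Sum>k. (2 * (if 1 / 2 ^ k \<le> x then F s else 0)) * indicator (dyadic_ivl k) s) \<le> 2 * (F s * indicator {0<..x} s)"
    proof (rule suminf_disjoint_le[OF dyadic_ivl_disjoint])
      fix k assume s: "s \<in> dyadic_ivl k"
      then have "0 < s" "s \<le> 1 / 2 ^ k" using dyadic_ivl_subset by (auto simp: dyadic_ivl_def)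
      then show "2 * (if 1 / 2 ^ k \<le> x then F s else 0) \<le> 2 * (F s * indicator {0<..x} s)"
        by (auto simp: indicator_def)
    qed
    then show "(\<Sum>k. 2 * ((if 1 / 2 ^ k \<le> x then F s else 0) * indicator (dyadic_ivl k) s)) \<le> 2 * (F s * indicator {0<..x} s)"
      by (simp only: mult.assoc)
  qed
  also have "\<dots> = 2 * (\<integral>\<^sup>+s\<in>{0<..x}. F s \<partial>lborel)" by (rule nn_integral_cmult) measurable
  also have "\<dots> \<le> 2 * H"
  proof (rule mult_left_mono)
    show "(\<integral>\<^sup>+s\<in>{0<..x}. F s \<partial>lborel) \<le> H"
    proof -
      have "{0<..x} \<subseteq> {0<..1}" using x by auto
      from HL[OF _ this] x show ?thesis by (simp add: H_def)
    qed
  qed simp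
  finally have "(\<integral>\<^sup>+t\<in>{0<..<x}. dyadic_major F t \<partial>lborel) \<le> 2 * H + 2 * H" by (simp add: add_left_mono)
  also have "2 * H + 2 * H = (2 + 2) * H" by (simp only: distrib_right)
  finally show ?thesis by (simp add: H_def)
qed

text \<open>
  The integral of F v over a dyadic interval is transferred to the next interval to the left:
  there v is at least as large up to the factor C, and h dominates the average of F because it
  dominates the majorant slightly to the right. The neighbour has half the length, whence the
  factor 2. All neighbours that occur lie to the right of t/4.
\<close>
lemma dyadic_tail:
  fixes F :: "real \<Rightarrow> ennreal" and h v :: "real \<Rightarrow> real"
  assumes F[measurable]: "F \<in> borel_measurable borel"
    and v: "v \<in> borel_measurable (restrict_space borel {0<..<1})" and v0: "\<And>s. s \<in> {0<..<1} \<Longrightarrow> 0 \<le> v s"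
    and C: "0 < C" and vC: "\<And>s t. 0 < s \<Longrightarrow> s \<le> t \<Longrightarrow> t < 1 \<Longrightarrow> v t \<le> C * v s"
    and h: "antimono_on {0<..<1} h" "\<And>s. s \<in> {0<..<1} \<Longrightarrow> 0 \<le> h s"
    and hF: "\<And>s t. 0 < s \<Longrightarrow> s < t \<Longrightarrow> t < 1 \<Longrightarrow> dyadic_major F t \<le> ennreal (h s)"
    and t: "0 < t"
  shows "(\<integral>\<^sup>+s\<in>{t<..<1}. F s * ennreal (v s) \<partial>lborel) \<le>
    ennreal (2 * C) * (\<integral>\<^sup>+s\<in>{t / 4<..<1}. ennreal (h s * v s) \<partial>lborel)"
proof -
  have mv[measurable]: "(\<lambda>s. ennreal (v s) * indicator {0<..<1} s) \<in> borel_measurable borel"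
    using measurable_compose[OF v measurable_ennreal]
    by (subst (asm) borel_measurable_restrict_space_iff_ennreal) auto
  have mhv[measurable]: "(\<lambda>s. ennreal (h s * v s) * indicator {0<..<1} s) \<in> borel_measurable borel"
  proof -
    have "(\<lambda>s. ennreal (h s * v s)) \<in> borel_measurable (restrict_space borel {0<..<1})"
      using antimono_measurable[OF h(1)] v by measurable
    then show ?thesis by (subst (asm) borel_measurable_restrict_space_iff_ennreal) auto
  qed
  define q where "q s = F s * (ennreal (v s) * indicator {0<..<1} s)" for s
  define r where "r s = ennreal (h s * v s) * indicator {0<..<1} s" for s
  have [measurable]: "q \<in> borel_measurable borel" "r \<in> borel_measurable borel"
    unfolding q_def[abs_def] r_def[abs_def] by measurable
  have step: "(\<integral>\<^sup>+s\<in>dyadic_ivl k. q s \<partial>lborel) \<le> ennreal (2 * C) * (\<integral>\<^sup>+s\<in>dyadic_ivl (k + 1). r s \<partial>lborel)" for k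
  proof -
    define A where "A = (\<integral>\<^sup>+s\<in>dyadic_ivl k. q s \<partial>lborel)"
    define J where "J = (\<integral>\<^sup>+s\<in>dyadic_ivl k. F s \<partial>lborel)"
    have pt: "A \<le> ennreal (C / 2 ^ (k + 1)) * r s'" if s': "s' \<in> dyadic_ivl (k + 1)" for s'
    proof -
      have s'1: "0 < s'" "s' \<le> 1 / 2 ^ (k + 1)" using s' dyadic_ivl_subset[of "k+1"] by (auto simp: dyadic_ivl_def)
      have lt: "(1::real) / 2 ^ (k + 1) < 1 / 2 ^ k" "(1::real) / 2 ^ k \<le> 1" by (auto simp: field_simps)
      have "s' < 1" using s'1 lt by linarith
      with s'1 have s'2: "s' \<in> {0<..<1}" by simp
      have "A \<le> (\<integral>\<^sup>+s. ennreal (C * v s') * (F s * indicator (dyadic_ivl k) s) \<partial>lborel)"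
        unfolding A_def
      proof (rule nn_integral_mono)
        fix s
        have "F s * ennreal (v s) \<le> ennreal (C * v s') * F s" if s: "s \<in> dyadic_ivl k" "s < 1"
        proof -
          have "v s \<le> C * v s'" using s s'1 by (intro vC) (auto simp: dyadic_ivl_def)
          then have "ennreal (v s) \<le> ennreal (C * v s')" by (rule ennreal_leI)
          then have "F s * ennreal (v s) \<le> F s * ennreal (C * v s')" by (rule mult_left_mono) simp
          then show ?thesis by (simp only: mult.commute)
        qed
        then show "q s * indicator (dyadic_ivl k) s \<le> ennreal (C * v s') * (F s * indicator (dyadic_ivl k) s)"
          by (auto simp: q_def indicator_def)
      qed
      also have "\<dots> = ennreal (C * v s') * J" unfolding J_def by (rule nn_integral_cmult) measurable
      also have "J = ennreal (1 / 2 ^ (k + 1)) * dyadic_avg F k"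
      proof -
        have "ennreal (1 / 2 ^ (k + 1)) * ennreal (2 ^ (k + 1)) = ennreal (1 / 2 ^ (k + 1) * 2 ^ (k + 1))"
          by (rule ennreal_mult[symmetric]) auto
        also have "(1::real) / 2 ^ (k + 1) * 2 ^ (k + 1) = 1" by simp
        finally have "ennreal (1 / 2 ^ (k + 1)) * ennreal (2 ^ (k + 1)) = 1" by simp
        then show ?thesis unfolding dyadic_avg_def J_def by (simp only: mult.assoc[symmetric]) simp
      qed
      also have "dyadic_avg F k \<le> ennreal (h s')"
      proof -
        obtain s'' where s'': "s' < s''" "s'' < 1 / 2 ^ k" using dense[of s' "1 / 2 ^ k"] s'1 lt by auto
        have "dyadic_avg F k \<le> dyadic_major F s''"
          unfolding dyadic_major_def by (rule SUP_upper) (use s'' in simp)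
        also have "\<dots> \<le> ennreal (h s')"
        proof (rule hF)
          show "s'' < 1" using s''(2) lt(2) by linarith
        qed (use s'' s'1 in auto)
        finally show ?thesis .
      qed
      finally have "A \<le> ennreal (C * v s') * (ennreal (1 / 2 ^ (k + 1)) * ennreal (h s'))"
        by (simp add: mult_left_mono)
      also have "\<dots> = ennreal (C * v s' * (1 / 2 ^ (k + 1) * h s'))"
      proof -
        have "0 \<le> C * v s'" "0 \<le> 1 / 2 ^ (k + 1) * h s'" using C v0[OF s'2] h(2)[OF s'2] by auto
        moreover have "ennreal (1 / 2 ^ (k + 1) * h s') = ennreal (1 / 2 ^ (k + 1)) * ennreal (h s')"
          by (rule ennreal_mult') simp
        ultimately show ?thesis by (simp only: ennreal_mult)
      qed
      also have "C * v s' * (1 / 2 ^ (k + 1) * h s') = C / 2 ^ (k + 1) * (h s' * v s')" by simp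
      also have "ennreal \<dots> = ennreal (C / 2 ^ (k + 1)) * r s'"
        using C v0[OF s'2] h(2)[OF s'2] s'2 by (simp add: r_def ennreal_mult del: times_divide_eq_left times_divide_eq_right)
      finally show ?thesis .
    qed
    have "A * ennreal (1 / 2 ^ (k + 1 + 1)) = (\<integral>\<^sup>+s. A * indicator (dyadic_ivl (k + 1)) s \<partial>lborel)"
      by (subst nn_integral_cmult_indicator) (auto simp: dyadic_ivl_emeasure simp del: power_Suc)
    also have "\<dots> \<le> (\<integral>\<^sup>+s. ennreal (C / 2 ^ (k + 1)) * (r s * indicator (dyadic_ivl (k + 1)) s) \<partial>lborel)"
      using pt by (intro nn_integral_mono) (auto simp: indicator_def)
    also have "\<dots> = ennreal (C / 2 ^ (k + 1)) * (\<integral>\<^sup>+s\<in>dyadic_ivl (k + 1). r s \<partial>lborel)"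
      by (rule nn_integral_cmult) measurable
    finally have *: "A * ennreal (1 / 2 ^ (k + 1 + 1)) \<le> ennreal (C / 2 ^ (k + 1)) * (\<integral>\<^sup>+s\<in>dyadic_ivl (k + 1). r s \<partial>lborel)" .
    have "ennreal (2 ^ (k + 1 + 1)) * ennreal (1 / 2 ^ (k + 1 + 1)) = ennreal (2 ^ (k + 1 + 1) * (1 / 2 ^ (k + 1 + 1)))"
      by (rule ennreal_mult[symmetric]) auto
    also have "(2::real) ^ (k + 1 + 1) * (1 / 2 ^ (k + 1 + 1)) = 1" by simp
    finally have one: "ennreal (2 ^ (k + 1 + 1)) * ennreal (1 / 2 ^ (k + 1 + 1)) = 1" by simp
    have "ennreal (2 ^ (k + 1 + 1)) * ennreal (C / 2 ^ (k + 1)) = ennreal (2 ^ (k + 1 + 1) * (C / 2 ^ (k + 1)))"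
      using C by (intro ennreal_mult[symmetric]) auto
    also have "2 ^ (k + 1 + 1) * (C / 2 ^ (k + 1)) = 2 * C" by simp
    finally have two: "ennreal (2 ^ (k + 1 + 1)) * ennreal (C / 2 ^ (k + 1)) = ennreal (2 * C)" .
    have "A = (ennreal (2 ^ (k + 1 + 1)) * ennreal (1 / 2 ^ (k + 1 + 1))) * A" unfolding one by simp
    also have "\<dots> = ennreal (2 ^ (k + 1 + 1)) * (A * ennreal (1 / 2 ^ (k + 1 + 1)))" by (simp only: mult_ac)
    also have "\<dots> \<le> ennreal (2 ^ (k + 1 + 1)) * (ennreal (C / 2 ^ (k + 1)) * (\<integral>\<^sup>+s\<in>dyadic_ivl (k + 1). r s \<partial>lborel))"
      using * by (rule mult_left_mono) simp
    also have "\<dots> = ennreal (2 * C) * (\<integral>\<^sup>+s\<in>dyadic_ivl (k + 1). r s \<partial>lborel)"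
      by (simp only: mult.assoc[symmetric] two)
    finally show ?thesis unfolding A_def .
  qed
  have "(\<integral>\<^sup>+s\<in>{t<..<1}. F s * ennreal (v s) \<partial>lborel) \<le>
      (\<integral>\<^sup>+s. (\<Sum>k. (if t < 1 / 2 ^ k then q s else 0) * indicator (dyadic_ivl k) s) \<partial>lborel)"
  proof (rule nn_integral_mono)
    fix s
    show "F s * ennreal (v s) * indicator {t<..<1} s \<le> (\<Sum>k. (if t < 1 / 2 ^ k then q s else 0) * indicator (dyadic_ivl k) s)"
    proof (cases "s \<in> {t<..<1}")
      case True
      then obtain k where k: "s \<in> dyadic_ivl k" using dyadic_ivl_cover[of s] t by auto
      then have "t < 1 / 2 ^ k" using True by (auto simp: dyadic_ivl_def)
      then have "F s * ennreal (v s) * indicator {t<..<1} s = (if t < 1 / 2 ^ k then q s else 0) * indicator (dyadic_ivl k) s"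
        using True k t by (simp add: q_def)
      also have "\<dots> \<le> (\<Sum>k. (if t < 1 / 2 ^ k then q s else 0) * indicator (dyadic_ivl k) s)" by (rule suminf_ge_term)
      finally show ?thesis .
    qed simp
  qed
  also have "\<dots> = (\<Sum>k. \<integral>\<^sup>+s. (if t < 1 / 2 ^ k then q s else 0) * indicator (dyadic_ivl k) s \<partial>lborel)"
    by (rule nn_integral_suminf) measurable
  also have "\<dots> \<le> (\<Sum>k. ennreal (2 * C) * (\<integral>\<^sup>+s. (if t < 1 / 2 ^ k then r s else 0) * indicator (dyadic_ivl (k + 1)) s \<partial>lborel))"
  proof (rule suminf_le)
    fix k
    show "(\<integral>\<^sup>+s. (if t < 1 / 2 ^ k then q s else 0) * indicator (dyadic_ivl k) s \<partial>lborel) \<le>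
        ennreal (2 * C) * (\<integral>\<^sup>+s. (if t < 1 / 2 ^ k then r s else 0) * indicator (dyadic_ivl (k + 1)) s \<partial>lborel)"
      using step[of k] by (cases "t < 1 / 2 ^ k") auto
  qed auto
  also have "\<dots> = ennreal (2 * C) * (\<Sum>k. \<integral>\<^sup>+s. (if t < 1 / 2 ^ k then r s else 0) * indicator (dyadic_ivl (k + 1)) s \<partial>lborel)"
    by simp
  also have "(\<Sum>k. \<integral>\<^sup>+s. (if t < 1 / 2 ^ k then r s else 0) * indicator (dyadic_ivl (k + 1)) s \<partial>lborel) =
      (\<integral>\<^sup>+s. (\<Sum>k. (if t < 1 / 2 ^ k then r s else 0) * indicator (dyadic_ivl (k + 1)) s) \<partial>lborel)"
    by (rule nn_integral_suminf[symmetric]) measurable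
  also have "\<dots> \<le> (\<integral>\<^sup>+s\<in>{t / 4<..<1}. ennreal (h s * v s) \<partial>lborel)"
  proof (rule nn_integral_mono)
    fix s
    have disj: "disjoint_family (\<lambda>k. dyadic_ivl (k + 1))"
      using dyadic_ivl_disjoint unfolding disjoint_family_on_def by auto
    show "(\<Sum>k. (if t < 1 / 2 ^ k then r s else 0) * indicator (dyadic_ivl (k + 1)) s) \<le>
        ennreal (h s * v s) * indicator {t / 4<..<1} s"
    proof (rule suminf_disjoint_le[OF disj])
      fix k assume s: "s \<in> dyadic_ivl (k + 1)"
      have "t / 4 < s" if "t < 1 / 2 ^ k"
        using s that by (simp add: dyadic_ivl_def)
      then show "(if t < 1 / 2 ^ k then r s else 0) \<le> ennreal (h s * v s) * indicator {t / 4<..<1} s"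
        by (auto simp: r_def indicator_def)
    qed
  qed
  finally show ?thesis by (simp add: mult_left_mono)
qed

section \<open>Boundedness of the integral operator\<close>

lemma M_space_norm: "f \<in> M_space \<Longrightarrow> (\<lambda>x. norm (f x)) \<in> borel_measurable (lebesgue_on {0<..<1})"
  unfolding M_space_def by measurable

context Bp_pair begin

text \<open>
  The p-th power of s^(1/p) b1(s), which is almost increasing by slow variation, is 1/v(s).
\<close>
lemma v_quasi: "\<exists>C>0. \<forall>s t. 0 < s \<longrightarrow> s \<le> t \<longrightarrow> t < 1 \<longrightarrow> v t \<le> C * v s"
proof -
  obtain C where C: "C > 0" "\<And>s t. 0 < s \<Longrightarrow> s \<le> t \<Longrightarrow> t < 1 \<Longrightarrow> s powr (1 / p) * b1 s \<le> C * (t powr (1 / p) * b1 t)"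
    using slowly_varying_quasi_increasing[OF sv(1), of "1 / p"] p by auto
  have "v t \<le> C powr p * v s" if st: "0 < s" "s \<le> t" "t < 1" for s t
  proof -
    have P: "0 < b1 s" "0 < b1 t" using pos(1)[of s] pos(1)[of t] st by auto
    have e: "(x powr (1 / p) * b1 x) powr p = x * b1 x powr p" if "0 < x" "0 < b1 x" for x
      using that p by (simp add: powr_mult powr_powr)
    have "(s powr (1 / p) * b1 s) powr p \<le> (C * (t powr (1 / p) * b1 t)) powr p"
      using C(2)[OF st] P p by (intro powr_mono2) auto
    also have "\<dots> = C powr p * (t powr (1 / p) * b1 t) powr p" using C P by (subst powr_mult) auto
    finally have "s * b1 s powr p \<le> C powr p * (t * b1 t powr p)" using e[of s] e[of t] st P by simp
    moreover have "0 < s * b1 s powr p" "0 < t * b1 t powr p" using st P by auto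
    ultimately show ?thesis unfolding v_def by (simp add: field_simps)
  qed
  then show ?thesis using C by (intro exI[of _ "C powr p"]) auto
qed

text \<open>
  The finite-valued form of the operator U.
\<close>
definition u :: "(real \<Rightarrow> complex) \<Rightarrow> real \<Rightarrow> real" where
  "u f t = rearr f (phi t) / b2 t"

lemma u_antimono:
  assumes f: "f \<in> M_space"
  shows "antimono_on {0<..<1} (u f)" and "t \<in> {0<..<1} \<Longrightarrow> 0 \<le> u f t"
proof -
  note nf = M_space_norm[OF f]
  show "0 \<le> u f t" if "t \<in> {0<..<1}" for t
    using rearr_nonneg[OF nf, of "phi t"] phi_in[OF that] pos(2)[OF that] by (simp add: u_def)
  show "antimono_on {0<..<1} (u f)"
  proof (rule monotone_onI)
    fix s t :: real assume st: "s \<in> {0<..<1}" "t \<in> {0<..<1}" "s \<le> t"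
    have "phi s \<le> phi t" using st by (intro phi_le_mono) auto
    then show "u f t \<le> u f s"
      unfolding u_def using phi_in[OF st(1)] phi_in[OF st(2)] pos(2)[OF st(1)] monotone_onD[OF b2_mono st]
      by (intro frac_le rearr_nonneg[OF nf] rearr_mono[OF nf]) auto
  qed
qed

lemma ext_norm_U:
  assumes N: "ri_functional N" and f: "f \<in> M_space"
  shows "ext_norm N (U_op b1 b2 p f) = N (u f)"
proof -
  have U: "U_op b1 b2 p f t = ennreal (u f t)" if "t \<in> {0<..<1}" for t
    using U_op_eq[OF that] by (simp add: u_def)
  have "AE t in lebesgue_on {0<..<1}. U_op b1 b2 p f t < \<infinity>" by (rule AE_I2) (simp add: U)
  then have "ext_norm N (U_op b1 b2 p f) = N (\<lambda>t. enn2real (U_op b1 b2 p f t))" by (simp add: ext_norm_def)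
  also have "\<dots> = N (u f)"
    by (rule ri_functional_cong[OF N antimono_M_plus, symmetric]) (use u_antimono[OF f] in \<open>auto simp: U\<close>)
  finally show ?thesis .
qed

lemma S_op_eq:
  "S_op b1 p f = (\<lambda>t. epow (\<integral>\<^sup>+s\<in>{t<..<1}. ennreal (norm (f s) powr p * v s) \<partial>lebesgue) (1 / p))"
  by (simp add: S_op_def v_def fun_eq_iff)

lemma tail_antimono:
  "s \<le> t \<Longrightarrow> (\<integral>\<^sup>+r\<in>{t<..<1::real}. q r \<partial>N) \<le> (\<integral>\<^sup>+r\<in>{s<..<1}. q r \<partial>N)"
  by (intro nn_set_integral_set_mono) auto

lemma S_rearr_majorized:
  "\<exists>C>0. \<forall>f\<in>M_space. \<forall>x\<in>{0<..<1}.
     (\<integral>\<^sup>+t\<in>{0<..<x}. (\<integral>\<^sup>+s\<in>{t<..<1}. ennreal (rearr f s powr p * v s) \<partial>lborel) \<partial>lborel) \<le>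
     (\<integral>\<^sup>+t\<in>{0<..<x}. ennreal (C * u f t powr p) \<partial>lborel)"
proof -
  obtain C where C: "C > 0" and maj: "\<And>h x. antimono_on {0<..<1} h \<Longrightarrow> \<forall>s\<in>{0<..<1}. 0 \<le> h s \<Longrightarrow> x \<in> {0<..<1} \<Longrightarrow>
     (\<integral>\<^sup>+t\<in>{0<..<x}. (\<integral>\<^sup>+s\<in>{t<..<1}. ennreal (h s * v s) \<partial>lborel) \<partial>lborel) \<le>
     (\<integral>\<^sup>+t\<in>{0<..<x}. ennreal (C * (h (phi t) / b2 t powr p)) \<partial>lborel)"
    using S_majorized_by_U by blast
  show ?thesis
  proof (intro exI[of _ C] conjI ballI C)
    fix f :: "real \<Rightarrow> complex" and x :: real assume f: "f \<in> M_space" and x: "x \<in> {0<..<1}"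
    note nf = M_space_norm[OF f]
    have "(\<integral>\<^sup>+t\<in>{0<..<x}. (\<integral>\<^sup>+s\<in>{t<..<1}. ennreal (rearr f s powr p * v s) \<partial>lborel) \<partial>lborel) \<le>
       (\<integral>\<^sup>+t\<in>{0<..<x}. ennreal (C * (rearr f (phi t) powr p / b2 t powr p)) \<partial>lborel)"
      by (rule maj[OF rearr_powr_antimono[OF nf p] _ x]) simp
    also have "\<dots> = (\<integral>\<^sup>+t\<in>{0<..<x}. ennreal (C * u f t powr p) \<partial>lborel)"
    proof (rule nn_integral_cong)
      fix t
      show "ennreal (C * (rearr f (phi t) powr p / b2 t powr p)) * indicator {0<..<x} t =
          ennreal (C * u f t powr p) * indicator {0<..<x} t"
        by (simp add: u_def powr_divide)
    qed
    finally show "(\<integral>\<^sup>+t\<in>{0<..<x}. (\<integral>\<^sup>+s\<in>{t<..<1}. ennreal (rearr f s powr p * v s) \<partial>lborel) \<partial>lborel) \<le>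
     (\<integral>\<^sup>+t\<in>{0<..<x}. ennreal (C * u f t powr p) \<partial>lborel)" .
  qed
qed

lemma S_rearr_bounded:
  assumes N: "ri_functional N" and conv: "p_convex p N"
  shows "\<exists>C>0. \<forall>f\<in>M_space. ext_norm N (S_op b1 p (rearr f)) \<le> ennreal C * ext_norm N (U_op b1 b2 p f)"
proof -
  obtain C where C: "C > 0" and maj: "\<And>f x. f \<in> M_space \<Longrightarrow> x \<in> {0<..<1} \<Longrightarrow>
     (\<integral>\<^sup>+t\<in>{0<..<x}. (\<integral>\<^sup>+s\<in>{t<..<1}. ennreal (rearr f s powr p * v s) \<partial>lborel) \<partial>lborel) \<le>
     (\<integral>\<^sup>+t\<in>{0<..<x}. ennreal (C * u f t powr p) \<partial>lborel)"
    using S_rearr_majorized by blast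
  show ?thesis
  proof (intro exI[of _ "C powr (1 / p)"] conjI ballI)
    fix f assume f: "f \<in> M_space"
    have "ext_norm N (S_op b1 p (rearr f)) \<le> ennreal (C powr (1 / p)) * N (u f)"
      unfolding S_op_eq
    proof (rule ext_norm_HLP[OF p N conv _ u_antimono[OF f] C])
      fix x :: real assume x: "x \<in> {0<..<1}"
      have "(\<integral>\<^sup>+t\<in>{0<..<x}. (\<integral>\<^sup>+s\<in>{t<..<1}. ennreal (norm (rearr f s) powr p * v s) \<partial>lebesgue) \<partial>lborel) =
          (\<integral>\<^sup>+t\<in>{0<..<x}. (\<integral>\<^sup>+s\<in>{t<..<1}. ennreal (rearr f s powr p * v s) \<partial>lborel) \<partial>lborel)"
        unfolding nn_integral_completion
      proof (intro nn_integral_cong)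
        fix t
        have "(\<integral>\<^sup>+s\<in>{t<..<1}. ennreal (norm (rearr f s) powr p * v s) \<partial>lborel) =
            (\<integral>\<^sup>+s\<in>{t<..<1}. ennreal (rearr f s powr p * v s) \<partial>lborel)" if "0 < t"
          using rearr_nonneg[OF M_space_norm[OF f]] that
          by (intro nn_integral_cong) (auto simp: indicator_def)
        then show "(\<integral>\<^sup>+s\<in>{t<..<1}. ennreal (norm (rearr f s) powr p * v s) \<partial>lborel) * indicator {0<..<x} t =
            (\<integral>\<^sup>+s\<in>{t<..<1}. ennreal (rearr f s powr p * v s) \<partial>lborel) * indicator {0<..<x} t"
          by (auto simp: indicator_def)
      qed
      also have "\<dots> \<le> (\<integral>\<^sup>+t\<in>{0<..<x}. ennreal (C * u f t powr p) \<partial>lborel)" by (rule maj[OF f x])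
      finally show "(\<integral>\<^sup>+t\<in>{0<..<x}. (\<integral>\<^sup>+s\<in>{t<..<1}. ennreal (norm (rearr f s) powr p * v s) \<partial>lebesgue) \<partial>lborel) \<le>
          (\<integral>\<^sup>+t\<in>{0<..<x}. ennreal (C * u f t powr p) \<partial>lborel)" .
    qed (rule tail_antimono)
    then show "ext_norm N (S_op b1 p (rearr f)) \<le> ennreal (C powr (1 / p)) * ext_norm N (U_op b1 b2 p f)"
      unfolding ext_norm_U[OF N f] .
  qed (use C in simp)
qed

text \<open>
  The function g is the p-th root of the majorant of the dyadic averages of |f|^p. It is
  finite because f* has finite norm, so that (f*)^p is integrable. The shift t/4 is absorbed
  by rescaling the outer integral, which costs a factor 4.
\<close>
lemma S_majorized_by_decreasing:
  assumes NX: "ri_functional NX" and conv: "p_convex p NX"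
  shows "\<exists>C>0. \<forall>f\<in>ri_space NX. \<exists>g\<in>M_space. NX (rearr g) \<le> ennreal (4 powr (1 / p)) * NX (rearr f) \<and>
    (\<forall>x\<in>{0<..<1}. (\<integral>\<^sup>+t\<in>{0<..<x}. (\<integral>\<^sup>+s\<in>{t<..<1}. ennreal (norm (f s) powr p * v s) \<partial>lebesgue) \<partial>lborel) \<le>
       ennreal C * (\<integral>\<^sup>+t\<in>{0<..<x}. (\<integral>\<^sup>+s\<in>{t<..<1}. ennreal (rearr g s powr p * v s) \<partial>lborel) \<partial>lborel))"
proof -
  obtain Cv where Cv: "Cv > 0" "\<And>s t. 0 < s \<Longrightarrow> s \<le> t \<Longrightarrow> t < 1 \<Longrightarrow> v t \<le> Cv * v s"
    using v_quasi by blast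
  show ?thesis
  proof (intro exI[of _ "8 * Cv"] conjI ballI)
    show "0 < 8 * Cv" using Cv by simp
    fix f assume fX: "f \<in> ri_space NX"
    then have f: "f \<in> M_space" and fin: "NX (rearr f) < \<infinity>" by (auto simp: ri_space_def ri_norm_def)
    note nf = M_space_norm[OF f]
    have "(\<lambda>x. indicator {0<..<1} x *\<^sub>R norm (f x)) \<in> borel_measurable lebesgue"
      using nf by (subst (asm) borel_measurable_restrict_space_iff) auto
    from completion_ex_borel_measurable_real[OF this]
    obtain g0 where g0: "g0 \<in> borel_measurable lborel"
      "AE x in lborel. indicator {0<..<1} x *\<^sub>R norm (f x) = g0 x" by blast
    define g where "g x = \<bar>g0 x\<bar>" for x
    have g[measurable]: "g \<in> borel_measurable borel" using g0(1) unfolding g_def[abs_def] by simp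
    have gf: "AE x in lebesgue. x \<in> {0<..<1} \<longrightarrow> g x = norm (f x)"
      using AE_completion[OF g0(2)]
    proof eventually_elim
      case (elim x)
      show ?case
      proof
        assume "x \<in> {0<..<1}"
        with elim have "g0 x = norm (f x)" by simp
        then show "g x = norm (f x)" by (simp add: g_def)
      qed
    qed
    have g_nonneg: "0 \<le> g x" for x by (simp add: g_def)
    define F where "F s = ennreal (g s powr p)" for s
    have F[measurable]: "F \<in> borel_measurable borel" unfolding F_def[abs_def] by measurable
    define h where "h t = rearr f t powr p" for t
    have h: "antimono_on {0<..<1} h" unfolding h_def[abs_def] by (rule rearr_powr_antimono[OF nf p])
    have HL: "(\<integral>\<^sup>+s\<in>E. F s \<partial>lborel) \<le> (\<integral>\<^sup>+t\<in>{0<..<measure lborel E}. ennreal (h t) \<partial>lborel)"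
      if "E \<in> sets borel" "E \<subseteq> {0<..1}" for E
      unfolding F_def h_def using that by (intro Hardy_Littlewood[OF nf g g_nonneg gf _ _ p])
    define fh where "fh = dyadic_major F"
    have fh_int: "(\<integral>\<^sup>+t\<in>{0<..<x}. fh t \<partial>lborel) \<le> 4 * (\<integral>\<^sup>+t\<in>{0<..<x}. ennreal (h t) \<partial>lborel)" if "x \<in> {0<..<1}" for x
      unfolding fh_def by (rule dyadic_major_integral[OF F h HL that])
    have fh_anti: "s \<le> t \<Longrightarrow> fh t \<le> fh s" for s t unfolding fh_def by (rule dyadic_major_antimono)
    have h_fin: "(\<integral>\<^sup>+t\<in>{0<..<1}. ennreal (h t) \<partial>lborel) < \<infinity>"
    proof -
      define Z where "Z h = epow (NX (\<lambda>x. h x powr (1 / p))) p" for h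
      have Z: "ri_banach_norm Z" using conv unfolding p_convex_def Z_def .
      have r: "rearr f \<in> M_plus"
        using rearr_mono[OF nf] rearr_nonneg[OF nf] by (intro antimono_M_plus) (auto simp: monotone_on_def)
      have "NX (rearr f) = NX (\<lambda>x. h x powr (1 / p))"
        by (rule ri_functional_cong[OF NX r]) (use rearr_nonneg[OF nf] p in \<open>simp add: h_def powr_powr\<close>)
      then have "Z h < \<infinity>" using fin by (simp add: Z_def epow_less_top)
      moreover have "h \<in> M_plus" by (rule antimono_M_plus[OF h]) (simp add: h_def)
      ultimately show ?thesis by (intro ri_banach_normD(7)[OF Z])
    qed
    have fh_fin: "fh t < \<infinity>" if t: "t \<in> {0<..<1}" for t
    proof -
      have "fh t * ennreal t = (\<integral>\<^sup>+s. fh t * indicator {0<..<t} s \<partial>lborel)"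
        using t by (subst nn_integral_cmult_indicator) auto
      also have "\<dots> \<le> (\<integral>\<^sup>+s\<in>{0<..<t}. fh s \<partial>lborel)"
        using t by (intro nn_integral_mono) (auto simp: indicator_def intro: fh_anti)
      also have "\<dots> \<le> 4 * (\<integral>\<^sup>+s\<in>{0<..<t}. ennreal (h s) \<partial>lborel)" by (rule fh_int[OF t])
      also have "\<dots> \<le> 4 * (\<integral>\<^sup>+s\<in>{0<..<1}. ennreal (h s) \<partial>lborel)"
        using t by (intro mult_left_mono nn_set_integral_set_mono) auto
      also have "\<dots> < \<infinity>" using h_fin by (simp add: ennreal_mult_less_top)
      finally show ?thesis using t by (auto simp: ennreal_mult_less_top)
    qed
    define k where "k t = enn2real (fh t) powr (1 / p)" for t
    have k0: "0 \<le> k t" for t by (simp add: k_def)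
    have k_pow: "ennreal (k t powr p) = fh t" if "t \<in> {0<..<1}" for t
      using fh_fin[OF that] p by (simp add: k_def powr_powr)
    have k_anti: "antimono_on {0<..<1} k"
      using fh_fin fh_anti p
      by (intro monotone_onI) (auto simp: k_def intro!: powr_mono2 enn2real_mono)
    define G where "G t = complex_of_real (k t)" for t
    have norm_G: "norm (G t) = k t" for t by (simp add: G_def k0)
    have GM: "G \<in> M_space"
    proof -
      have "k \<in> borel_measurable (lebesgue_on {0<..<1})"
        using antimono_measurable[OF k_anti] by (rule borel_lebesgue_on) simp
      then show ?thesis unfolding M_space_def G_def[abs_def] by measurable
    qed
    note nG = M_space_norm[OF GM]
    have G_anti: "antimono_on {0<..<1} (\<lambda>x. norm (G x))" using k_anti by (simp add: norm_G)
    have rearr_le: "ennreal (rearr G t powr p) \<le> fh t" if t: "t \<in> {0<..<1}" for t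
    proof -
      have "rearr G t powr p \<le> k t powr p"
        using rearr_antimono_le(1)[OF nG G_anti t] rearr_nonneg[OF nG, of t] t p
        by (intro powr_mono2) (auto simp: norm_G)
      then show ?thesis unfolding k_pow[OF t, symmetric] by (rule ennreal_leI)
    qed
    have rearr_ge: "fh t \<le> ennreal (rearr G s powr p)" if "0 < s" "s < t" "t < 1" for s t
    proof -
      have t: "t \<in> {0<..<1}" and s: "s \<in> {0<..<1}" using that by auto
      have "k t powr p \<le> rearr G s powr p"
        using rearr_antimono_le(2)[OF nG G_anti s, of t] that k0 p
        by (intro powr_mono2) (auto simp: norm_G)
      then show ?thesis unfolding k_pow[OF t, symmetric] by (rule ennreal_leI)
    qed
    define H where "H t = rearr G t powr p" for t
    have H: "antimono_on {0<..<1} H" unfolding H_def[abs_def] by (rule rearr_powr_antimono[OF nG p])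
    have mv: "v \<in> borel_measurable (restrict_space borel {0<..<1})"
      by (rule borel_measurable_continuous_on_restrict[OF v_cont])
    have mHv: "(\<lambda>s. ennreal (H s * v s) * indicator {0<..<1} s) \<in> borel_measurable borel"
    proof -
      have "(\<lambda>s. ennreal (H s * v s)) \<in> borel_measurable (restrict_space borel {0<..<1})"
        using antimono_measurable[OF H] mv by measurable
      then show ?thesis by (subst (asm) borel_measurable_restrict_space_iff_ennreal) auto
    qed
    define T where "T t = (\<integral>\<^sup>+s\<in>{t<..<1}. ennreal (H s * v s) \<partial>lborel)" for t
    have mT: "(\<lambda>t. T t * indicator {0<..<y} t) \<in> borel_measurable borel" for y
    proof -
      note [measurable] = mHv
      have "(\<lambda>t. (\<integral>\<^sup>+s. (ennreal (H s * v s) * indicator {0<..<1} s) * (if t < s \<and> s < 1 then 1 else 0) \<partial>lborel) * indicator {0<..<y} t)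
          \<in> borel_measurable borel"
        by measurable
      also have "(\<lambda>t. (\<integral>\<^sup>+s. (ennreal (H s * v s) * indicator {0<..<1} s) * (if t < s \<and> s < 1 then 1 else 0) \<partial>lborel) * indicator {0<..<y} t) =
          (\<lambda>t. T t * indicator {0<..<y} t)"
      proof (rule ext)
        fix t :: real
        have "(\<integral>\<^sup>+s. (ennreal (H s * v s) * indicator {0<..<1} s) * (if t < s \<and> s < 1 then 1 else 0) \<partial>lborel) = T t" if "0 < t"
          unfolding T_def using that by (intro nn_integral_cong) (auto simp: indicator_def)
        then show "(\<integral>\<^sup>+s. (ennreal (H s * v s) * indicator {0<..<1} s) * (if t < s \<and> s < 1 then 1 else 0) \<partial>lborel) * indicator {0<..<y} t =
            T t * indicator {0<..<y} t"
          by (auto simp: indicator_def)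
      qed
      finally show ?thesis .
    qed
    have tail: "(\<integral>\<^sup>+s\<in>{t<..<1}. ennreal (norm (f s) powr p * v s) \<partial>lebesgue) \<le> ennreal (2 * Cv) * T (t / 4)" if t: "0 < t" for t
    proof -
      have "(\<integral>\<^sup>+s\<in>{t<..<1}. ennreal (norm (f s) powr p * v s) \<partial>lebesgue) =
          (\<integral>\<^sup>+s\<in>{t<..<1}. F s * ennreal (v s) \<partial>lebesgue)"
      proof (rule nn_integral_cong_AE)
        show "AE s in lebesgue. ennreal (norm (f s) powr p * v s) * indicator {t<..<1} s =
            F s * ennreal (v s) * indicator {t<..<1} s"
          using gf by eventually_elim (use t in \<open>auto simp: F_def indicator_def ennreal_mult'\<close>)
      qed
      also have "\<dots> = (\<integral>\<^sup>+s\<in>{t<..<1}. F s * ennreal (v s) \<partial>lborel)" by (rule nn_integral_completion)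
      also have "\<dots> \<le> ennreal (2 * Cv) * T (t / 4)"
        unfolding T_def
      proof (rule dyadic_tail[OF F mv _ Cv H _ _ t])
        show "dyadic_major F t \<le> ennreal (H s)" if "0 < s" "s < t" "t < 1" for s t
          using rearr_ge[OF that] by (simp add: fh_def H_def)
      qed (use v_pos in \<open>auto simp: H_def less_imp_le\<close>)
      finally show ?thesis .
    qed
    show "\<exists>g\<in>M_space. NX (rearr g) \<le> ennreal (4 powr (1 / p)) * NX (rearr f) \<and>
      (\<forall>x\<in>{0<..<1}. (\<integral>\<^sup>+t\<in>{0<..<x}. (\<integral>\<^sup>+s\<in>{t<..<1}. ennreal (norm (f s) powr p * v s) \<partial>lebesgue) \<partial>lborel) \<le>
         ennreal (8 * Cv) * (\<integral>\<^sup>+t\<in>{0<..<x}. (\<integral>\<^sup>+s\<in>{t<..<1}. ennreal (rearr g s powr p * v s) \<partial>lborel) \<partial>lborel))"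
    proof (intro bexI[of _ G] conjI ballI GM)
      have "ext_norm NX (\<lambda>t. epow (ennreal (H t)) (1 / p)) \<le> ennreal (4 powr (1 / p)) * NX (rearr f)"
      proof (rule ext_norm_HLP[OF p NX conv])
        show "ennreal (H t) \<le> ennreal (H s)" if "0 < s" "s \<le> t" "t < 1" for s t
          using that by (intro ennreal_leI monotone_onD[OF H]) auto
        show "antimono_on {0<..<1} (rearr f)" using rearr_mono[OF nf] by (auto simp: monotone_on_def)
        show "0 \<le> rearr f t" if "t \<in> {0<..<1}" for t using rearr_nonneg[OF nf] that by simp
        fix x :: real assume x: "x \<in> {0<..<1}"
        have "(\<integral>\<^sup>+t\<in>{0<..<x}. ennreal (H t) \<partial>lborel) \<le> (\<integral>\<^sup>+t\<in>{0<..<x}. fh t \<partial>lborel)"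
          using rearr_le x by (intro nn_integral_mono) (auto simp: indicator_def H_def)
        also have "\<dots> \<le> 4 * (\<integral>\<^sup>+t\<in>{0<..<x}. ennreal (h t) \<partial>lborel)" by (rule fh_int[OF x])
        also have "\<dots> = (\<integral>\<^sup>+t. 4 * (ennreal (h t) * indicator {0<..<x} t) \<partial>lborel)"
        proof (rule nn_integral_cmult[symmetric])
          have "antimono_on {0<..<x} h" using x by (intro monotone_on_subset[OF h]) auto
          then have "(\<lambda>t. ennreal (h t)) \<in> borel_measurable (restrict_space borel {0<..<x})"
            by (intro measurable_compose[OF antimono_measurable measurable_ennreal])
          then show "(\<lambda>t. ennreal (h t) * indicator {0<..<x} t) \<in> borel_measurable lborel"
            by (subst (asm) borel_measurable_restrict_space_iff_ennreal) auto
        qed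
        also have "\<dots> = (\<integral>\<^sup>+t\<in>{0<..<x}. ennreal (4 * rearr f t powr p) \<partial>lborel)"
          by (intro nn_integral_cong) (auto simp: h_def indicator_def ennreal_mult)
        finally show "(\<integral>\<^sup>+t\<in>{0<..<x}. ennreal (H t) \<partial>lborel) \<le>
            (\<integral>\<^sup>+t\<in>{0<..<x}. ennreal (4 * rearr f t powr p) \<partial>lborel)" .
      qed simp
      also have "ext_norm NX (\<lambda>t. epow (ennreal (H t)) (1 / p)) = NX (rearr G)"
      proof -
        have rG: "rearr G \<in> M_plus"
          using rearr_mono[OF nG] rearr_nonneg[OF nG] by (intro antimono_M_plus) (auto simp: monotone_on_def)
        have e: "epow (ennreal (H t)) (1 / p) = ennreal (H t powr (1 / p))" for t
          by (simp add: epow_def H_def)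
        have "ext_norm NX (\<lambda>t. epow (ennreal (H t)) (1 / p)) = NX (\<lambda>t. H t powr (1 / p))"
          by (simp add: ext_norm_def e)
        also have "\<dots> = NX (rearr G)"
          by (rule ri_functional_cong[OF NX rG, symmetric])
            (use rearr_nonneg[OF nG] p in \<open>simp add: H_def powr_powr\<close>)
        finally show ?thesis .
      qed
      finally show "NX (rearr G) \<le> ennreal (4 powr (1 / p)) * NX (rearr f)" .
    next
      fix x :: real assume x: "x \<in> {0<..<1}"
      have mT4: "(\<lambda>t. T (t / 4) * indicator {0<..<x} t) \<in> borel_measurable lborel"
      proof -
        have "(\<lambda>t. T (t / 4) * indicator {0<..<x / 4} (t / 4)) \<in> borel_measurable borel"
          by (rule measurable_compose[OF _ mT]) measurable
        also have "(\<lambda>t. T (t / 4) * indicator {0<..<x / 4} (t / 4)) = (\<lambda>t. T (t / 4) * indicator {0<..<x} t)"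
          by (auto simp: indicator_def fun_eq_iff)
        finally show ?thesis by simp
      qed
      have "(\<integral>\<^sup>+t\<in>{0<..<x}. (\<integral>\<^sup>+s\<in>{t<..<1}. ennreal (norm (f s) powr p * v s) \<partial>lebesgue) \<partial>lborel) \<le>
          (\<integral>\<^sup>+t. ennreal (2 * Cv) * (T (t / 4) * indicator {0<..<x} t) \<partial>lborel)"
        using tail by (intro nn_integral_mono) (auto simp: indicator_def)
      also have "\<dots> = ennreal (2 * Cv) * (\<integral>\<^sup>+t\<in>{0<..<x}. T (t / 4) \<partial>lborel)"
        by (rule nn_integral_cmult[OF mT4])
      also have "(\<integral>\<^sup>+t\<in>{0<..<x}. T (t / 4) \<partial>lborel) = 4 * (\<integral>\<^sup>+t\<in>{0<..<x / 4}. T t \<partial>lborel)"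
        using nn_integral_scale[of "\<lambda>t. T (t / 4)" 4 "x / 4"] mT4 by simp
      also have "\<dots> \<le> 4 * (\<integral>\<^sup>+t\<in>{0<..<x}. T t \<partial>lborel)"
        using x by (intro mult_left_mono nn_set_integral_set_mono) auto
      finally have "(\<integral>\<^sup>+t\<in>{0<..<x}. (\<integral>\<^sup>+s\<in>{t<..<1}. ennreal (norm (f s) powr p * v s) \<partial>lebesgue) \<partial>lborel) \<le>
          ennreal (2 * Cv) * (4 * (\<integral>\<^sup>+t\<in>{0<..<x}. T t \<partial>lborel))"
        by (simp add: mult_left_mono)
      also have "\<dots> = ennreal (8 * Cv) * (\<integral>\<^sup>+t\<in>{0<..<x}. T t \<partial>lborel)"
      proof -
        have "ennreal (2 * Cv) * 4 = ennreal (2 * Cv) * ennreal 4" by simp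
        also have "\<dots> = ennreal (2 * Cv * 4)" by (rule ennreal_mult''[symmetric]) simp
        also have "2 * Cv * 4 = 8 * Cv" by simp
        finally show ?thesis by (simp only: mult.assoc[symmetric])
      qed
      finally show "(\<integral>\<^sup>+t\<in>{0<..<x}. (\<integral>\<^sup>+s\<in>{t<..<1}. ennreal (norm (f s) powr p * v s) \<partial>lebesgue) \<partial>lborel) \<le>
         ennreal (8 * Cv) * (\<integral>\<^sup>+t\<in>{0<..<x}. (\<integral>\<^sup>+s\<in>{t<..<1}. ennreal (rearr G s powr p * v s) \<partial>lborel) \<partial>lborel)"
        by (simp add: T_def H_def)
    qed
  qed
qed

lemma S_bounded_if_U_bounded:
  assumes NY: "ri_functional NY" "p_convex p NY" and NX: "ri_functional NX" "p_convex p NX"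
    and U: "bounded_op NX NY (U_op b1 b2 p)"
  shows "bounded_op NX NY (S_op b1 p)"
proof -
  obtain CU where CU: "CU > 0" "\<And>f. f \<in> ri_space NX \<Longrightarrow> ext_norm NY (U_op b1 b2 p f) \<le> ennreal CU * ri_norm NX f"
    using U unfolding bounded_op_def by blast
  obtain C where C: "C > 0" and maj: "\<And>f x. f \<in> M_space \<Longrightarrow> x \<in> {0<..<1} \<Longrightarrow>
     (\<integral>\<^sup>+t\<in>{0<..<x}. (\<integral>\<^sup>+s\<in>{t<..<1}. ennreal (rearr f s powr p * v s) \<partial>lborel) \<partial>lborel) \<le>
     (\<integral>\<^sup>+t\<in>{0<..<x}. ennreal (C * u f t powr p) \<partial>lborel)"
    using S_rearr_majorized by blast
  obtain D where D: "D > 0" and dec: "\<And>f. f \<in> ri_space NX \<Longrightarrow> \<exists>g\<in>M_space.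
    NX (rearr g) \<le> ennreal (4 powr (1 / p)) * NX (rearr f) \<and>
    (\<forall>x\<in>{0<..<1}. (\<integral>\<^sup>+t\<in>{0<..<x}. (\<integral>\<^sup>+s\<in>{t<..<1}. ennreal (norm (f s) powr p * v s) \<partial>lebesgue) \<partial>lborel) \<le>
       ennreal D * (\<integral>\<^sup>+t\<in>{0<..<x}. (\<integral>\<^sup>+s\<in>{t<..<1}. ennreal (rearr g s powr p * v s) \<partial>lborel) \<partial>lborel))"
    using S_majorized_by_decreasing[OF NX] by blast
  define K where "K = (D * C) powr (1 / p) * (CU * 4 powr (1 / p))"
  have K: "K > 0" using C D CU by (simp add: K_def)
  show ?thesis
    unfolding bounded_op_def
  proof (intro exI[of _ K] conjI ballI K)
    fix f assume f: "f \<in> ri_space NX"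
    obtain g where g: "g \<in> M_space" "NX (rearr g) \<le> ennreal (4 powr (1 / p)) * NX (rearr f)"
      and gmaj: "\<And>x. x \<in> {0<..<1} \<Longrightarrow> (\<integral>\<^sup>+t\<in>{0<..<x}. (\<integral>\<^sup>+s\<in>{t<..<1}. ennreal (norm (f s) powr p * v s) \<partial>lebesgue) \<partial>lborel) \<le>
       ennreal D * (\<integral>\<^sup>+t\<in>{0<..<x}. (\<integral>\<^sup>+s\<in>{t<..<1}. ennreal (rearr g s powr p * v s) \<partial>lborel) \<partial>lborel)"
      using dec[OF f] by blast
    have "NX (rearr f) < \<infinity>" using f by (simp add: ri_space_def ri_norm_def)
    then have "ennreal (4 powr (1 / p)) * NX (rearr f) < \<infinity>" by (simp add: ennreal_mult_less_top)
    with g have gX: "g \<in> ri_space NX" by (auto simp: ri_space_def ri_norm_def intro: le_less_trans)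
    have "ext_norm NY (S_op b1 p f) \<le> ennreal ((D * C) powr (1 / p)) * NY (u g)"
      unfolding S_op_eq
    proof (rule ext_norm_HLP[OF p NY _ u_antimono[OF g(1)]])
      show "0 < D * C" using D C by simp
      fix x :: real assume x: "x \<in> {0<..<1}"
      have "(\<integral>\<^sup>+t\<in>{0<..<x}. (\<integral>\<^sup>+s\<in>{t<..<1}. ennreal (norm (f s) powr p * v s) \<partial>lebesgue) \<partial>lborel) \<le>
          ennreal D * (\<integral>\<^sup>+t\<in>{0<..<x}. (\<integral>\<^sup>+s\<in>{t<..<1}. ennreal (rearr g s powr p * v s) \<partial>lborel) \<partial>lborel)"
        by (rule gmaj[OF x])
      also have "\<dots> \<le> ennreal D * (\<integral>\<^sup>+t\<in>{0<..<x}. ennreal (C * u g t powr p) \<partial>lborel)"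
        by (intro mult_left_mono maj g x) simp
      also have "\<dots> = (\<integral>\<^sup>+t. ennreal D * (ennreal (C * u g t powr p) * indicator {0<..<x} t) \<partial>lborel)"
      proof (rule nn_integral_cmult[symmetric])
        have "antimono_on {0<..<x} (\<lambda>t. C * u g t powr p)"
          using u_antimono[OF g(1)] C p x
          by (auto simp: monotone_on_def intro!: mult_left_mono powr_mono2)
        then have "(\<lambda>t. ennreal (C * u g t powr p)) \<in> borel_measurable (restrict_space borel {0<..<x})"
          by (intro measurable_compose[OF antimono_measurable measurable_ennreal])
        then show "(\<lambda>t. ennreal (C * u g t powr p) * indicator {0<..<x} t) \<in> borel_measurable lborel"
          by (subst (asm) borel_measurable_restrict_space_iff_ennreal) auto
      qed
      also have "\<dots> = (\<integral>\<^sup>+t\<in>{0<..<x}. ennreal (D * C * u g t powr p) \<partial>lborel)"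
        using D C by (intro nn_integral_cong) (auto simp: indicator_def ennreal_mult mult.assoc)
      finally show "(\<integral>\<^sup>+t\<in>{0<..<x}. (\<integral>\<^sup>+s\<in>{t<..<1}. ennreal (norm (f s) powr p * v s) \<partial>lebesgue) \<partial>lborel) \<le>
          (\<integral>\<^sup>+t\<in>{0<..<x}. ennreal (D * C * u g t powr p) \<partial>lborel)" .
    qed (rule tail_antimono)
    also have "NY (u g) \<le> ennreal CU * NX (rearr g)"
      using CU(2)[OF gX] unfolding ext_norm_U[OF NY(1) g(1)] ri_norm_def .
    also have "NX (rearr g) \<le> ennreal (4 powr (1 / p)) * NX (rearr f)" by (rule g(2))
    finally have "ext_norm NY (S_op b1 p f) \<le>
        ennreal ((D * C) powr (1 / p)) * (ennreal CU * (ennreal (4 powr (1 / p)) * NX (rearr f)))"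
      by (simp add: mult_left_mono)
    also have "\<dots> = ennreal K * NX (rearr f)"
      using CU by (simp add: K_def ennreal_mult mult.assoc)
    finally show "ext_norm NY (S_op b1 p f) \<le> ennreal K * ri_norm NX f" by (simp add: ri_norm_def)
  qed
qed

end

theorem theorem3p12:
  fixes p :: real and b1 b2 :: "real \<Rightarrow> real" and NY :: "(real \<Rightarrow> real) \<Rightarrow> ennreal"
  assumes "0 < p"
    and "ri_quasi_banach_norm NY" and "p_convex p NY"
    and "(b1, b2) \<in> B_class p"
    and "strict_antimono_on {0<..<1} (\<lambda>\<tau>. b1 \<tau> / b2 \<tau>)"
    and "\<exists>L::real. 0 < L \<and>
      ((\<lambda>s. ennreal (b2 s powr p) *
          (\<integral>\<^sup>+\<tau>\<in>{s<..<1}. ennreal (1 / (\<tau> * b1 \<tau> powr p)) \<partial>lebesgue)) \<longlongrightarrow> ennreal L)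
        (at_right 0)"
  shows "(\<exists>C::real. C > 0 \<and> (\<forall>f\<in>M_space.
            ext_norm NY (S_op b1 p (rearr f)) \<le> ennreal C * ext_norm NY (U_op b1 b2 p f))) \<and>
         (\<forall>NX. ri_quasi_banach_norm NX \<and> p_convex p NX \<and> bounded_op NX NY (U_op b1 b2 p) \<longrightarrow>
            bounded_op NX NY (S_op b1 p))"
proof -
  interpret Bp_pair p b1 b2
    by standard (use assms in auto)
  have NY: "ri_functional NY" using assms by (simp add: ri_quasi_banach_norm_def)
  show ?thesis
    using S_rearr_bounded[OF NY] S_bounded_if_U_bounded[OF NY] assms(3)
    unfolding ri_quasi_banach_norm_def by blast
qed

end
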